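(* For $n\ge 4$ there are $15$ pairwise non-isomorphic uniform flag triangulations of the boundary of the root polytope $P_n$. They are distributed as follows: the lex class and the revlex class each contain $3$ of them; the Simion subclasses of types $a$ and $b$ each contain $4$; and the Simion subclass of type $c$ contains $1$.
   Context: Let $P_n$ be the convex hull of the points $e_j-e_i$ ($i\ne j$) in $\mathbb{R}^{n+1}$, $e_1,\dots,e_{n+1}$ the standard basis. An arrow $(i,j)$, $i\ne j$ in $\{1,\dots,n+1\}$, has tail $i$ and head $j$ and is identified with $e_j-e_i$; $V_n$ is the set of arrows. A uniform flag triangulation of $\partial P_n$ is a flag simplicial complex on $V_n$ which, identifying arrows with vertices, represents a triangulation of $\partial P_n$ (without new vertices), and such that whether a pair $\{(i_1,j_1),(i_2,j_2)\}$ is an edge depends only on the equalities and inequalities among $i_1,i_2,j_1,j_2$. Isomorphism means isomorphism of simplicial complexes. For two arrows with four distinct endpoints $p_1<\dots<p_4$, the type is the $T/H$ word recording whether $p_1,\dots,p_4$ are tails or heads; the pair nests if it joins $\{p_1,p_4\},\{p_2,p_3\}$, crosses if it joins $\{p_1,p_3\},\{p_2,p_4\}$. "Type $W$ nests" means nesting pairs of type $W$ are edges, "does not nest" that they are not; similarly for cross. Classes: the lex class: $THTH$ and $HTHT$ do not nest and $THHT$, $HTTH$ do not cross. The revlex class: $THTH$ and $HTHT$ nest and $THHT$, $HTTH$ cross. The Simion class: exactly one of $THTH$, $HTHT$ nests, and if both $THHT$ and $HTTH$ cross then both $TTHH$ and $HHTT$ nest; its subclass $a$: both $THHT$ and $HTTH$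 do not cross; subclass $b$: exactly one of $THHT$, $HTTH$ crosses; subclass $c$: both $THHT$ and $HTTH$ cross and both $TTHH$ and $HHTT$ nest.
   Formalization: That there are exactly 15 uniform flag triangulations up to isomorphism overall is stated only for n ≥ 5, since for n = 4 further ones exist outside the lex, revlex and Simion classes; the 15 in these classes and their distribution 3, 3, 4, 4, 1 are stated for all n ≥ 4. *)

theory Defs
  imports "HOL-Analysis.Analysis"
begin

text \<open>
  The index set \<open>{1, \<dots>, n + 1}\<close> is a finite linearly ordered type \<open>'n\<close> with \<open>CARD('n) = n + 1\<close>.
  The arrow with tail \<open>i\<close> and head \<open>j\<close> is the pair \<open>(i, j)\<close>.
\<close>

type_synonym 'n arrow = "'n \<times> 'n"

type_synonym 'n arrow_complex = "'n arrow set set"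

definition arrows :: "'n arrow set" where
  "arrows = {(i, j). i \<noteq> j}"

definition arrow_vector :: "'n::finite arrow \<Rightarrow> real ^ 'n" where
  "arrow_vector a = axis (snd a) 1 - axis (fst a) 1"

definition root_polytope :: "(real ^ 'n::finite) set" where
  "root_polytope = convex hull (arrow_vector ` arrows)"


section \<open>Abstract simplicial complexes\<close>

definition simplicial_complex_on :: "'v set \<Rightarrow> 'v set set \<Rightarrow> bool" where
  "simplicial_complex_on V K \<longleftrightarrow>
     (\<forall>\<sigma>\<in>K. finite \<sigma> \<and> \<sigma> \<subseteq> V) \<and>
     (\<forall>v\<in>V. {v} \<in> K) \<and>
     (\<forall>\<sigma>\<in>K. \<forall>\<tau>. \<tau> \<subseteq> \<sigma> \<longrightarrow> \<tau> \<in> K)"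

definition flag_complex_on :: "'v set \<Rightarrow> 'v set set \<Rightarrow> bool" where
  "flag_complex_on V K \<longleftrightarrow>
     simplicial_complex_on V K \<and>
     (\<forall>\<sigma>. finite \<sigma> \<and> \<sigma> \<subseteq> V \<and> (\<forall>a\<in>\<sigma>. \<forall>b\<in>\<sigma>. a \<noteq> b \<longrightarrow> {a, b} \<in> K) \<longrightarrow> \<sigma> \<in> K)"

definition complex_isomorphism :: "('v set set \<times> 'v set set) set" where
  "complex_isomorphism = {(K, L). \<exists>f. bij_betw f (\<Union>K) (\<Union>L) \<and> (\<lambda>\<sigma>. f ` \<sigma>) ` K = L}"


section \<open>Uniform flag triangulations of the boundary\<close>

text \<open>
  Since the polytope is not full-dimensional in the ambient space, its boundary is its relative
  frontier.
\<close>

definition represents_boundary_triangulation :: "'n::finite arrow_complex \<Rightarrow> bool" where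
  "represents_boundary_triangulation K \<longleftrightarrow>
     (\<forall>\<sigma>\<in>K. \<not> affine_dependent (arrow_vector ` \<sigma>)) \<and>
     simplicial_complex ((\<lambda>\<sigma>. convex hull (arrow_vector ` \<sigma>)) ` K) \<and>
     (\<Union>\<sigma>\<in>K. convex hull (arrow_vector ` \<sigma>)) = rel_frontier root_polytope"

definition same_relative_order :: "'n::linorder list \<Rightarrow> 'n list \<Rightarrow> bool" where
  "same_relative_order xs ys \<longleftrightarrow>
     length xs = length ys \<and>
     (\<forall>k<length xs. \<forall>l<length xs.
        (xs ! k = xs ! l \<longleftrightarrow> ys ! k = ys ! l) \<and> (xs ! k < xs ! l \<longleftrightarrow> ys ! k < ys ! l))"

definition uniform_complex :: "'n::linorder arrow_complex \<Rightarrow> bool" where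
  "uniform_complex K \<longleftrightarrow>
     (\<forall>i1 j1 i2 j2 i1' j1' i2' j2'.
        (i1, j1) \<in> arrows \<and> (i2, j2) \<in> arrows \<and> (i1', j1') \<in> arrows \<and> (i2', j2') \<in> arrows \<and>
        same_relative_order [i1, j1, i2, j2] [i1', j1', i2', j2'] \<longrightarrow>
        ({(i1, j1), (i2, j2)} \<in> K \<longleftrightarrow> {(i1', j1'), (i2', j2')} \<in> K))"

definition uniform_flag_triangulation :: "'n::{finite,linorder} arrow_complex \<Rightarrow> bool" where
  "uniform_flag_triangulation K \<longleftrightarrow>
     flag_complex_on arrows K \<and> represents_boundary_triangulation K \<and> uniform_complex K"


section \<open>Types of pairs of arrows\<close>

datatype tail_head = T | H

definition endpoints :: "'n::linorder arrow \<Rightarrow> 'n arrow \<Rightarrow> 'n list" where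
  "endpoints a b = sorted_list_of_set {fst a, snd a, fst b, snd b}"

definition pair_type :: "'n::linorder arrow \<Rightarrow> 'n arrow \<Rightarrow> tail_head list" where
  "pair_type a b = map (\<lambda>p. if p \<in> {fst a, fst b} then T else H) (endpoints a b)"

definition nesting :: "'n::linorder arrow \<Rightarrow> 'n arrow \<Rightarrow> bool" where
  "nesting a b \<longleftrightarrow> (\<exists>p1 p2 p3 p4. endpoints a b = [p1, p2, p3, p4] \<and>
     {{fst a, snd a}, {fst b, snd b}} = {{p1, p4}, {p2, p3}})"

definition crossing :: "'n::linorder arrow \<Rightarrow> 'n arrow \<Rightarrow> bool" where
  "crossing a b \<longleftrightarrow> (\<exists>p1 p2 p3 p4. endpoints a b = [p1, p2, p3, p4] \<and>
     {{fst a, snd a}, {fst b, snd b}} = {{p1, p3}, {p2, p4}})"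

definition nests :: "'n::linorder arrow_complex \<Rightarrow> tail_head list \<Rightarrow> bool" where
  "nests K W \<longleftrightarrow>
     (\<forall>a\<in>arrows. \<forall>b\<in>arrows. nesting a b \<and> pair_type a b = W \<longrightarrow> {a, b} \<in> K)"

definition does_not_nest :: "'n::linorder arrow_complex \<Rightarrow> tail_head list \<Rightarrow> bool" where
  "does_not_nest K W \<longleftrightarrow>
     (\<forall>a\<in>arrows. \<forall>b\<in>arrows. nesting a b \<and> pair_type a b = W \<longrightarrow> {a, b} \<notin> K)"

definition crosses :: "'n::linorder arrow_complex \<Rightarrow> tail_head list \<Rightarrow> bool" where
  "crosses K W \<longleftrightarrow>
     (\<forall>a\<in>arrows. \<forall>b\<in>arrows. crossing a b \<and> pair_type a b = W \<longrightarrow> {a, b} \<in> K)"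

definition does_not_cross :: "'n::linorder arrow_complex \<Rightarrow> tail_head list \<Rightarrow> bool" where
  "does_not_cross K W \<longleftrightarrow>
     (\<forall>a\<in>arrows. \<forall>b\<in>arrows. crossing a b \<and> pair_type a b = W \<longrightarrow> {a, b} \<notin> K)"


section \<open>The lex, revlex and Simion classes\<close>

text \<open>
  These conditions are meant for uniform flag triangulations over at least four indices. By
  uniformity each type then either nests or does not nest, and either crosses or does not cross.
\<close>

definition lex_class :: "'n::linorder arrow_complex \<Rightarrow> bool" where
  "lex_class K \<longleftrightarrow>
     does_not_nest K [T,H,T,H] \<and> does_not_nest K [H,T,H,T] \<and>
     does_not_cross K [T,H,H,T] \<and> does_not_cross K [H,T,T,H]"

definition revlex_class :: "'n::linorder arrow_complex \<Rightarrow> bool" where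
  "revlex_class K \<longleftrightarrow>
     nests K [T,H,T,H] \<and> nests K [H,T,H,T] \<and>
     crosses K [T,H,H,T] \<and> crosses K [H,T,T,H]"

definition simion_class :: "'n::linorder arrow_complex \<Rightarrow> bool" where
  "simion_class K \<longleftrightarrow>
     (nests K [T,H,T,H] \<noteq> nests K [H,T,H,T]) \<and>
     (crosses K [T,H,H,T] \<and> crosses K [H,T,T,H] \<longrightarrow>
        nests K [T,T,H,H] \<and> nests K [H,H,T,T])"

definition simion_class_a :: "'n::linorder arrow_complex \<Rightarrow> bool" where
  "simion_class_a K \<longleftrightarrow>
     simion_class K \<and> does_not_cross K [T,H,H,T] \<and> does_not_cross K [H,T,T,H]"

definition simion_class_b :: "'n::linorder arrow_complex \<Rightarrow> bool" where
  "simion_class_b K \<longleftrightarrow>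
     simion_class K \<and> (crosses K [T,H,H,T] \<noteq> crosses K [H,T,T,H])"

definition simion_class_c :: "'n::linorder arrow_complex \<Rightarrow> bool" where
  "simion_class_c K \<longleftrightarrow>
     simion_class K \<and> crosses K [T,H,H,T] \<and> crosses K [H,T,T,H] \<and>
     nests K [T,T,H,H] \<and> nests K [H,H,T,T]"

text \<open>
  For \<open>n \<ge> 5\<close> every uniform flag triangulation lies in one of the three classes. For \<open>n = 4\<close> this
  fails: if exactly one of \<open>THTH\<close>, \<open>HTHT\<close> nests and both \<open>THHT\<close> and \<open>HTTH\<close> cross, then one
  obtains a triangulation for all four choices for \<open>TTHH\<close>, \<open>HHTT\<close>, because the obstruction to the
  three choices excluded from the Simion class needs six distinct indices. These account for three
  further isomorphism types, 18 in total.
\<close>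

end

theory Submission
  imports Defs
begin

text \<open>
  Midpoints of pairs of arrows show that a uniform flag triangulation consists of the cliques of a
  compatibility relation on arrows, which is determined by six bits. A flag complex triangulates the
  boundary if and only if every boundary point is a convex combination of the vertices of a face in exactly
  one way. In terms of supply at the tails and demand at the heads, this says that every transportation
  problem with disjoint sets of tails and heads has exactly one solution supported on a clique.

  Existence: choose arrow costs for which each incompatible pair can be exchanged against a cheaper
  compatible one, and take a cheapest solution. Uniqueness: the difference of two solutions contains an
  alternating cycle, that is, two clique matchings of the same tails and heads; the balance of tails
  and heads along the order determines which of them belong to backward arrows, and the arrows of one
  direction are then matched either all without crossing or all without nesting.

  The remaining patterns are excluded by prisms and hexagons with five and six indices. Reversal of the order
  and of the arrows leaves 15 patterns, which are told apart by how many arrows have a given number of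
  non-neighbours.
\<close>

section \<open>Compatible arrows and matchings\<close>

text \<open>Six bits suffice because there are six words with two tails and two heads. Such a word
  has two matchings with a common midpoint, exactly one of which is an edge. Pairs sharing a tail or
  sharing a head are always edges; a pair in which the head of one arrow is the tail of the other
  never is, since its midpoint has too small an l1 norm. Indeed the boundary consists of the points
  with coordinate sum 0 and l1 norm 2, so the positive and negative parts of a boundary point are a
  demand and a supply of total 1.

  The obstacle is that these conditions see only alternating cycles of length four. The exchange
  argument shows that a cheapest solution lives on a clique, not that every solution on a clique is
  cheapest, and pairwise conditions alone do not give uniqueness: if exactly one of
  \<open>THTH\<close>, \<open>HTHT\<close> nests, both \<open>THHT\<close> and \<open>HTTH\<close>
  cross and one of \<open>TTHH\<close>, \<open>HHTT\<close> does not nest, then two clique matchings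
  close up to a hexagon. Uniqueness therefore rests on an argument about matchings of arbitrary
  size, not on the costs.\<close>

text \<open>
  The six bits of a pattern say whether \<open>THTH\<close> nests, \<open>HTHT\<close> nests, \<open>THHT\<close> crosses, \<open>HTTH\<close> crosses,
  \<open>TTHH\<close> nests and \<open>HHTT\<close> nests, in this order. Arrows \<open>(i, j)\<close> with \<open>i < j\<close> are called forward,
  the others backward.
\<close>

definition compatible ::
    "bool \<Rightarrow> bool \<Rightarrow> bool \<Rightarrow> bool \<Rightarrow> bool \<Rightarrow> bool \<Rightarrow> 'n::linorder arrow \<Rightarrow> 'n arrow \<Rightarrow> bool" where
  "compatible A B C D E G = (\<lambda>(i, j) (k, l).
     i \<noteq> j \<and> k \<noteq> l \<and> i \<noteq> l \<and> k \<noteq> j \<and>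
     (i = k \<or> j = l \<or>
      (if i < j \<and> k < l then
         if j < k \<or> l < i then \<not> A else E = (i < k \<and> l < j \<or> k < i \<and> j < l)
       else if j < i \<and> l < k then
         if i < l \<or> k < j then \<not> B else G = (j < l \<and> k < i \<or> l < j \<and> i < k)
       else if i < j then
         if j < l then \<not> C else if k < i then \<not> D
         else if i < l then if k < j then A else C else if j < k then B else D
       else
         if l < j then \<not> C else if i < k then \<not> D
         else if k < j then if i < l then A else C else if l < i then B else D)))"

lemma compatible_self: "compatible A B C D E G a a \<longleftrightarrow> a \<in> arrows"
  by (cases a) (auto simp: compatible_def arrows_def)

lemma increasing_quadruple:
  fixes p q r s :: "'a::linorder"
  assumes "p < q" "q < r" "r < s"
  shows "p < r \<and> q < s \<and> p < s \<and> \<not> q < p \<and> \<not> r < q \<and> \<not> s < r \<and> \<not> r < p \<and> \<not> s < q \<and> \<not> s < p \<and>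
    p \<noteq> q \<and> p \<noteq> r \<and> p \<noteq> s \<and> q \<noteq> p \<and> q \<noteq> r \<and> q \<noteq> s \<and> r \<noteq> p \<and> r \<noteq> q \<and> r \<noteq> s \<and> s \<noteq> p \<and> s \<noteq> q \<and> s \<noteq> r"
  using assms less_trans[OF assms(1,2)] less_trans[OF assms(2,3)] less_trans[OF less_trans[OF assms(1,2)] assms(3)]
  by (simp add: less_not_sym less_imp_neq less_imp_neq[symmetric])

text \<open>Each word on \<open>p < q < r < s\<close> has two matchings, and its bit selects one of
  them; this is the exchange property that midpoints force later (\<open>edge_exchange\<close>).
  Both orders of each pair are listed so that case proofs over 24 arrangements become plain
  rewriting.\<close>

lemma compatible_quadruple:
  assumes "p < q" "q < r" "r < s"
  shows "compatible A B C D E G (p, q) (r, s) \<longleftrightarrow> \<not> A" "compatible A B C D E G (r, s) (p, q) \<longleftrightarrow> \<not> A"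
    and "compatible A B C D E G (p, s) (r, q) \<longleftrightarrow> A" "compatible A B C D E G (r, q) (p, s) \<longleftrightarrow> A"
    and "compatible A B C D E G (q, p) (s, r) \<longleftrightarrow> \<not> B" "compatible A B C D E G (s, r) (q, p) \<longleftrightarrow> \<not> B"
    and "compatible A B C D E G (s, p) (q, r) \<longleftrightarrow> B" "compatible A B C D E G (q, r) (s, p) \<longleftrightarrow> B"
    and "compatible A B C D E G (p, q) (s, r) \<longleftrightarrow> \<not> C" "compatible A B C D E G (s, r) (p, q) \<longleftrightarrow> \<not> C"
    and "compatible A B C D E G (p, r) (s, q) \<longleftrightarrow> C" "compatible A B C D E G (s, q) (p, r) \<longleftrightarrow> C"
    and "compatible A B C D E G (q, p) (r, s) \<longleftrightarrow> \<not> D" "compatible A B C D E G (r, s) (q, p) \<longleftrightarrow> \<not> D"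
    and "compatible A B C D E G (r, p) (q, s) \<longleftrightarrow> D" "compatible A B C D E G (q, s) (r, p) \<longleftrightarrow> D"
    and "compatible A B C D E G (p, r) (q, s) \<longleftrightarrow> \<not> E" "compatible A B C D E G (q, s) (p, r) \<longleftrightarrow> \<not> E"
    and "compatible A B C D E G (p, s) (q, r) \<longleftrightarrow> E" "compatible A B C D E G (q, r) (p, s) \<longleftrightarrow> E"
    and "compatible A B C D E G (r, p) (s, q) \<longleftrightarrow> \<not> G" "compatible A B C D E G (s, q) (r, p) \<longleftrightarrow> \<not> G"
    and "compatible A B C D E G (s, p) (r, q) \<longleftrightarrow> G" "compatible A B C D E G (r, q) (s, p) \<longleftrightarrow> G"
  using assms increasing_quadruple[OF assms] unfolding compatible_def by simp_all

lemma compatible_shared: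
  "i \<noteq> j \<Longrightarrow> i \<noteq> l \<Longrightarrow> compatible A B C D E G (i, j) (i, l)"
  "i \<noteq> j \<Longrightarrow> k \<noteq> j \<Longrightarrow> compatible A B C D E G (i, j) (k, j)"
  "\<not> compatible A B C D E G (i, j) (k, i)"
  "\<not> compatible A B C D E G (i, j) (j, k)"
  by (auto simp: compatible_def)

lemma compatible_arrows: "compatible A B C D E G a b \<Longrightarrow> a \<in> arrows \<and> b \<in> arrows"
  by (auto simp: compatible_def arrows_def)

lemma compatible_tails_heads:
  "compatible A B C D E G (i, j) (k, l) \<Longrightarrow> i \<noteq> j \<and> k \<noteq> l \<and> i \<noteq> l \<and> k \<noteq> j"
  by (auto simp: compatible_def)

text \<open>Replaces reasoning with inequalities on four distinct indices by 24 explicit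
  arrangements, which \<open>compatible_quadruple\<close> then evaluates.\<close>

lemma sorted_quadruple_cases:
  fixes i j k l :: "'a::linorder"
  assumes "distinct [i, j, k, l]"
  obtains p q r s where "p < q" "q < r" "r < s" "distinct [p, q, r, s]"
    "(i, j, k, l) \<in> {(p,q,r,s), (p,q,s,r), (p,r,q,s), (p,r,s,q), (p,s,q,r), (p,s,r,q),
       (q,p,r,s), (q,p,s,r), (q,r,p,s), (q,r,s,p), (q,s,p,r), (q,s,r,p),
       (r,p,q,s), (r,p,s,q), (r,q,p,s), (r,q,s,p), (r,s,p,q), (r,s,q,p),
       (s,p,q,r), (s,p,r,q), (s,q,p,r), (s,q,r,p), (s,r,p,q), (s,r,q,p)}"
proof -
  define xs where "xs = sort [i, j, k, l]"
  have len: "length xs = 4" and set: "set xs = {i, j, k, l}" and dist: "distinct xs" and "sorted xs"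
    using assms by (auto simp: xs_def)
  then obtain p q r s where xs: "xs = [p, q, r, s]"
    by (auto simp: numeral_eq_Suc length_Suc_conv)
  have lt: "p < q" "q < r" "r < s"
    using \<open>sorted xs\<close> dist unfolding xs by auto
  have d: "distinct [p, q, r, s]" using dist xs by simp
  have "{i, j, k, l} = {p, q, r, s}" using set xs by auto
  then have m: "i \<in> {p, q, r, s}" "j \<in> {p, q, r, s}" "k \<in> {p, q, r, s}" "l \<in> {p, q, r, s}" by auto
  show thesis
    by (rule that[OF lt d], use m assms in \<open>elim insertE emptyE; simp\<close>)
qed

lemma compatible_sym: "compatible A B C D E G a b \<longleftrightarrow> compatible A B C D E G b a"
proof -
  obtain i j k l where ab: "a = (i, j)" "b = (k, l)" by (cases a, cases b)
  show ?thesis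
  proof (cases "distinct [i, j, k, l]")
    case True
    then show ?thesis
      by (rule sorted_quadruple_cases)
        (unfold ab, elim insertE emptyE Pair_inject; hypsubst_thin; simp only: compatible_quadruple)
  next
    case False
    then consider "i = j" | "k = l" | "i = l" | "k = j" | "i = k" | "j = l" by auto
    then show ?thesis unfolding ab compatible_def prod.case by cases (simp_all, blast+)
  qed
qed

section \<open>Matchings on a linear order and their uniqueness\<close>

text \<open>Disjointness of tails and heads is built in because no face uses an index in both
  roles.\<close>

definition matching :: "('a \<times> 'a) set \<Rightarrow> bool" where
  "matching M \<longleftrightarrow> finite M \<and> inj_on fst M \<and> inj_on snd M \<and> fst ` M \<inter> snd ` M = {}"

lemma matching_distinct:
  assumes "matching M" "(i, j) \<in> M" "(k, l) \<in> M"
  shows "i \<noteq> l" "j \<noteq> k" "(i, j) \<noteq> (k, l) \<Longrightarrow> i \<noteq> k \<and> j \<noteq> l"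
  using assms by (force simp: matching_def inj_on_def)+

lemma matching_fst: "matching M \<Longrightarrow> (i, j) \<in> M \<Longrightarrow> (i, l) \<in> M \<Longrightarrow> j = l"
  using matching_distinct(3)[of M i j i l] by auto

lemma matching_snd: "matching M \<Longrightarrow> (i, j) \<in> M \<Longrightarrow> (k, j) \<in> M \<Longrightarrow> i = k"
  using matching_distinct(3)[of M i j k j] by auto

text \<open>An arrow with both ends at most \<open>x\<close> is counted once on each side and
  cancels, so only the arrows passing over \<open>x\<close> remain, signed by direction. The class
  context makes the result available for the dual order as well.\<close>

lemma (in linorder) matching_balance:
  assumes M: "matching M"
  shows "int (card {i \<in> fst ` M. i \<le> x}) - int (card {j \<in> snd ` M. j \<le> x}) =
    int (card {a \<in> M. fst a \<le> x \<and> x < snd a}) - int (card {a \<in> M. snd a \<le> x \<and> x < fst a})"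
proof -
  have fin: "finite M" and inj: "inj_on fst M" "inj_on snd M"
    using M by (auto simp: matching_def)
  have split: "card {a \<in> M. P a} = card {a \<in> M. P a \<and> Q a} + card {a \<in> M. P a \<and> \<not> Q a}" for P Q
    using fin by (subst card_Un_disjoint[symmetric]) (auto intro!: arg_cong[where f = card])
  have "{i \<in> fst ` M. i \<le> x} = fst ` {a \<in> M. fst a \<le> x}"
       "{j \<in> snd ` M. j \<le> x} = snd ` {a \<in> M. snd a \<le> x}"
    by auto
  then have *: "card {i \<in> fst ` M. i \<le> x} = card {a \<in> M. fst a \<le> x}"
      "card {j \<in> snd ` M. j \<le> x} = card {a \<in> M. snd a \<le> x}"
    using inj by (simp_all add: card_image inj_on_subset)
  have "{a \<in> M. snd a \<le> x \<and> fst a \<le> x} = {a \<in> M. fst a \<le> x \<and> snd a \<le> x}" by auto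
  then show ?thesis
    unfolding * using split[of "\<lambda>a. fst a \<le> x" "\<lambda>a. snd a \<le> x"]
      split[of "\<lambda>a. snd a \<le> x" "\<lambda>a. fst a \<le> x"]
    by (simp add: not_le)
qed

text \<open>
  The heads of the backward arrows are the strict record lows of the balance
  (number of tails minus number of heads so far), which does not depend on the matching.
\<close>

lemma (in linorder) backward_heads_unique:
  assumes M: "matching M" and N: "matching N"
    and eq: "fst ` M = fst ` N" "snd ` M = snd ` N"
    and cover: "\<And>p q t h. (p, q) \<in> M \<Longrightarrow> (t, h) \<in> M \<Longrightarrow> h < t \<Longrightarrow> p < h \<Longrightarrow> \<not> h < q"
      "\<And>p q t h. (p, q) \<in> N \<Longrightarrow> (t, h) \<in> N \<Longrightarrow> h < t \<Longrightarrow> p < h \<Longrightarrow> \<not> h < q"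
    and overlap: "\<And>t h t' h'. (t, h) \<in> M \<Longrightarrow> (t', h') \<in> M \<Longrightarrow> h < t \<Longrightarrow> h' < t' \<Longrightarrow> h < t'"
      "\<And>t h t' h'. (t, h) \<in> N \<Longrightarrow> (t', h') \<in> N \<Longrightarrow> h < t \<Longrightarrow> h' < t' \<Longrightarrow> h < t'"
    and h: "(t, h) \<in> M" "h < t" and h': "(t', h) \<in> N"
  shows "h < t'"
proof (rule ccontr)
  assume neg: "\<not> h < t'"
  define f where "f x = int (card {i \<in> fst ` M. i \<le> x}) - int (card {j \<in> snd ` M. j \<le> x})" for x
  define F where "F R x = int (card {a \<in> R. fst a \<le> x \<and> x < snd a})" for R :: "('a \<times> 'a) set" and x
  define W where "W R x = int (card {a \<in> R. snd a \<le> x \<and> x < fst a})" for R :: "('a \<times> 'a) set" and x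
  define H where "H R x = {a \<in> R. snd a < fst a \<and> snd a \<le> x}" for R :: "('a \<times> 'a) set" and x
  have finM: "finite M" and finN: "finite N" using M N by (auto simp: matching_def)
  have fM: "f x = F M x - W M x" for x
    unfolding f_def F_def W_def by (rule matching_balance[OF M])
  have fN: "f x = F N x - W N x" for x
    unfolding f_def F_def W_def eq by (rule matching_balance[OF N])
  have WH: "W R x \<le> int (card (H R x))" if "finite R" for R x
    unfolding W_def H_def using that by (auto intro!: card_mono)
  \<comment> \<open>No forward arrow passes over a backward head \<open>h0\<close>, while every
    backward arrow whose head is at most \<open>h0\<close> does, by the overlap assumption. So the
    lower bound \<open>f x \<ge> - card (H R x)\<close> is attained at \<open>h0\<close>.\<close>
  have at: "f h0 = - int (card (H R h0))"
    if "R = M \<or> R = N" "(t0, h0) \<in> R" "h0 < t0" for R t0 h0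
  proof -
    have mR: "matching R" using that(1) M N by auto
    have "(p, q) \<in> R \<Longrightarrow> \<not> (p \<le> h0 \<and> h0 < q)" for p q
      using that cover[of p q t0 h0] matching_distinct(1)[OF mR _ that(2), of p q] by (auto simp: le_less)
    then have "{a \<in> R. fst a \<le> h0 \<and> h0 < snd a} = {}" by auto
    then have "F R h0 = 0" unfolding F_def by (simp only: card.empty of_nat_0)
    moreover have "{a \<in> R. snd a \<le> h0 \<and> h0 < fst a} = H R h0"
    proof -
      have "h0 < t" if "(t, h) \<in> R" "h < t" for t h
        using that \<open>R = M \<or> R = N\<close> \<open>(t0, h0) \<in> R\<close> \<open>h0 < t0\<close> overlap by metis
      then show ?thesis
        unfolding H_def by (auto intro: le_less_trans)
    qed
    ultimately show ?thesis
      using fM[of h0] fN[of h0] that(1) unfolding W_def by (elim disjE) simp_all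
  qed
  have hM: "f h = - int (card (H M h))" using at h by blast
  have "f h < f y" if "y < h" for y
  proof -
    have "H M y \<subseteq> H M h" using that by (auto simp: H_def)
    moreover have "(t, h) \<in> H M h - H M y" using h that by (auto simp: H_def)
    ultimately have "H M y \<subset> H M h" by blast
    then have "card (H M y) < card (H M h)" using finM by (intro psubset_card_mono) (auto simp: H_def)
    then show ?thesis
      using fM[of y] WH[OF finM, of y] hM by (simp add: F_def)
  qed
  moreover have "f h < 0"
  proof -
    have "(t, h) \<in> H M h" using h by (auto simp: H_def)
    then have "card (H M h) > 0" using finM by (auto simp: card_gt_0_iff H_def)
    then show ?thesis using hM by simp
  qed
  \<comment> \<open>If \<open>h\<close> were a forward head in \<open>N\<close>, the last backward
    head of \<open>N\<close> before it would already have a balance at most \<open>f h\<close>, and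
    without such a head \<open>f h\<close> is nonnegative. Either contradicts that \<open>h\<close>
    is a strict negative record low.\<close>
  moreover have "f h \<ge> 0 \<or> (\<exists>y<h. f y \<le> f h)"
  proof (cases "H N h = {}")
    case True
    then show ?thesis using fN[of h] WH[OF finN, of h] by (simp add: F_def)
  next
    case False
    define y where "y = Max (snd ` H N h)"
    have fin: "finite (snd ` H N h)" using finN by (auto simp: H_def)
    have "y \<in> snd ` H N h" unfolding y_def using False fin by (intro Max_in) auto
    then obtain s where s: "(s, y) \<in> N" "y < s" "y \<le> h" by (auto simp: H_def)
    have "y \<noteq> h" using s h' neg matching_snd[OF N] by blast
    have "H N y = H N h"
    proof
      show "H N h \<subseteq> H N y"
        using Max_ge[OF fin] by (auto simp: H_def y_def)
    qed (use s in \<open>auto simp: H_def\<close>)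
    then have "f y \<le> f h"
      using at[of N s y] s fN[of h] WH[OF finN, of h] by (simp add: F_def)
    then show ?thesis using s \<open>y \<noteq> h\<close> by (auto simp: le_less)
  qed
  ultimately show False by force
qed

text \<open>The arrow of \<open>N\<close> ending at \<open>j\<close> cannot start after
  \<open>i\<close>, where \<open>N\<close> is contained in \<open>M\<close>; starting before
  \<open>i\<close>, it would cross \<open>(i, j')\<close> if \<open>j < j'\<close>. Noncrossing
  matchings are thus determined from the right.\<close>

lemma noncrossing_step:
  fixes i :: "'a::linorder"
  assumes "matching M" "matching N" "snd ` M = snd ` N"
    and "\<And>p q. (p, q) \<in> M \<Longrightarrow> p < q"
    and "\<And>p q p' q'. (p, q) \<in> N \<Longrightarrow> (p', q') \<in> N \<Longrightarrow> p < p' \<Longrightarrow> p' < q \<Longrightarrow> \<not> q < q'"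
    and "\<And>p q. i < p \<Longrightarrow> (p, q) \<in> N \<Longrightarrow> (p, q) \<in> M"
    and "(i, j) \<in> M" "(i, j') \<in> N"
  shows "\<not> j < j'"
proof
  assume "j < j'"
  have "j \<in> snd ` N" using assms(3,7) by force
  then obtain p where p: "(p, j) \<in> N" by auto
  consider "p = i" | "i < p" | "p < i" by force
  then show False
  proof cases
    case 1
    then show ?thesis using matching_fst[OF assms(2) p[unfolded 1] assms(8)] \<open>j < j'\<close> by simp
  next
    case 2
    then show ?thesis using matching_snd[OF assms(1) assms(6)[OF 2 p] assms(7)] by simp
  next
    case 3
    then show ?thesis using assms(5)[OF p assms(8)] assms(4)[OF assms(7)] \<open>j < j'\<close> by simp
  qed
qed

text \<open>Here the matchings are determined from the left: the arrow of \<open>N\<close> ending at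
  \<open>j\<close> would have to start after \<open>i\<close> and would lie nested inside
  \<open>(i, j')\<close>.\<close>

lemma nonnesting_step:
  fixes i :: "'a::linorder"
  assumes "matching M" "matching N" "snd ` M = snd ` N"
    and "\<And>p q p' q'. (p, q) \<in> N \<Longrightarrow> (p', q') \<in> N \<Longrightarrow> p < p' \<Longrightarrow> \<not> q' < q"
    and "\<And>p q. p < i \<Longrightarrow> (p, q) \<in> N \<Longrightarrow> (p, q) \<in> M"
    and "(i, j) \<in> M" "(i, j') \<in> N"
  shows "\<not> j < j'"
proof
  assume "j < j'"
  have "j \<in> snd ` N" using assms(3,6) by force
  then obtain p where p: "(p, j) \<in> N" by auto
  consider "p = i" | "p < i" | "i < p" by force
  then show False
  proof cases
    case 1
    then show ?thesis using matching_fst[OF assms(2) p[unfolded 1] assms(7)] \<open>j < j'\<close> by simp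
  next
    case 2
    then show ?thesis using matching_snd[OF assms(1) assms(5)[OF 2 p] assms(6)] by simp
  next
    case 3
    then show ?thesis using assms(4)[OF assms(7) p] \<open>j < j'\<close> by simp
  qed
qed

text \<open>At an extremal tail where the two matchings differ, the last one in the noncrossing and
  the first one in the nonnesting case, the step lemma applied in both directions makes the heads
  equal.\<close>

lemma interval_matching_unique:
  fixes M N :: "('a::linorder \<times> 'a) set"
  assumes M: "matching M" and N: "matching N" and eq: "fst ` M = fst ` N" "snd ` M = snd ` N"
    and fwd: "\<And>p q. (p, q) \<in> M \<Longrightarrow> p < q" "\<And>p q. (p, q) \<in> N \<Longrightarrow> p < q"
    and shape: "(\<forall>R\<in>{M, N}. \<forall>(p, q)\<in>R. \<forall>(p', q')\<in>R. p < p' \<longrightarrow> p' < q \<longrightarrow> \<not> q < q') \<or>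
      (\<forall>R\<in>{M, N}. \<forall>(p, q)\<in>R. \<forall>(p', q')\<in>R. p < p' \<longrightarrow> \<not> q' < q)"
  shows "M = N"
proof -
  define X where "X = {i. \<exists>j j'. (i, j) \<in> M \<and> (i, j') \<in> N \<and> j \<noteq> j'}"
  have "X \<subseteq> fst ` M" by (force simp: X_def)
  then have finX: "finite X" using M by (auto simp: matching_def intro: finite_subset)
  have same: "(p, q) \<in> M \<longleftrightarrow> (p, q) \<in> N" if "p \<notin> X" for p q
  proof
    assume "(p, q) \<in> M"
    moreover from this have "p \<in> fst ` N" using eq(1) by force
    ultimately show "(p, q) \<in> N" using that by (auto simp: X_def)
  next
    assume "(p, q) \<in> N"
    moreover from this have "p \<in> fst ` M" using eq(1) by force
    ultimately show "(p, q) \<in> M" using that by (auto simp: X_def)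
  qed
  have "X = {}"
  proof (rule ccontr)
    assume ne: "X \<noteq> {}"
    from shape show False
    proof
      assume nc: "\<forall>R\<in>{M, N}. \<forall>(p, q)\<in>R. \<forall>(p', q')\<in>R. p < p' \<longrightarrow> p' < q \<longrightarrow> \<not> q < q'"
      have "Max X \<in> X" using ne finX by (rule Max_in[rotated])
      then obtain j j' where j: "(Max X, j) \<in> M" "(Max X, j') \<in> N" "j \<noteq> j'" by (auto simp: X_def)
      have notX: "p \<notin> X" if "Max X < p" for p
        using that Max_ge[OF finX] by (auto simp: not_less[symmetric])
      have "\<not> j < j'"
        using noncrossing_step[OF M N eq(2) fwd(1) _ _ j(1,2)] nc same notX by blast
      moreover have "\<not> j' < j"
        using noncrossing_step[OF N M eq(2)[symmetric] fwd(2) _ _ j(2,1)] nc same notX by blast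
      ultimately show False using j(3) by auto
    next
      assume nn: "\<forall>R\<in>{M, N}. \<forall>(p, q)\<in>R. \<forall>(p', q')\<in>R. p < p' \<longrightarrow> \<not> q' < q"
      have "Min X \<in> X" using ne finX by (rule Min_in[rotated])
      then obtain j j' where j: "(Min X, j) \<in> M" "(Min X, j') \<in> N" "j \<noteq> j'" by (auto simp: X_def)
      have notX: "p \<notin> X" if "p < Min X" for p
        using that Min_le[OF finX] by (auto simp: not_less[symmetric])
      have "\<not> j < j'"
        using nonnesting_step[OF M N eq(2) _ _ j(1,2)] nn same notX by blast
      moreover have "\<not> j' < j"
        using nonnesting_step[OF N M eq(2)[symmetric] _ _ j(2,1)] nn same notX by blast
      ultimately show False using j(3) by auto
    qed
  qed
  then show ?thesis using same by auto
qed

lemma matching_subset: "matching M \<Longrightarrow> N \<subseteq> M \<Longrightarrow> matching N"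
  unfolding matching_def by (meson disjoint_iff finite_subset image_mono inj_on_subset subsetD)

lemma matching_converse:
  assumes "matching M"
  shows "matching (M\<inverse>)"
proof -
  have "fst ` (M\<inverse>) = snd ` M" "snd ` (M\<inverse>) = fst ` M" by force+
  then show ?thesis
    using assms matching_fst[OF assms] matching_snd[OF assms] unfolding matching_def
    by (auto intro!: inj_onI)
qed

text \<open>Reversing both the order and every arrow keeps backward arrows backward and exchanges
  tails with heads, so this is \<open>backward_heads_unique\<close> for the converse matchings in
  the dual order.\<close>

lemma backward_tails_unique:
  fixes M N :: "('a::linorder \<times> 'a) set"
  assumes M: "matching M" and N: "matching N"
    and eq: "fst ` M = fst ` N" "snd ` M = snd ` N"
    and cover: "\<And>p q t h. (p, q) \<in> M \<Longrightarrow> (t, h) \<in> M \<Longrightarrow> h < t \<Longrightarrow> p < t \<Longrightarrow> \<not> t < q"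
      "\<And>p q t h. (p, q) \<in> N \<Longrightarrow> (t, h) \<in> N \<Longrightarrow> h < t \<Longrightarrow> p < t \<Longrightarrow> \<not> t < q"
    and overlap: "\<And>t h t' h'. (t, h) \<in> M \<Longrightarrow> (t', h') \<in> M \<Longrightarrow> h < t \<Longrightarrow> h' < t' \<Longrightarrow> h < t'"
      "\<And>t h t' h'. (t, h) \<in> N \<Longrightarrow> (t', h') \<in> N \<Longrightarrow> h < t \<Longrightarrow> h' < t' \<Longrightarrow> h < t'"
    and t: "(t, h) \<in> M" "h < t" and t': "(t, h') \<in> N"
  shows "h' < t"
proof -
  have fs: "fst ` (M\<inverse>) = snd ` M" "snd ` (M\<inverse>) = fst ` M" for M :: "('a \<times> 'a) set"
    by force+
  show ?thesis
    by (rule linorder.backward_heads_unique[OF dual_linorder,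
          where M = "M\<inverse>" and N = "N\<inverse>" and h = t and t = h and t' = h'])
      (simp_all only: fs converse_iff, use assms in \<open>simp_all add: matching_converse\<close>, (metis not_less_iff_gr_or_eq)+)
qed

section \<open>Order constraints inside a clique matching\<close>

locale clique_matching =
  fixes A B C D E G :: bool and R :: "('a::linorder \<times> 'a) set"
  assumes matching: "matching R"
    and clique: "\<And>a b. a \<in> R \<Longrightarrow> b \<in> R \<Longrightarrow> a \<noteq> b \<Longrightarrow> compatible A B C D E G a b"
begin

lemmas distinctness = matching_distinct[OF matching]

lemma backward_overlap:
  assumes "B" "(t, h) \<in> R" "(t', h') \<in> R" "h < t" "h' < t'"
  shows "h < t'"
proof (rule ccontr)
  assume "\<not> h < t'"
  moreover have "t' \<noteq> h" by (rule distinctness(1)[OF assms(3,2)])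
  ultimately have "t' < h" by simp
  then show False
    using clique[OF assms(2,3)] compatible_quadruple(6)[of h' t' h t A B C D E G] assms by (auto dest: less_trans)
qed

lemma forward_overlap:
  assumes "A" "(p, q) \<in> R" "(p', q') \<in> R" "p < q" "p' < q'"
  shows "p < q'"
proof (rule ccontr)
  assume "\<not> p < q'"
  moreover have "p \<noteq> q'" by (rule distinctness(1)[OF assms(2,3)])
  ultimately have "q' < p" by simp
  then show False
    using clique[OF assms(2,3)] compatible_quadruple(2)[of p' q' p q A B C D E G] assms by (auto dest: less_trans)
qed

lemma forward_not_around_backward:
  assumes "\<not> A" "(p, q) \<in> R" "(t, h) \<in> R" "h < t" "p < h"
  shows "\<not> t < q"
  using clique[OF assms(2,3)] compatible_quadruple(3)[of p h t q A B C D E G] assms by (auto dest: less_trans)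

text \<open>A forward arrow over the head of a backward arrow either ends beyond its tail, a nesting
  \<open>THTH\<close>, or below it, a crossing \<open>THHT\<close>. This supplies the
  \<open>cover\<close> hypothesis of \<open>backward_heads_unique\<close>.\<close>

lemma forward_avoids_backward_head:
  assumes "\<not> A" "\<not> C" "(p, q) \<in> R" "(t, h) \<in> R" "h < t" "p < h"
  shows "\<not> h < q"
proof
  assume "h < q"
  then have "\<not> t < q" by (intro forward_not_around_backward[OF assms(1,3,4,5,6)])
  moreover have "q \<noteq> t" using distinctness(2)[OF assms(3,4)] by simp
  ultimately have "q < t" by simp
  then show False
    using clique[OF assms(3,4)] compatible_quadruple(11)[of p h q t A B C D E G] assms \<open>h < q\<close> by (auto dest: less_trans)
qed

text \<open>The mirror image: passing over the tail is a nesting \<open>THTH\<close> or a crossing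
  \<open>HTTH\<close>, as needed for \<open>backward_tails_unique\<close>.\<close>

lemma forward_avoids_backward_tail:
  assumes "\<not> A" "\<not> D" "(p, q) \<in> R" "(t, h) \<in> R" "h < t" "p < t"
  shows "\<not> t < q"
proof
  assume "t < q"
  then have "\<not> p < h" using forward_not_around_backward[OF assms(1,3,4,5)] by blast
  moreover have "p \<noteq> h" by (rule distinctness(1)[OF assms(3,4)])
  ultimately have "h < p" by simp
  then show False
    using clique[OF assms(3,4)] compatible_quadruple(16)[of h p t q A B C D E G] assms \<open>t < q\<close> by (auto dest: less_trans)
qed

lemma forward_tail_before_backward_tail:
  assumes "D" "(p, q) \<in> R" "(t, h) \<in> R" "p < q" "h < t"
  shows "p < t"
proof (rule ccontr)
  assume "\<not> p < t"
  moreover have "p \<noteq> t" using matching_fst[OF matching assms(2)] assms(3-5) less_not_sym by metis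
  ultimately have "t < p" by simp
  then show False
    using clique[OF assms(2,3)] compatible_quadruple(14)[of h t p q A B C D E G] assms by (auto dest: less_trans)
qed

lemma backward_head_before_forward_head:
  assumes "C" "(p, q) \<in> R" "(t, h) \<in> R" "p < q" "h < t"
  shows "h < q"
proof (rule ccontr)
  assume "\<not> h < q"
  moreover have "h \<noteq> q" using matching_snd[OF matching assms(2)] assms(3-5) less_not_sym by metis
  ultimately have "q < h" by simp
  then show False
    using clique[OF assms(2,3)] compatible_quadruple(9)[of p q h t A B C D E G] assms by (auto dest: less_trans)
qed

text \<open>Once arrows of opposite direction can neither cross nor nest with the forward one
  outside, the only overlap left is a backward arrow around a forward one, a nesting
  \<open>HTHT\<close>.\<close>

lemma forward_backward_apart:
  assumes "\<not> A" "\<not> B" "\<not> C" "\<not> D" "(p, q) \<in> R" "(t, h) \<in> R" "p < q" "h < t"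
  shows "q < h \<or> t < p"
proof (rule ccontr)
  assume *: "\<not> (q < h \<or> t < p)"
  have "q \<noteq> h" "p \<noteq> t"
    using matching_snd[OF matching assms(5)] matching_fst[OF matching assms(5)] assms(6-8) less_not_sym
    by metis+
  with * have "h < q" "p < t" by auto
  then have "\<not> p < h" "\<not> t < q"
    using forward_avoids_backward_head[OF assms(1,3,5,6,8)] forward_avoids_backward_tail[OF assms(1,4,5,6,8)]
    by blast+
  moreover have "p \<noteq> h" "q \<noteq> t" using distinctness(1,2)[OF assms(5,6)] by auto
  ultimately have "h < p" "q < t" by auto
  then show False
    using clique[OF assms(5,6)] compatible_quadruple(8)[of h p q t A B C D E G] assms by (auto dest: less_trans)
qed

lemma forward_noncrossing:
  assumes "E" "(p, q) \<in> R" "(p', q') \<in> R" "p < p'" "p' < q"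
  shows "\<not> q < q'"
  using clique[OF assms(2,3)] compatible_quadruple(17)[of p p' q q' A B C D E G] assms by auto

lemma forward_nonnesting:
  assumes "\<not> E" "(p, q) \<in> R" "(p', q') \<in> R" "p' < q'" "p < p'"
  shows "\<not> q' < q"
  using clique[OF assms(2,3)] compatible_quadruple(19)[of p p' q' q A B C D E G] assms by auto

lemma backward_noncrossing:
  assumes "G" "(t, h) \<in> R" "(t', h') \<in> R" "h < h'" "h' < t"
  shows "\<not> t < t'"
  using clique[OF assms(2,3)] compatible_quadruple(21)[of h h' t t' A B C D E G] assms by auto

lemma backward_nonnesting:
  assumes "\<not> G" "(t, h) \<in> R" "(t', h') \<in> R" "h' < t'" "h < h'"
  shows "\<not> t' < t"
  using clique[OF assms(2,3)] compatible_quadruple(23)[of h h' t' t A B C D E G] assms by auto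

end

text \<open>
  Of the patterns in which exactly one of \<open>THTH\<close> and \<open>HTHT\<close> nests, only those with \<open>HTHT\<close> nesting are
  listed, and none in which only \<open>THHT\<close> crosses: reversal and negation reduce the other ones to these.
\<close>

definition good_pattern :: "bool \<Rightarrow> bool \<Rightarrow> bool \<Rightarrow> bool \<Rightarrow> bool \<Rightarrow> bool \<Rightarrow> bool" where
  "good_pattern A B C D E G \<longleftrightarrow>
     \<not> A \<and> \<not> B \<and> \<not> C \<and> \<not> D \<or> A \<and> B \<and> C \<and> D \<or> \<not> A \<and> B \<and> \<not> C \<or> \<not> A \<and> B \<and> C \<and> D \<and> E \<and> G"

section \<open>Two clique matchings on the same tails and heads\<close>

locale clique_matchings =
  M: clique_matching A B C D E G M + N: clique_matching A B C D E G N
  for A B C D E G :: bool and M N :: "('a::linorder \<times> 'a) set" +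
  assumes eq: "fst ` M = fst ` N" "snd ` M = snd ` N"
begin

text \<open>The forward tails and heads are the complements of the backward ones, so both halves
  have prescribed ends. \<open>E\<close> makes the forward half noncrossing or nonnesting, and
  \<open>G\<close> does so for the backward half, which \<open>bw\<close> turns around so that
  \<open>interval_matching_unique\<close> applies to it too.\<close>

lemma matchings_equal:
  assumes "fst ` {(t, h) \<in> M. h < t} = fst ` {(t, h) \<in> N. h < t}"
    and "snd ` {(t, h) \<in> M. h < t} = snd ` {(t, h) \<in> N. h < t}"
  shows "M = N"
proof -
  define fw where "fw R = {(p, q) \<in> R. p < q}" for R :: "('a \<times> 'a) set"
  define bw where "bw R = {(h, t). (t, h) \<in> R \<and> h < t}" for R :: "('a \<times> 'a) set"
  have bw: "fst ` bw R = snd ` {(t, h) \<in> R. h < t}" "snd ` bw R = fst ` {(t, h) \<in> R. h < t}"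
    for R by (force simp: bw_def)+
  have fw: "fst ` fw R = fst ` R - fst ` {(t, h) \<in> R. h < t}"
      "snd ` fw R = snd ` R - snd ` {(t, h) \<in> R. h < t}" if "matching R" for R
  proof -
    show "fst ` fw R = fst ` R - fst ` {(t, h) \<in> R. h < t}"
    proof (intro equalityI subsetI)
      fix p assume "p \<in> fst ` fw R"
      then obtain q where q: "(p, q) \<in> R" "p < q" by (auto simp: fw_def)
      have "\<not> h < p" if "(p, h) \<in> R" for h
        using q matching_fst[OF \<open>matching R\<close> q(1) that] by simp
      then have "p \<notin> fst ` {(t, h) \<in> R. h < t}" by auto
      then show "p \<in> fst ` R - fst ` {(t, h) \<in> R. h < t}" using q(1) by force
    next
      fix p assume p: "p \<in> fst ` R - fst ` {(t, h) \<in> R. h < t}"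
      then obtain q where q: "(p, q) \<in> R" by auto
      with p have "\<not> q < p" by force
      then have "p < q" using matching_distinct(1)[OF that q q] by auto
      then show "p \<in> fst ` fw R" using q by (force simp: fw_def)
    qed
    show "snd ` fw R = snd ` R - snd ` {(t, h) \<in> R. h < t}"
    proof (intro equalityI subsetI)
      fix q assume "q \<in> snd ` fw R"
      then obtain p where p: "(p, q) \<in> R" "p < q" by (auto simp: fw_def)
      have "\<not> q < t" if "(t, q) \<in> R" for t
        using p matching_snd[OF \<open>matching R\<close> p(1) that] by simp
      then have "q \<notin> snd ` {(t, h) \<in> R. h < t}" by auto
      then show "q \<in> snd ` R - snd ` {(t, h) \<in> R. h < t}" using p(1) by force
    next
      fix q assume q: "q \<in> snd ` R - snd ` {(t, h) \<in> R. h < t}"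
      then obtain p where p: "(p, q) \<in> R" by auto
      with q have "\<not> q < p" by force
      then have "p < q" using matching_distinct(1)[OF that p p] by auto
      then show "q \<in> snd ` fw R" using p by (force simp: fw_def)
    qed
  qed
  have mfw: "matching (fw R)" and mbw: "matching (bw R)" if "matching R" for R
  proof -
    have "fw R \<subseteq> R" "bw R \<subseteq> R\<inverse>" by (auto simp: fw_def bw_def)
    then show "matching (fw R)" "matching (bw R)"
      using that matching_subset matching_converse by blast+
  qed
  have "fw M = fw N"
  proof (rule interval_matching_unique)
    show "fst ` fw M = fst ` fw N" "snd ` fw M = snd ` fw N"
      using fw[OF M.matching] fw[OF N.matching] assms eq by simp_all
    show "(\<forall>R\<in>{fw M, fw N}. \<forall>(p, q)\<in>R. \<forall>(p', q')\<in>R. p < p' \<longrightarrow> p' < q \<longrightarrow> \<not> q < q') \<or>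
      (\<forall>R\<in>{fw M, fw N}. \<forall>(p, q)\<in>R. \<forall>(p', q')\<in>R. p < p' \<longrightarrow> \<not> q' < q)"
      using M.forward_noncrossing N.forward_noncrossing M.forward_nonnesting N.forward_nonnesting
      by (cases E) (simp_all add: fw_def, blast+)
  qed (use mfw M.matching N.matching in \<open>auto simp: fw_def\<close>)
  moreover have "bw M = bw N"
  proof (rule interval_matching_unique)
    show "fst ` bw M = fst ` bw N" "snd ` bw M = snd ` bw N"
      using assms by (simp_all add: bw)
    show "(\<forall>R\<in>{bw M, bw N}. \<forall>(p, q)\<in>R. \<forall>(p', q')\<in>R. p < p' \<longrightarrow> p' < q \<longrightarrow> \<not> q < q') \<or>
      (\<forall>R\<in>{bw M, bw N}. \<forall>(p, q)\<in>R. \<forall>(p', q')\<in>R. p < p' \<longrightarrow> \<not> q' < q)"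
      using M.backward_noncrossing N.backward_noncrossing M.backward_nonnesting N.backward_nonnesting
      by (cases G) (simp_all add: bw_def, blast+)
  qed (use mbw M.matching N.matching in \<open>auto simp: bw_def\<close>)
  moreover have "R = fw R \<union> (bw R)\<inverse>" if "matching R" for R
    using matching_distinct(1)[OF that] by (auto simp: fw_def bw_def neq_iff)
  ultimately show "M = N" using M.matching N.matching by metis
qed

end

lemma comparable_card_eq:
  "finite X \<Longrightarrow> finite Y \<Longrightarrow> X \<subseteq> Y \<or> Y \<subseteq> X \<Longrightarrow> card X = card Y \<Longrightarrow> X = Y"
  using card_subset_eq by metis

context clique_matchings
begin

abbreviation "backward R \<equiv> {(t, h) \<in> R. h < t}"

lemma swap: "clique_matchings A B C D E G N M"
  by unfold_locales (use eq in auto)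

lemma finite_backward: "finite (backward M)" "finite (backward N)"
  using M.matching N.matching by (auto simp: matching_def intro: finite_subset)

lemma card_backward:
  "card (fst ` backward M) = card (backward M)" "card (snd ` backward M) = card (backward M)"
proof -
  have "inj_on fst M" "inj_on snd M" using M.matching by (simp_all add: matching_def)
  then have "inj_on fst (backward M)" "inj_on snd (backward M)"
    by (blast intro: inj_on_subset)+
  then show "card (fst ` backward M) = card (backward M)" "card (snd ` backward M) = card (backward M)"
    by (simp_all only: card_image)
qed

text \<open>Only one inclusion is proved here and in the similar lemmas below; interpreting the
  locale with \<open>M\<close> and \<open>N\<close> exchanged gives the other.\<close>

lemma backward_heads_subset:
  assumes "\<not> A" "B" "\<not> C"
  shows "snd ` backward M \<subseteq> snd ` backward N"
proof
  fix h assume "h \<in> snd ` backward M"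
  then obtain t where t: "(t, h) \<in> M" "h < t" by auto
  then obtain t' where t': "(t', h) \<in> N" using eq(2) by force
  have "h < t'"
    using backward_heads_unique[OF M.matching N.matching eq _ _ _ _ t t']
      M.forward_avoids_backward_head[OF assms(1,3)] N.forward_avoids_backward_head[OF assms(1,3)]
      M.backward_overlap[OF assms(2)] N.backward_overlap[OF assms(2)] by blast
  then show "h \<in> snd ` backward N" using t' by force
qed

lemma backward_tails_subset:
  assumes "\<not> A" "B" "\<not> D"
  shows "fst ` backward M \<subseteq> fst ` backward N"
proof
  fix t assume "t \<in> fst ` backward M"
  then obtain h where h: "(t, h) \<in> M" "h < t" by auto
  then obtain h' where h': "(t, h') \<in> N" using eq(1) by force
  have "h' < t"
    using backward_tails_unique[OF M.matching N.matching eq _ _ _ _ h h']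
      M.forward_avoids_backward_tail[OF assms(1,3)] N.forward_avoids_backward_tail[OF assms(1,3)]
      M.backward_overlap[OF assms(2)] N.backward_overlap[OF assms(2)] by blast
  then show "t \<in> fst ` backward N" using h' by force
qed

text \<open>If \<open>HTTH\<close> crosses, the backward tails form a final segment of all tails.\<close>

lemma backward_tails_comparable:
  assumes "D"
  shows "fst ` backward M \<subseteq> fst ` backward N \<or> fst ` backward N \<subseteq> fst ` backward M"
proof (rule ccontr)
  assume "\<not> ?thesis"
  then obtain s t where st: "s \<in> fst ` backward M - fst ` backward N" "t \<in> fst ` backward N - fst ` backward M"
    by blast
  obtain h where h: "(s, h) \<in> M" "h < s" using st by auto
  obtain h' where h': "(t, h') \<in> N" "h' < t" using st by auto
  obtain q where q: "(t, q) \<in> M" using h'(1) eq(1) by force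
  obtain q' where q': "(s, q') \<in> N" using h(1) eq(1) by force
  have "t < q" using q st M.distinctness(1)[OF q q] by (force simp: neq_iff)
  moreover have "s < q'" using q' st N.distinctness(1)[OF q' q'] by (force simp: neq_iff)
  ultimately have "t < s" "s < t"
    using M.forward_tail_before_backward_tail[OF assms q h(1)]
      N.forward_tail_before_backward_tail[OF assms q' h'(1)] h h' by auto
  then show False by simp
qed

text \<open>Dually, if \<open>THHT\<close> crosses, the backward heads form an initial segment of
  all heads, and initial segments are comparable.\<close>

lemma backward_heads_comparable:
  assumes "C"
  shows "snd ` backward M \<subseteq> snd ` backward N \<or> snd ` backward N \<subseteq> snd ` backward M"
proof (rule ccontr)
  assume "\<not> ?thesis"
  then obtain s t where st: "s \<in> snd ` backward M - snd ` backward N" "t \<in> snd ` backward N - snd ` backward M"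
    by blast
  obtain h where h: "(h, s) \<in> M" "s < h" using st by auto
  obtain h' where h': "(h', t) \<in> N" "t < h'" using st by auto
  obtain q where q: "(q, t) \<in> M" using h'(1) eq(2) by force
  obtain q' where q': "(q', s) \<in> N" using h(1) eq(2) by force
  have "q < t" using q st M.distinctness(1)[OF q q] by (force simp: neq_iff)
  moreover have "q' < s" using q' st N.distinctness(1)[OF q' q'] by (force simp: neq_iff)
  ultimately have "s < t" "t < s"
    using M.backward_head_before_forward_head[OF assms q h(1)]
      N.backward_head_before_forward_head[OF assms q' h'(1)] h h' by auto
  then show False by simp
qed

definition "balance x = int (card {i \<in> fst ` M. i \<le> x}) - int (card {j \<in> snd ` M. j \<le> x})"

lemma balance_M: "balance x =
    int (card {a \<in> M. fst a \<le> x \<and> x < snd a}) - int (card {a \<in> M. snd a \<le> x \<and> x < fst a})"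
  unfolding balance_def by (rule matching_balance[OF M.matching])

lemma balance_N: "balance x =
    int (card {a \<in> N. fst a \<le> x \<and> x < snd a}) - int (card {a \<in> N. snd a \<le> x \<and> x < fst a})"
  unfolding balance_def eq by (rule matching_balance[OF N.matching])

text \<open>
  Without overlap of forward and backward arrows, the sign of the balance says which kind of
  arrow passes over a point.
\<close>

lemma apart_backward_subset:
  assumes "\<not> A" "\<not> B" "\<not> C" "\<not> D"
  shows "fst ` backward M \<subseteq> fst ` backward N" "snd ` backward M \<subseteq> snd ` backward N"
proof -
  have fin: "finite M" "finite N" using M.matching N.matching by (auto simp: matching_def)
  show "fst ` backward M \<subseteq> fst ` backward N"
  proof
    fix t assume "t \<in> fst ` backward M"
    then obtain h where h: "(t, h) \<in> M" "h < t" by auto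
    then obtain q where q: "(t, q) \<in> N" using eq(1) by force
    have "q < t"
    proof (rule ccontr)
      assume "\<not> q < t"
      then have "t < q" using N.distinctness(1)[OF q q] by auto
      have "\<not> (p \<le> t \<and> t < q)" if "(p, q) \<in> M" for p q
        using M.forward_backward_apart[OF assms that h(1) _ h(2)] matching_fst[OF M.matching h(1), of q] that h(2)
        by (cases "p = t") (auto dest: less_trans le_less_trans)
      then have "{a \<in> M. fst a \<le> t \<and> t < snd a} = {}" by auto
      \<comment> \<open>Nothing forward passes over \<open>t\<close> in \<open>M\<close>, whereas in
        \<open>N\<close> the forward arrow leaving \<open>t\<close> keeps all backward arrows away,
        which makes the balance positive.\<close>
      then have "balance t \<le> 0" unfolding balance_M by (simp only: card.empty)
      moreover have "\<not> (h' \<le> t \<and> t < t')" if "(t', h') \<in> N" for t' h'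
        using N.forward_backward_apart[OF assms q that \<open>t < q\<close>] \<open>t < q\<close>
        by (metis le_less_trans less_asym)
      then have "{a \<in> N. snd a \<le> t \<and> t < fst a} = {}" by auto
      moreover have "(t, q) \<in> {a \<in> N. fst a \<le> t \<and> t < snd a}" using q \<open>t < q\<close> by simp
      then have "card {a \<in> N. fst a \<le> t \<and> t < snd a} > 0" using fin by (auto simp: card_gt_0_iff)
      ultimately show False by (simp add: balance_N del: Collect_empty_eq)
    qed
    then show "t \<in> fst ` backward N" using q by force
  qed
  show "snd ` backward M \<subseteq> snd ` backward N"
  proof
    fix h assume "h \<in> snd ` backward M"
    then obtain t where t: "(t, h) \<in> M" "h < t" by auto
    then obtain p where p: "(p, h) \<in> N" using eq(2) by force
    have "h < p"
    proof (rule ccontr)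
      assume "\<not> h < p"
      then have "p < h" using N.distinctness(1)[OF p p] by auto
      have "\<not> (p \<le> h \<and> h < q)" if "(p, q) \<in> M" for p q
        using M.forward_backward_apart[OF assms that t(1) _ t(2)] t(2)
        by (metis le_less_trans less_asym)
      then have "{a \<in> M. fst a \<le> h \<and> h < snd a} = {}" by auto
      moreover have "(t, h) \<in> {a \<in> M. snd a \<le> h \<and> h < fst a}" using t by simp
      then have "card {a \<in> M. snd a \<le> h \<and> h < fst a} > 0" using fin by (auto simp: card_gt_0_iff)
      ultimately have "balance h < 0" unfolding balance_M by (simp del: Collect_empty_eq)
      moreover have "\<not> (h' \<le> h \<and> h < t')" if "(t', h') \<in> N" for t' h'
        using N.forward_backward_apart[OF assms p that \<open>p < h\<close>] matching_snd[OF N.matching p, of t'] that \<open>p < h\<close>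
        by (metis le_less_trans less_asym less_trans)
      then have "{a \<in> N. snd a \<le> h \<and> h < fst a} = {}" by auto
      then have "balance h \<ge> 0" unfolding balance_N by (simp del: Collect_empty_eq)
      ultimately show False by simp
    qed
    then show "h \<in> snd ` backward N" using p by force
  qed
qed

text \<open>
  In the last Simion class some point lies under all backward arrows and under no forward arrow,
  so the number of backward arrows is the depth of the balance.
\<close>

lemma balance_attains_backward:
  assumes "\<not> A" "B" "E" "G" "backward M \<noteq> {}"
  shows "\<exists>x. balance x = - int (card (backward M))"
proof -
  have fin: "finite M" using M.matching by (auto simp: matching_def)
  \<comment> \<open>The backward arrows overlap pairwise and do not cross, so they form a nested
    chain; the rightmost head belongs to the innermost one.\<close>
  define h where "h = Max (snd ` backward M)"
  have finh: "finite (snd ` backward M)" using finite_backward by simp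
  have "h \<in> snd ` backward M" unfolding h_def using assms(5) finh by (intro Max_in) auto
  then obtain t where t: "(t, h) \<in> M" "h < t" by auto
  have innermost: "h' \<le> h \<and> t \<le> t'" if "(t', h') \<in> M" "h' < t'" for t' h'
  proof -
    have le: "h' \<le> h" unfolding h_def using that finh by (intro Max_ge) force+
    moreover have "t \<le> t'"
    proof (cases "h' = h")
      case True
      then show ?thesis using matching_snd[OF M.matching t(1)] that(1) by simp
    next
      case False
      then have "h' < h" using le by simp
      then show ?thesis
        using M.backward_noncrossing[OF assms(4) that(1) t(1)]
          M.backward_overlap[OF assms(2) t(1) that(1) t(2) that(2)] by simp
    qed
    ultimately show ?thesis by simp
  qed
  \<comment> \<open>The point sought is \<open>h\<close> itself or, if forward arrows pass over
    \<open>h\<close>, the last of their heads. It stays left of \<open>t\<close> because no forward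
    arrow goes around a backward one.\<close>
  define S where "S = insert h {q. \<exists>p. (p, q) \<in> M \<and> p < h \<and> h < q}"
  have finS: "finite S"
  proof (rule finite_subset)
    show "S \<subseteq> insert h (snd ` M)" by (auto simp: S_def) force
  qed (use fin in simp)
  define x where "x = Max S"
  have "x \<in> S" unfolding x_def using finS by (intro Max_in) (auto simp: S_def)
  have "h \<le> x" unfolding x_def using finS by (intro Max_ge) (auto simp: S_def)
  have "x < t"
  proof (cases "x = h")
    case False
    with \<open>x \<in> S\<close> obtain p where p: "(p, x) \<in> M" "p < h" "h < x" by (auto simp: S_def)
    then show ?thesis
      using M.forward_not_around_backward[OF assms(1) p(1) t p(2)] M.distinctness(1)[OF t(1) p(1)] by simp
  qed (use t in simp)
  have "{a \<in> M. fst a \<le> x \<and> x < snd a} = {}"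
  proof (rule ccontr)
    assume "\<not> ?thesis"
    then obtain p q where pq: "(p, q) \<in> M" "p \<le> x" "x < q" by auto
    have "\<not> p < h"
    proof
      assume "p < h"
      then have "q \<in> S" using pq \<open>h \<le> x\<close> by (auto simp: S_def)
      then show False using Max_ge[OF finS] pq(3) by (auto simp: x_def not_less[symmetric])
    qed
    moreover have "p \<noteq> h" by (rule M.distinctness(1)[OF pq(1) t(1)])
    \<comment> \<open>Starting after \<open>h\<close>, this arrow would cross the forward arrow that
      passes over \<open>h\<close> and ends at \<open>x\<close>.\<close>
    ultimately have "h < p" by simp
    then have "x \<noteq> h" using pq by auto
    with \<open>x \<in> S\<close> obtain p' where p': "(p', x) \<in> M" "p' < h" "h < x" by (auto simp: S_def)
    have "p \<noteq> x" by (rule M.distinctness(1)[OF pq(1) p'(1)])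
    then show False
      using M.forward_noncrossing[OF assms(3) p'(1) pq(1) less_trans[OF p'(2) \<open>h < p\<close>]] pq
      by (auto simp: le_less)
  qed
  moreover have "{a \<in> M. snd a \<le> x \<and> x < fst a} = backward M"
    using innermost \<open>h \<le> x\<close> \<open>x < t\<close> by (fastforce intro: order.trans less_le_trans)
  ultimately show ?thesis by (intro exI[of _ x]) (simp add: balance_M del: Collect_empty_eq)
qed

lemma balance_ge: "balance x \<ge> - int (card (backward N))"
proof -
  have "card {a \<in> N. snd a \<le> x \<and> x < fst a} \<le> card (backward N)"
    using finite_backward by (intro card_mono) auto
  then show ?thesis unfolding balance_N by simp
qed

text \<open>A surplus of backward tails in \<open>N\<close> entails a surplus of backward heads, so
  \<open>N\<close> has an extra tail \<open>i\<close> and an extra head \<open>j\<close>, and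
  overlap gives \<open>j < i\<close>. In \<open>M\<close> both belong to forward arrows. If
  \<open>A\<close> holds, these overlap too and give \<open>i < j\<close>. Otherwise
  \<open>E\<close> and \<open>G\<close> let the shared balance reach minus the number of backward
  arrows of \<open>N\<close>, deeper than \<open>M\<close> allows.\<close>

lemma crossing_backward_subset:
  assumes "B" "C" "D" "A \<or> E \<and> G" and "fst ` backward M \<subseteq> fst ` backward N"
  shows "fst ` backward N \<subseteq> fst ` backward M"
proof (rule ccontr)
  interpret swapped: clique_matchings A B C D E G N M by (rule swap)
  assume not: "\<not> ?thesis"
  then obtain i where i: "i \<in> fst ` backward N" "i \<notin> fst ` backward M" by blast
  have "card (fst ` backward M) < card (fst ` backward N)"
    using assms(5) i finite_backward by (intro psubset_card_mono) auto
  then have less: "card (backward M) < card (backward N)"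
    by (simp add: card_backward swapped.card_backward)
  have "\<not> snd ` backward N \<subseteq> snd ` backward M"
    using card_mono[of "snd ` backward M" "snd ` backward N"] finite_backward less
    by (auto simp: card_backward swapped.card_backward)
  then obtain j where j: "j \<in> snd ` backward N" "j \<notin> snd ` backward M" by blast
  obtain h where h: "(i, h) \<in> N" "h < i" using i by auto
  obtain t where t: "(t, j) \<in> N" "j < t" using j by auto
  have "j < i" by (rule N.backward_overlap[OF assms(1) t(1) h(1) t(2) h(2)])
  show False
  proof (cases A)
    case True
    obtain q where q: "(i, q) \<in> M" using h(1) eq(1) by force
    obtain p where p: "(p, j) \<in> M" using t(1) eq(2) by force
    have "i < q" using q i M.distinctness(1)[OF q q] by (force simp: neq_iff)
    moreover have "p < j" using p j M.distinctness(1)[OF p p] by (force simp: neq_iff)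
    ultimately have "i < j" by (intro M.forward_overlap[OF True q p])
    then show ?thesis using \<open>j < i\<close> by simp
  next
    case False
    then have "E" "G" using assms(4) by auto
    moreover have "backward N \<noteq> {}" using i by auto
    ultimately obtain x where "swapped.balance x = - int (card (backward N))"
      using swapped.balance_attains_backward[OF False assms(1)] by blast
    then show ?thesis using less swapped.balance_ge[of x] by simp
  qed
qed

text \<open>It remains to identify the backward tails and heads. The sign of the balance does this
  for the lex patterns, and record lows from both ends when neither \<open>THHT\<close> nor
  \<open>HTTH\<close> crosses in the Simion case. If only \<open>HTTH\<close> crosses, record lows
  give the heads, and the tails follow because they are comparable and equally many. If both cross,
  comparability and counting give both.\<close>

theorem clique_matching_unique:
  assumes "good_pattern A B C D E G"
  shows "M = N"
proof -
  interpret swapped: clique_matchings A B C D E G N M by (rule swap)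
  have finite_images: "finite (fst ` backward M)" "finite (fst ` backward N)"
      "finite (snd ` backward M)" "finite (snd ` backward N)"
    using finite_backward by auto
  have "fst ` backward M = fst ` backward N \<and> snd ` backward M = snd ` backward N"
  proof (cases "B \<and> C \<and> D")
    case True
    then have "A \<or> E \<and> G" using assms by (auto simp: good_pattern_def)
    then have tails: "fst ` backward M = fst ` backward N"
      using backward_tails_comparable crossing_backward_subset swapped.crossing_backward_subset True
      by blast
    then have "card (snd ` backward M) = card (snd ` backward N)"
      using card_backward(1) swapped.card_backward(1) unfolding card_backward(2) swapped.card_backward(2)
      by simp
    then show ?thesis
      using tails comparable_card_eq[OF finite_images(3,4) backward_heads_comparable] True by simp
  next
    case False
    then consider "\<not> A" "\<not> B" "\<not> C" "\<not> D" | "\<not> A" "B" "\<not> C" "\<not> D" | "\<not> A" "B" "\<not> C" "D"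
      using assms by (auto simp: good_pattern_def)
    then show ?thesis
    proof cases
      case 1
      then show ?thesis using apart_backward_subset swapped.apart_backward_subset by blast
    next
      case 2
      then show ?thesis
        using backward_heads_subset swapped.backward_heads_subset
          backward_tails_subset swapped.backward_tails_subset by blast
    next
      case 3
      then have heads: "snd ` backward M = snd ` backward N"
        using backward_heads_subset swapped.backward_heads_subset by blast
      then have "card (fst ` backward M) = card (fst ` backward N)"
        using card_backward(2) swapped.card_backward(2) unfolding card_backward(1) swapped.card_backward(1)
        by simp
      then show ?thesis
        using heads comparable_card_eq[OF finite_images(1,2) backward_tails_comparable] 3(4) by simp
    qed
  qed
  then show ?thesis by (intro matchings_equal) auto
qed

end

section \<open>Coordinates of points\<close>

lemma arrow_vector_nth:
  "arrow_vector a $ k = (if snd a = k then 1 else 0) - (if fst a = k then 1 else 0)"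
  by (simp add: arrow_vector_def axis_def)

lemma inj_on_arrow_vector: "inj_on arrow_vector arrows"
proof (rule inj_onI)
  fix a b :: "'n::finite arrow"
  assume ab: "a \<in> arrows" "b \<in> arrows" "arrow_vector a = arrow_vector b"
  have "arrow_vector a $ snd a = arrow_vector b $ snd a" "arrow_vector a $ fst a = arrow_vector b $ fst a"
    using ab(3) by simp_all
  then show "a = b"
    using ab(1,2) by (cases a; cases b) (auto simp: arrow_vector_nth arrows_def split: if_splits)
qed

text \<open>Weights live on all pairs, loops included (a loop has the zero vector), so that sums run
  over \<open>UNIV\<close> and split into rows and columns of a transportation table.\<close>

definition point :: "('n::finite arrow \<Rightarrow> real) \<Rightarrow> real ^ 'n" where
  "point l = (\<Sum>a\<in>UNIV. l a *\<^sub>R arrow_vector a)"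

lemma sum_arrows: "(\<Sum>a\<in>UNIV. f a) = (\<Sum>i\<in>UNIV. \<Sum>j\<in>UNIV. f (i, j))"
  for f :: "'n::finite arrow \<Rightarrow> 'b::comm_monoid_add"
  by (simp add: sum.cartesian_product UNIV_Times_UNIV)

lemma sum_arrows': "(\<Sum>a\<in>UNIV. f a) = (\<Sum>j\<in>UNIV. \<Sum>i\<in>UNIV. f (i, j))"
  for f :: "'n::finite arrow \<Rightarrow> 'b::comm_monoid_add"
  unfolding sum_arrows by (rule sum.swap)

lemma point_nth: "point l $ k = (\<Sum>i\<in>UNIV. l (i, k)) - (\<Sum>j\<in>UNIV. l (k, j))"
proof -
  have "point l $ k = (\<Sum>a\<in>UNIV. l a * (if snd a = k then 1 else 0)) - (\<Sum>a\<in>UNIV. l a * (if fst a = k then 1 else 0))"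
    by (simp add: point_def arrow_vector_nth right_diff_distrib sum_subtractf)
  also have "(\<Sum>a\<in>UNIV. l a * (if snd a = k then 1 else 0)) = (\<Sum>i\<in>UNIV. l (i, k))"
    unfolding sum_arrows by (simp add: if_distrib cong: if_cong)
  also have "(\<Sum>a\<in>UNIV. l a * (if fst a = k then 1 else 0)) = (\<Sum>j\<in>UNIV. l (k, j))"
    unfolding sum_arrows' by (simp add: if_distrib cong: if_cong)
  finally show ?thesis .
qed

lemma point_add: "point (\<lambda>a. l a + m a) = point l + point m"
  by (simp add: point_def scaleR_add_left sum.distrib)

lemma point_scale: "point (\<lambda>a. c * l a) = c *\<^sub>R point l"
  by (simp add: point_def scaleR_sum_right)

lemma sum_point: "(\<Sum>k\<in>UNIV. point l $ k) = 0"
  by (simp add: point_nth sum_subtractf sum_arrows[symmetric] sum_arrows'[symmetric])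

lemma convex_hull_arrow_vectors:
  assumes "\<sigma> \<subseteq> arrows"
  shows "convex hull (arrow_vector ` \<sigma>) =
    point ` {l. (\<forall>a. 0 \<le> l a) \<and> {a. l a \<noteq> 0} \<subseteq> \<sigma> \<and> (\<Sum>a\<in>UNIV. l a) = 1}"
proof (intro equalityI subsetI)
  have inj: "inj_on arrow_vector \<sigma>" using inj_on_arrow_vector assms by (rule inj_on_subset)
  fix x assume "x \<in> convex hull (arrow_vector ` \<sigma>)"
  then obtain u where u: "\<forall>v\<in>arrow_vector ` \<sigma>. 0 \<le> u v" "sum u (arrow_vector ` \<sigma>) = 1"
      "(\<Sum>v\<in>arrow_vector ` \<sigma>. u v *\<^sub>R v) = x"
    by (subst (asm) convex_hull_finite) auto
  define l where "l a = (if a \<in> \<sigma> then u (arrow_vector a) else 0)" for a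
  have "(\<Sum>a\<in>UNIV. l a) = sum u (arrow_vector ` \<sigma>)"
    by (simp add: l_def sum.If_cases sum.reindex[OF inj])
  moreover have "point l = (\<Sum>v\<in>arrow_vector ` \<sigma>. u v *\<^sub>R v)"
    by (simp add: point_def l_def sum.If_cases sum.reindex[OF inj] if_distrib[of "\<lambda>c. c *\<^sub>R _"] cong: if_cong)
  ultimately show "x \<in> point ` {l. (\<forall>a. 0 \<le> l a) \<and> {a. l a \<noteq> 0} \<subseteq> \<sigma> \<and> (\<Sum>a\<in>UNIV. l a) = 1}"
    using u by (intro image_eqI[of _ _ l]) (auto simp: l_def)
next
  fix x assume "x \<in> point ` {l. (\<forall>a. 0 \<le> l a) \<and> {a. l a \<noteq> 0} \<subseteq> \<sigma> \<and> (\<Sum>a\<in>UNIV. l a) = 1}"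
  then obtain l where l: "x = point l" "\<forall>a. 0 \<le> l a" "{a. l a \<noteq> 0} \<subseteq> \<sigma>" "(\<Sum>a\<in>UNIV. l a) = 1"
    by auto
  have "(\<Sum>a\<in>\<sigma>. l a) = (\<Sum>a\<in>UNIV. l a)" "(\<Sum>a\<in>\<sigma>. l a *\<^sub>R arrow_vector a) = point l"
    unfolding point_def by (rule sum.mono_neutral_left; use l(3) in auto)+
  then show "x \<in> convex hull (arrow_vector ` \<sigma>)"
    using convex_sum[of \<sigma> "convex hull (arrow_vector ` \<sigma>)" l arrow_vector] l
    by (auto simp: convex_convex_hull hull_inc)
qed

section \<open>The boundary of the root polytope\<close>

text \<open>The demand and, with \<open>neg\<close>, the supply that a point prescribes to the
  transportation problem.\<close>

definition pos :: "real ^ 'n::finite \<Rightarrow> 'n \<Rightarrow> real" where "pos x k = max 0 (x $ k)"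
definition neg :: "real ^ 'n::finite \<Rightarrow> 'n \<Rightarrow> real" where "neg x k = max 0 (- (x $ k))"

lemma sum_pos_neg:
  assumes "(\<Sum>k\<in>UNIV. x $ k) = 0"
  shows "(\<Sum>k\<in>UNIV. pos x k) = (\<Sum>k\<in>UNIV. \<bar>x $ k\<bar>) / 2" "(\<Sum>k\<in>UNIV. neg x k) = (\<Sum>k\<in>UNIV. \<bar>x $ k\<bar>) / 2"
proof -
  have "pos x = (\<lambda>k. (\<bar>x $ k\<bar> + x $ k) / 2)" "neg x = (\<lambda>k. (\<bar>x $ k\<bar> - x $ k) / 2)"
    by (auto simp: pos_def neg_def fun_eq_iff)
  then show "(\<Sum>k\<in>UNIV. pos x k) = (\<Sum>k\<in>UNIV. \<bar>x $ k\<bar>) / 2" "(\<Sum>k\<in>UNIV. neg x k) = (\<Sum>k\<in>UNIV. \<bar>x $ k\<bar>) / 2"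
    using assms by (simp_all only: sum_divide_distrib[symmetric] sum.distrib sum_subtractf) simp_all
qed

text \<open>The product coupling of supply and demand. It is an explicit solution, in general not on
  a clique, and starts the search for a cheapest one.\<close>

definition coupling :: "real ^ 'n::finite \<Rightarrow> 'n arrow \<Rightarrow> real" where
  "coupling x a = neg x (fst a) * pos x (snd a) / (\<Sum>k\<in>UNIV. pos x k)"

lemma coupling:
  assumes "(\<Sum>k\<in>UNIV. x $ k) = 0" "x \<noteq> 0"
  shows "\<forall>a. 0 \<le> coupling x a" "{a. coupling x a \<noteq> 0} \<subseteq> {(i, j). x $ i < 0 \<and> 0 < x $ j}"
    "(\<Sum>a\<in>UNIV. coupling x a) = (\<Sum>k\<in>UNIV. \<bar>x $ k\<bar>) / 2" "point (coupling x) = x"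
proof -
  define s where "s = (\<Sum>k\<in>UNIV. pos x k)"
  have s: "s = (\<Sum>k\<in>UNIV. \<bar>x $ k\<bar>) / 2" "(\<Sum>k\<in>UNIV. neg x k) = s"
    using sum_pos_neg[OF assms(1)] by (simp_all add: s_def)
  obtain k where "x $ k \<noteq> 0" using assms(2) by (auto simp: vec_eq_iff)
  then have "(\<Sum>k\<in>UNIV. \<bar>x $ k\<bar>) > 0" by (intro sum_pos2[of _ k]) auto
  then have "s > 0" using s by simp
  show "\<forall>a. 0 \<le> coupling x a"
  proof
    have "0 \<le> pos x k" "0 \<le> neg x k" for k by (simp_all add: pos_def neg_def)
    then show "0 \<le> coupling x a" for a
      using \<open>s > 0\<close> by (simp add: coupling_def s_def[symmetric])
  qed
  show "{a. coupling x a \<noteq> 0} \<subseteq> {(i, j). x $ i < 0 \<and> 0 < x $ j}"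
    by (auto simp: coupling_def pos_def neg_def max_def split: if_splits)
  have c: "coupling x (i, j) = neg x i * pos x j / s" for i j
    by (simp add: coupling_def s_def)
  have row: "(\<Sum>j\<in>UNIV. coupling x (i, j)) = neg x i" for i
    using \<open>s > 0\<close> by (simp add: c sum_divide_distrib[symmetric] sum_distrib_left[symmetric] s_def[symmetric])
  have col: "(\<Sum>i\<in>UNIV. coupling x (i, j)) = pos x j" for j
    using \<open>s > 0\<close> s(2) by (simp add: c sum_divide_distrib[symmetric] sum_distrib_right[symmetric])
  show "(\<Sum>a\<in>UNIV. coupling x a) = (\<Sum>k\<in>UNIV. \<bar>x $ k\<bar>) / 2"
    unfolding sum_arrows row using s by simp
  show "point (coupling x) = x"
    by (simp add: vec_eq_iff point_nth row col) (simp add: pos_def neg_def max_def)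
qed

lemma root_polytope_eq:
  assumes "CARD('n::finite) \<ge> 2"
  shows "root_polytope = {x :: real ^ 'n. (\<Sum>k\<in>UNIV. x $ k) = 0 \<and> (\<Sum>k\<in>UNIV. \<bar>x $ k\<bar>) \<le> 2}"
proof (intro equalityI subsetI)
  fix x :: "real ^ 'n" assume "x \<in> root_polytope"
  then obtain l where l: "x = point l" "\<forall>a. 0 \<le> l a" "(\<Sum>a\<in>UNIV. l a) = 1"
    unfolding root_polytope_def convex_hull_arrow_vectors[OF order.refl] by blast
  have "\<bar>x $ k\<bar> \<le> (\<Sum>i\<in>UNIV. l (i, k)) + (\<Sum>j\<in>UNIV. l (k, j))" for k
    unfolding l(1) point_nth using l(2) by (intro order.trans[OF abs_triangle_ineq4]) (simp add: sum_nonneg)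
  then have "(\<Sum>k\<in>UNIV. \<bar>x $ k\<bar>) \<le> (\<Sum>k\<in>UNIV. (\<Sum>i\<in>UNIV. l (i, k)) + (\<Sum>j\<in>UNIV. l (k, j)))"
    by (intro sum_mono)
  also have "\<dots> = 2"
    using l(3) by (simp add: sum.distrib sum_arrows[symmetric] sum_arrows'[symmetric])
  finally show "x \<in> {x. (\<Sum>k\<in>UNIV. x $ k) = 0 \<and> (\<Sum>k\<in>UNIV. \<bar>x $ k\<bar>) \<le> 2}"
    by (simp add: l(1) sum_point)
next
  fix x :: "real ^ 'n"
  assume "x \<in> {x. (\<Sum>k\<in>UNIV. x $ k) = 0 \<and> (\<Sum>k\<in>UNIV. \<bar>x $ k\<bar>) \<le> 2}"
  then have x: "(\<Sum>k\<in>UNIV. x $ k) = 0" "(\<Sum>k\<in>UNIV. \<bar>x $ k\<bar>) \<le> 2" by auto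
  obtain i j :: 'n where "i \<noteq> j"
    using assms by (metis One_nat_def card_2_iff' card_le_Suc0_iff_eq finite not_less_eq_eq numeral_2_eq_2 UNIV_I)
  \<comment> \<open>Two opposite arrows with equal weight cancel. They pad the total weight to 1
    without moving the point.\<close>
  define z :: "'n arrow \<Rightarrow> real" where "z a = (if a = (i, j) \<or> a = (j, i) then 1 / 2 else 0)" for a
  have z_sum: "(\<Sum>a\<in>UNIV. z a) = 1"
  proof -
    have "(\<Sum>a\<in>UNIV. z a) = (\<Sum>a\<in>{(i, j), (j, i)}. 1 / 2)"
      unfolding z_def by (rule sum.mono_neutral_cong_right) auto
    then show ?thesis using \<open>i \<noteq> j\<close> by simp
  qed
  have "point z = (\<Sum>a\<in>{(i, j), (j, i)}. (1 / 2) *\<^sub>R arrow_vector a)"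
    unfolding point_def z_def by (rule sum.mono_neutral_cong_right) auto
  then have z_point: "point z = 0"
    using \<open>i \<noteq> j\<close> by (simp add: arrow_vector_def scaleR_diff_right)
  define c where "c = (if x = 0 then \<lambda>a. 0 else coupling x)"
  have c: "\<forall>a. 0 \<le> c a" "{a. c a \<noteq> 0} \<subseteq> arrows" "(\<Sum>a\<in>UNIV. c a) = (\<Sum>k\<in>UNIV. \<bar>x $ k\<bar>) / 2" "point c = x"
  proof -
    have "{(i, j). x $ i < 0 \<and> 0 < x $ j} \<subseteq> arrows" by (auto simp: arrows_def)
    then show "\<forall>a. 0 \<le> c a" "{a. c a \<noteq> 0} \<subseteq> arrows" "(\<Sum>a\<in>UNIV. c a) = (\<Sum>k\<in>UNIV. \<bar>x $ k\<bar>) / 2" "point c = x"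
      using coupling[OF x(1)] by (cases "x = 0"; force simp: c_def point_def)+
  qed
  define r where "r = 1 - (\<Sum>k\<in>UNIV. \<bar>x $ k\<bar>) / 2"
  define l where "l a = c a + r * z a" for a
  have "r \<ge> 0" using x by (simp add: r_def)
  then have "\<forall>a. 0 \<le> l a" using c(1) by (auto simp: l_def z_def)
  moreover have "{a. l a \<noteq> 0} \<subseteq> arrows"
    using c(2) \<open>i \<noteq> j\<close> by (auto simp: l_def z_def arrows_def split: if_splits)
  moreover have "(\<Sum>a\<in>UNIV. l a) = 1"
    by (simp add: l_def sum.distrib sum_distrib_left[symmetric] z_sum c(3) r_def)
  moreover have "point l = x"
    unfolding l_def by (simp add: point_add point_scale z_point c(4))
  ultimately show "x \<in> root_polytope"
    unfolding root_polytope_def convex_hull_arrow_vectors[OF order.refl] by (intro image_eqI[of _ _ l]) auto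
qed

lemma rel_frontier_root_polytope:
  assumes "CARD('n::finite) \<ge> 2"
  shows "rel_frontier root_polytope =
    {x :: real ^ 'n. (\<Sum>k\<in>UNIV. x $ k) = 0 \<and> (\<Sum>k\<in>UNIV. \<bar>x $ k\<bar>) = 2}"
proof -
  let ?P = "root_polytope :: (real ^ 'n) set"
  have closure: "closure ?P = ?P"
    unfolding root_polytope_def
    by (intro closure_closed compact_imp_closed finite_imp_compact_convex_hull) auto
  have zero: "0 \<in> ?P" using assms by (simp add: root_polytope_eq)
  have hull: "affine hull ?P \<subseteq> {x. (\<Sum>k\<in>UNIV. x $ k) = 0}"
  proof (rule hull_minimal)
    show "affine {x :: real ^ 'n. (\<Sum>k\<in>UNIV. x $ k) = 0}"
      by (auto simp: affine_def sum.distrib sum_distrib_left[symmetric])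
  qed (use assms in \<open>auto simp: root_polytope_eq\<close>)
  have "x \<in> rel_interior ?P \<longleftrightarrow> (\<Sum>k\<in>UNIV. \<bar>x $ k\<bar>) < 2" if x: "x \<in> ?P" for x
  proof
    assume less: "(\<Sum>k\<in>UNIV. \<bar>x $ k\<bar>) < 2"
    have "open {y :: real ^ 'n. (\<Sum>k\<in>UNIV. \<bar>y $ k\<bar>) < 2}"
      by (intro open_Collect_less continuous_intros)
    then obtain e where "e > 0" "ball x e \<subseteq> {y. (\<Sum>k\<in>UNIV. \<bar>y $ k\<bar>) < 2}"
      using less by (auto simp: open_contains_ball)
    then have "ball x e \<inter> affine hull ?P \<subseteq> ?P"
      using hull assms by (fastforce simp: root_polytope_eq)
    then show "x \<in> rel_interior ?P" using x \<open>e > 0\<close> by (auto simp: mem_rel_interior_ball)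
  next
    assume "x \<in> rel_interior ?P"
    then obtain e where e: "e > 0" "ball x e \<inter> affine hull ?P \<subseteq> ?P"
      by (auto simp: mem_rel_interior_ball)
    show "(\<Sum>k\<in>UNIV. \<bar>x $ k\<bar>) < 2"
    proof (rule ccontr)
      assume "\<not> ?thesis"
      then have two: "(\<Sum>k\<in>UNIV. \<bar>x $ k\<bar>) = 2" using x assms by (auto simp: root_polytope_eq)
      then have "x \<noteq> 0" by auto
      \<comment> \<open>Stretching away from 0 by the factor \<open>1 + d\<close> moves
        \<open>x\<close> by only \<open>e / 2\<close>, inside the ball, yet pushes the l1 norm above
        2.\<close>
      define d where "d = e / (2 * norm x)"
      have "d > 0" using e \<open>x \<noteq> 0\<close> by (simp add: d_def)
      define y where "y = (1 + d) *\<^sub>R x"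
      have "y = (1 + d) *\<^sub>R x + (- d) *\<^sub>R 0" by (simp add: y_def)
      then have "y \<in> affine hull ?P"
        using mem_affine[OF affine_affine_hull hull_inc[OF x] hull_inc[OF zero], of "1 + d" "- d"] by simp
      moreover have "dist x y = e / 2"
        using \<open>d > 0\<close> \<open>x \<noteq> 0\<close> e by (simp add: y_def dist_norm algebra_simps d_def)
      ultimately have "y \<in> ?P" using e by auto
      then have "(\<Sum>k\<in>UNIV. \<bar>y $ k\<bar>) \<le> 2" using assms by (simp add: root_polytope_eq)
      moreover have "(\<Sum>k\<in>UNIV. \<bar>y $ k\<bar>) = (1 + d) * 2"
        using \<open>d > 0\<close> by (simp add: y_def abs_mult sum_distrib_left[symmetric] two)
      ultimately show False using \<open>d > 0\<close> by simp
    qed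
  qed
  then show ?thesis
    unfolding rel_frontier_def closure using assms by (auto simp: root_polytope_eq)
qed

section \<open>Barycentric coordinates and the bijection criterion\<close>

text \<open>The geometric realization of \<open>K\<close>. Triangulating the boundary will mean that
  \<open>point\<close> maps it bijectively onto the relative frontier.\<close>

definition coordinates :: "'n::finite arrow_complex \<Rightarrow> ('n arrow \<Rightarrow> real) set" where
  "coordinates K = {l. (\<forall>a. 0 \<le> l a) \<and> {a. l a \<noteq> 0} \<in> K \<and> (\<Sum>a\<in>UNIV. l a) = 1}"

lemma simplicial_complex_onD:
  assumes "simplicial_complex_on V K"
  shows "\<sigma> \<in> K \<Longrightarrow> \<sigma> \<subseteq> V" "\<sigma> \<in> K \<Longrightarrow> finite \<sigma>" "\<sigma> \<in> K \<Longrightarrow> \<tau> \<subseteq> \<sigma> \<Longrightarrow> \<tau> \<in> K"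
  using assms by (auto simp: simplicial_complex_on_def)

lemma convex_hull_coordinates:
  assumes "simplicial_complex_on arrows K" "\<sigma> \<in> K"
  shows "convex hull (arrow_vector ` \<sigma>) = point ` {l \<in> coordinates K. {a. l a \<noteq> 0} \<subseteq> \<sigma>}"
proof -
  have "{l. (\<forall>a. 0 \<le> l a) \<and> {a. l a \<noteq> 0} \<subseteq> \<sigma> \<and> (\<Sum>a\<in>UNIV. l a) = 1} =
      {l \<in> coordinates K. {a. l a \<noteq> 0} \<subseteq> \<sigma>}"
    using simplicial_complex_onD[OF assms(1)] assms(2) by (auto simp: coordinates_def)
  then show ?thesis
    using convex_hull_arrow_vectors[of \<sigma>] simplicial_complex_onD(1)[OF assms] by simp
qed

lemma Union_convex_hulls:
  assumes "simplicial_complex_on arrows K"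
  shows "(\<Union>\<sigma>\<in>K. convex hull (arrow_vector ` \<sigma>)) = point ` coordinates K"
  using assms by (auto simp: convex_hull_coordinates) (auto simp: coordinates_def)

text \<open>
  A nontrivial affine relation on a face can be added in a small multiple to its barycentric weights,
  contradicting injectivity.
\<close>

lemma affine_independent_if_inj:
  assumes K: "simplicial_complex_on arrows K" and inj: "inj_on point (coordinates K)" and "\<sigma> \<in> K"
  shows "\<not> affine_dependent (arrow_vector ` \<sigma>)"
proof
  have fin: "finite \<sigma>" and sub: "\<sigma> \<subseteq> arrows" using simplicial_complex_onD[OF K] \<open>\<sigma> \<in> K\<close> by auto
  have inj_v: "inj_on arrow_vector \<sigma>" using inj_on_arrow_vector sub by (rule inj_on_subset)
  assume "affine_dependent (arrow_vector ` \<sigma>)"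
  then obtain u where u: "sum u (arrow_vector ` \<sigma>) = 0" "\<exists>v\<in>arrow_vector ` \<sigma>. u v \<noteq> 0"
      "(\<Sum>v\<in>arrow_vector ` \<sigma>. u v *\<^sub>R v) = 0"
    using fin by (auto simp: affine_dependent_explicit_finite)
  define w where "w a = (if a \<in> \<sigma> then u (arrow_vector a) else 0)" for a
  have w: "(\<Sum>a\<in>UNIV. w a) = 0" "point w = 0"
    using u(1,3) by (simp_all add: point_def w_def sum.If_cases sum.reindex[OF inj_v]
      if_distrib[of "\<lambda>c. c *\<^sub>R _"] cong: if_cong)
  obtain b where b: "b \<in> \<sigma>" "w b \<noteq> 0" using u(2) by (auto simp: w_def)
  define m where "m = real (card \<sigma>)"
  have "m > 0" using b(1) fin by (auto simp: m_def card_gt_0_iff)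
  define W where "W = (\<Sum>a\<in>UNIV. \<bar>w a\<bar>)"
  have "W > 0" unfolding W_def using b by (intro sum_pos2[of _ b]) auto
  have wW: "\<bar>w a\<bar> \<le> W" for a unfolding W_def by (rule member_le_sum) auto
  define l where "l c a = (if a \<in> \<sigma> then 1 / m else 0) + c * w a" for c a
  \<comment> \<open>The weights start at \<open>1 / m\<close> and every \<open>w a\<close> is at
    most \<open>W\<close> in absolute value, so a multiple up to \<open>1 / (m * W)\<close> keeps
    them nonnegative.\<close>
  have "l c \<in> coordinates K" if "\<bar>c\<bar> \<le> 1 / (m * W)" for c
  proof -
    have "0 \<le> l c a" for a
    proof (cases "a \<in> \<sigma>")
      case True
      have "\<bar>c * w a\<bar> \<le> 1 / (m * W) * W"
        unfolding abs_mult using that wW \<open>m > 0\<close> \<open>W > 0\<close> by (intro mult_mono) auto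
      then have "\<bar>c * w a\<bar> \<le> 1 / m" using \<open>W > 0\<close> by simp
      then show ?thesis using True by (simp add: l_def)
    qed (simp add: l_def w_def)
    moreover have "{a. l c a \<noteq> 0} \<subseteq> \<sigma>" by (auto simp: l_def w_def split: if_splits)
    then have "{a. l c a \<noteq> 0} \<in> K" using simplicial_complex_onD(3)[OF K \<open>\<sigma> \<in> K\<close>] by blast
    moreover have "(\<Sum>a\<in>UNIV. l c a) = 1"
      using w(1) \<open>m > 0\<close>
      by (simp add: l_def sum.distrib sum_distrib_left[symmetric] sum.If_cases m_def[symmetric])
    ultimately show ?thesis by (simp add: coordinates_def)
  qed
  moreover have "point (l c) = point (l 0)" for c
    unfolding l_def by (simp add: point_add point_scale w(2))
  moreover have "\<bar>1 / (m * W)\<bar> \<le> 1 / (m * W)" "\<bar>0\<bar> \<le> 1 / (m * W)"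
    using \<open>m > 0\<close> \<open>W > 0\<close> by simp_all
  ultimately have "l (1 / (m * W)) = l 0" using inj by (meson inj_onD)
  then have "l (1 / (m * W)) b = l 0 b" by (rule fun_cong)
  then have "1 / (m * W) * w b = 0" by (simp add: l_def)
  then show False using b \<open>m > 0\<close> \<open>W > 0\<close> by simp
qed

text \<open>Injectivity turns the intersection of two simplices into a condition on supports: they
  meet in the simplex of their common vertices.\<close>

lemma represents_if_bij_betw:
  assumes K: "simplicial_complex_on arrows K"
    and bij: "bij_betw point (coordinates K) (rel_frontier root_polytope)"
  shows "represents_boundary_triangulation K"
  unfolding represents_boundary_triangulation_def
proof (intro conjI ballI)
  have inj: "inj_on point (coordinates K)" using bij by (simp add: bij_betw_def)
  show indep: "\<not> affine_dependent (arrow_vector ` \<sigma>)" if "\<sigma> \<in> K" for \<sigma>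
    by (rule affine_independent_if_inj[OF K inj that])
  show "simplicial_complex ((\<lambda>\<sigma>. convex hull (arrow_vector ` \<sigma>)) ` K)"
    unfolding simplicial_complex_def
  proof (intro conjI ballI allI impI)
    show "finite ((\<lambda>\<sigma>. convex hull (arrow_vector ` \<sigma>)) ` K)" by simp
  next
    fix S assume "S \<in> (\<lambda>\<sigma>. convex hull (arrow_vector ` \<sigma>)) ` K"
    then obtain \<sigma> where \<sigma>: "\<sigma> \<in> K" "S = convex hull (arrow_vector ` \<sigma>)" by auto
    have "int (card (arrow_vector ` \<sigma>)) - 1 simplex S"
      unfolding simplex_def using indep[OF \<sigma>(1)] \<sigma>(2) by (intro exI[of _ "arrow_vector ` \<sigma>"]) auto
    then show "\<exists>n. n simplex S" by blast
  next
    fix F S assume "S \<in> (\<lambda>\<sigma>. convex hull (arrow_vector ` \<sigma>)) ` K \<and> F face_of S"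
    then obtain \<sigma> where \<sigma>: "\<sigma> \<in> K" "F face_of convex hull (arrow_vector ` \<sigma>)" by auto
    then obtain c where c: "c \<subseteq> arrow_vector ` \<sigma>" "F = convex hull c"
      using face_of_convex_hull_affine_independent[OF indep[OF \<sigma>(1)]] by blast
    then obtain \<tau> where "\<tau> \<subseteq> \<sigma>" "c = arrow_vector ` \<tau>" by (meson subset_imageE)
    then show "F \<in> (\<lambda>\<sigma>. convex hull (arrow_vector ` \<sigma>)) ` K"
      unfolding c(2) by (auto intro: simplicial_complex_onD(3)[OF K \<sigma>(1)])
  next
    fix S S' assume "S \<in> (\<lambda>\<sigma>. convex hull (arrow_vector ` \<sigma>)) ` K \<and> S' \<in> (\<lambda>\<sigma>. convex hull (arrow_vector ` \<sigma>)) ` K"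
    then obtain \<sigma> \<tau> where \<sigma>: "\<sigma> \<in> K" "S = convex hull (arrow_vector ` \<sigma>)"
        and \<tau>: "\<tau> \<in> K" "S' = convex hull (arrow_vector ` \<tau>)" by auto
    have "\<sigma> \<inter> \<tau> \<in> K" using simplicial_complex_onD(3)[OF K \<sigma>(1)] by blast
    have "S \<inter> S' = point ` ({l \<in> coordinates K. {a. l a \<noteq> 0} \<subseteq> \<sigma>} \<inter> {l \<in> coordinates K. {a. l a \<noteq> 0} \<subseteq> \<tau>})"
      unfolding \<sigma>(2) \<tau>(2) convex_hull_coordinates[OF K \<sigma>(1)] convex_hull_coordinates[OF K \<tau>(1)]
      by (rule inj_on_image_Int[OF inj, symmetric]) auto
    also have "\<dots> = convex hull (arrow_vector ` (\<sigma> \<inter> \<tau>))"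
      unfolding convex_hull_coordinates[OF K \<open>\<sigma> \<inter> \<tau> \<in> K\<close>] by (rule arg_cong[where f = "image point"]) auto
    finally have Int: "S \<inter> S' = convex hull (arrow_vector ` (\<sigma> \<inter> \<tau>))" .
    show "S \<inter> S' face_of S"
      unfolding Int unfolding \<sigma>(2) face_of_convex_hull_affine_independent[OF indep[OF \<sigma>(1)]]
      by (intro exI[of _ "arrow_vector ` (\<sigma> \<inter> \<tau>)"]) auto
  qed
  show "(\<Union>\<sigma>\<in>K. convex hull (arrow_vector ` \<sigma>)) = rel_frontier root_polytope"
    using bij by (simp add: Union_convex_hulls[OF K] bij_betw_def)
qed

text \<open>A point is in the relative interior of the simplex spanned by the support of its
  weights, and simplices of a complex that share a relative interior point coincide. Two weight
  vectors of one point thus have the same support, and affine independence makes them equal.\<close>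

lemma bij_betw_if_represents:
  assumes K: "simplicial_complex_on arrows K" and rep: "represents_boundary_triangulation K"
  shows "bij_betw point (coordinates K) (rel_frontier root_polytope)"
proof -
  have indep: "\<not> affine_dependent (arrow_vector ` \<sigma>)" if "\<sigma> \<in> K" for \<sigma>
    using rep that by (simp add: represents_boundary_triangulation_def)
  have complex: "simplicial_complex ((\<lambda>\<sigma>. convex hull (arrow_vector ` \<sigma>)) ` K)"
    using rep by (simp add: represents_boundary_triangulation_def)
  define face where "face l = convex hull (arrow_vector ` {a. l a \<noteq> 0})" for l :: "'a arrow \<Rightarrow> real"
  have rel_interior: "point l \<in> rel_interior (face l)" if l: "l \<in> coordinates K" for l
  proof -
    let ?s = "{a. l a \<noteq> 0}"
    have s: "?s \<in> K" using l by (simp add: coordinates_def)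
    have inj: "inj_on arrow_vector ?s"
      using inj_on_arrow_vector simplicial_complex_onD(1)[OF K s] by (rule inj_on_subset)
    define u where "u v = l (inv_into ?s arrow_vector v)" for v
    have u: "u (arrow_vector a) = l a" if "l a \<noteq> 0" for a
      using inv_into_f_f[OF inj] that by (simp add: u_def)
    have "(\<Sum>v\<in>arrow_vector ` ?s. u v) = (\<Sum>a\<in>?s. l a)"
      unfolding sum.reindex[OF inj] by (rule sum.cong) (auto simp: u)
    also have "\<dots> = (\<Sum>a\<in>UNIV. l a)" by (rule sum.mono_neutral_left) auto
    also have "\<dots> = 1" using l by (simp add: coordinates_def)
    finally have "(\<Sum>v\<in>arrow_vector ` ?s. u v) = 1" .
    moreover have "(\<Sum>v\<in>arrow_vector ` ?s. u v *\<^sub>R v) = (\<Sum>a\<in>?s. l a *\<^sub>R arrow_vector a)"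
      unfolding sum.reindex[OF inj] by (rule sum.cong) (auto simp: u)
    moreover have "\<dots> = point l" unfolding point_def by (rule sum.mono_neutral_left) auto
    moreover have "\<forall>v\<in>arrow_vector ` ?s. 0 < u v"
      using l by (auto simp: u coordinates_def less_le)
    ultimately show ?thesis
      unfolding face_def rel_interior_convex_hull_explicit[OF indep[OF s]] by auto
  qed
  have subset: "{a. l a \<noteq> 0} \<subseteq> {a. m a \<noteq> 0}"
    if l: "l \<in> coordinates K" and m: "m \<in> coordinates K" and eq: "point l = point m" for l m
  proof
    have s: "{a. l a \<noteq> 0} \<in> K" "{a. m a \<noteq> 0} \<in> K" using l m by (auto simp: coordinates_def)
    have faces: "(face l \<inter> face m) face_of face l" "(face m \<inter> face l) face_of face m"
      using complex s unfolding simplicial_complex_def face_def by blast+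
    have "point l \<in> face l \<inter> face m"
      using rel_interior[OF l] rel_interior[OF m] rel_interior_subset eq by force
    then have "face l \<subseteq> face m" "face m \<subseteq> face l"
      using subset_of_face_of[OF faces(1) order.refl] subset_of_face_of[OF faces(2) order.refl]
        rel_interior[OF l] rel_interior[OF m] eq by auto
    then have "face l = face m" by simp
    then have same: "arrow_vector ` {a. l a \<noteq> 0} = arrow_vector ` {a. m a \<noteq> 0}"
      unfolding face_def
      using extreme_point_of_convex_hull_affine_independent[OF indep[OF s(1)]]
        extreme_point_of_convex_hull_affine_independent[OF indep[OF s(2)]] by auto
    fix a assume "a \<in> {a. l a \<noteq> 0}"
    then show "a \<in> {a. m a \<noteq> 0}"
      using same simplicial_complex_onD(1)[OF K s(1)] simplicial_complex_onD(1)[OF K s(2)]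
        inj_on_image_eq_iff[OF inj_on_arrow_vector] by blast
  qed
  have "inj_on point (coordinates K)"
  proof (rule inj_onI, rule ccontr)
    fix l m assume l: "l \<in> coordinates K" and m: "m \<in> coordinates K"
      and eq: "point l = point m" and "l \<noteq> m"
    let ?s = "{a. l a \<noteq> 0}"
    have s: "?s \<in> K" using l by (simp add: coordinates_def)
    have supp: "{a. m a \<noteq> 0} = ?s" using subset[OF l m eq] subset[OF m l] eq by auto
    have inj: "inj_on arrow_vector ?s"
      using inj_on_arrow_vector simplicial_complex_onD(1)[OF K s] by (rule inj_on_subset)
    define u where "u v = l (inv_into ?s arrow_vector v) - m (inv_into ?s arrow_vector v)" for v
    have u: "u (arrow_vector a) = l a - m a" if "l a \<noteq> 0" for a
      using inv_into_f_f[OF inj] that by (simp add: u_def)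
    have zero: "m a = 0" if "l a = 0" for a using supp that by blast
    have "(\<Sum>v\<in>arrow_vector ` ?s. u v) = (\<Sum>a\<in>?s. l a - m a)"
      unfolding sum.reindex[OF inj] by (rule sum.cong) (auto simp: u)
    also have "\<dots> = (\<Sum>a\<in>UNIV. l a - m a)" by (rule sum.mono_neutral_left) (auto simp: zero)
    also have "\<dots> = 0" using l m by (simp add: coordinates_def sum_subtractf)
    finally have "(\<Sum>v\<in>arrow_vector ` ?s. u v) = 0" .
    moreover have "(\<Sum>v\<in>arrow_vector ` ?s. u v *\<^sub>R v) = (\<Sum>a\<in>?s. (l a - m a) *\<^sub>R arrow_vector a)"
      unfolding sum.reindex[OF inj] by (rule sum.cong) (auto simp: u)
    moreover have "\<dots> = (\<Sum>a\<in>UNIV. (l a - m a) *\<^sub>R arrow_vector a)"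
      by (rule sum.mono_neutral_left) (auto simp: zero)
    moreover have "\<dots> = 0" using eq by (simp add: point_def scaleR_diff_left sum_subtractf)
    moreover obtain a where "l a \<noteq> m a" using \<open>l \<noteq> m\<close> by (meson ext)
    then have "l a \<noteq> 0" using zero by metis
    then have "\<exists>v\<in>arrow_vector ` ?s. u v \<noteq> 0" 
      using u[of a] \<open>l a \<noteq> m a\<close> by (intro bexI[of _ "arrow_vector a"]) auto
    ultimately have "affine_dependent (arrow_vector ` ?s)"
      by (subst affine_dependent_explicit_finite) auto
    then show False using indep[OF s] by simp
  qed
  moreover have "point ` coordinates K = rel_frontier root_polytope"
    using rep by (simp add: represents_boundary_triangulation_def Union_convex_hulls[OF K, symmetric])
  ultimately show ?thesis by (simp add: bij_betw_def)
qed

section \<open>Pattern complexes\<close>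

text \<open>The quantifiers include \<open>a = b\<close>, and compatibility with itself excludes
  loops, so every face consists of arrows.\<close>

definition pattern_complex ::
    "bool \<Rightarrow> bool \<Rightarrow> bool \<Rightarrow> bool \<Rightarrow> bool \<Rightarrow> bool \<Rightarrow> 'n::{finite,linorder} arrow_complex" where
  "pattern_complex A B C D E G = {\<sigma>. \<forall>a\<in>\<sigma>. \<forall>b\<in>\<sigma>. compatible A B C D E G a b}"

lemma edge_pattern_complex: "{a, b} \<in> pattern_complex A B C D E G \<longleftrightarrow> compatible A B C D E G a b"
proof
  assume ab: "compatible A B C D E G a b"
  then have "compatible A B C D E G b a" by (rule compatible_sym[THEN iffD1])
  moreover have "compatible A B C D E G a a" "compatible A B C D E G b b"
    unfolding compatible_self using compatible_arrows[OF ab] by blast+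
  ultimately show "{a, b} \<in> pattern_complex A B C D E G"
    using ab unfolding pattern_complex_def by blast
qed (simp add: pattern_complex_def)

lemma simplicial_pattern_complex: "simplicial_complex_on arrows (pattern_complex A B C D E G)"
proof -
  have "\<sigma> \<subseteq> arrows" if "\<sigma> \<in> pattern_complex A B C D E G" for \<sigma>
  proof
    fix a assume "a \<in> \<sigma>"
    then have "compatible A B C D E G a a" using that unfolding pattern_complex_def by blast
    then show "a \<in> arrows" by (simp only: compatible_self)
  qed
  moreover have "{v} \<in> pattern_complex A B C D E G" if "v \<in> arrows" for v
    using that by (simp add: pattern_complex_def compatible_self)
  moreover have "\<tau> \<in> pattern_complex A B C D E G" if "\<sigma> \<in> pattern_complex A B C D E G" "\<tau> \<subseteq> \<sigma>" for \<sigma> \<tau>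
    using that unfolding pattern_complex_def by blast
  ultimately show ?thesis unfolding simplicial_complex_on_def by (meson finite)
qed

lemma Union_pattern_complex: "\<Union>(pattern_complex A B C D E G) = (arrows :: 'n::{finite,linorder} arrow set)"
proof
  show "\<Union>(pattern_complex A B C D E G) \<subseteq> (arrows :: 'n arrow set)"
    by (rule Union_least) (rule simplicial_complex_onD(1)[OF simplicial_pattern_complex])
  show "(arrows :: 'n arrow set) \<subseteq> \<Union>(pattern_complex A B C D E G)"
  proof
    fix a :: "'n arrow" assume "a \<in> arrows"
    then have "{a} \<in> pattern_complex A B C D E G"
      using edge_pattern_complex[of a a] by (simp add: compatible_self)
    then show "a \<in> \<Union>(pattern_complex A B C D E G)" by blast
  qed
qed

lemma flag_pattern_complex: "flag_complex_on arrows (pattern_complex A B C D E G :: 'n::{finite,linorder} arrow_complex)"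
  unfolding flag_complex_on_def edge_pattern_complex
proof (intro conjI allI impI)
  fix \<sigma> :: "'n arrow set"
  assume \<sigma>: "finite \<sigma> \<and> \<sigma> \<subseteq> arrows \<and> (\<forall>a\<in>\<sigma>. \<forall>b\<in>\<sigma>. a \<noteq> b \<longrightarrow> compatible A B C D E G a b)"
  have "compatible A B C D E G a b" if "a \<in> \<sigma>" "b \<in> \<sigma>" for a b
    using that \<sigma> by (cases "a = b") (auto simp only: compatible_self)
  then show "\<sigma> \<in> pattern_complex A B C D E G" by (simp add: pattern_complex_def)
qed (rule simplicial_pattern_complex)

lemma uniform_pattern_complex: "uniform_complex (pattern_complex A B C D E G :: 'n::{finite,linorder} arrow_complex)"
  unfolding uniform_complex_def edge_pattern_complex
proof (intro allI impI)
  fix i1 j1 i2 j2 i1' j1' i2' j2' :: 'n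
  assume "(i1, j1) \<in> arrows \<and> (i2, j2) \<in> arrows \<and> (i1', j1') \<in> arrows \<and> (i2', j2') \<in> arrows \<and>
    same_relative_order [i1, j1, i2, j2] [i1', j1', i2', j2']"
  then have order: "\<forall>k<4. \<forall>l<4. ([i1, j1, i2, j2] ! k = [i1, j1, i2, j2] ! l \<longleftrightarrow> [i1', j1', i2', j2'] ! k = [i1', j1', i2', j2'] ! l) \<and>
      ([i1, j1, i2, j2] ! k < [i1, j1, i2, j2] ! l \<longleftrightarrow> [i1', j1', i2', j2'] ! k < [i1', j1', i2', j2'] ! l)"
    by (simp add: same_relative_order_def)
  note o = order[rule_format]
  note o' = o[of 0 1] o[of 0 2] o[of 0 3] o[of 1 0] o[of 1 2] o[of 1 3]
    o[of 2 0] o[of 2 1] o[of 2 3] o[of 3 0] o[of 3 1] o[of 3 2]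
  show "compatible A B C D E G (i1, j1) (i2, j2) = compatible A B C D E G (i1', j1') (i2', j2')"
    using o' unfolding compatible_def by (simp add: numeral_2_eq_2 numeral_3_eq_3)
qed

lemma coordinates_nonneg: "l \<in> coordinates K \<Longrightarrow> 0 \<le> l a"
  unfolding coordinates_def by blast

lemma coordinates_clique:
  "l \<in> coordinates (pattern_complex A B C D E G) \<Longrightarrow> l a \<noteq> 0 \<Longrightarrow> l b \<noteq> 0 \<Longrightarrow> compatible A B C D E G a b"
  unfolding coordinates_def pattern_complex_def by blast

text \<open>In a clique no index is both a tail and a head, so the marginals can be read off the point.\<close>

lemma marginals:
  assumes nonneg: "\<And>a. 0 \<le> l a" and disjoint: "\<And>i j k. l (i, k) \<noteq> 0 \<Longrightarrow> l (k, j) = 0"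
  shows "(\<Sum>j\<in>UNIV. l (k, j)) = neg (point l) k" "(\<Sum>i\<in>UNIV. l (i, k)) = pos (point l) k"
proof -
  have "(\<forall>i. l (i, k) = 0) \<or> (\<forall>j. l (k, j) = 0)"
    using disjoint by blast
  then have "(\<Sum>i\<in>UNIV. l (i, k)) = 0 \<or> (\<Sum>j\<in>UNIV. l (k, j)) = 0" by (elim disjE) simp_all
  moreover have "(\<Sum>i\<in>UNIV. l (i, k)) \<ge> 0" "(\<Sum>j\<in>UNIV. l (k, j)) \<ge> 0"
    by (simp_all add: nonneg sum_nonneg)
  ultimately show "(\<Sum>j\<in>UNIV. l (k, j)) = neg (point l) k" "(\<Sum>i\<in>UNIV. l (i, k)) = pos (point l) k"
    unfolding pos_def neg_def point_nth by auto
qed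

lemma coordinates_marginals:
  assumes "l \<in> coordinates (pattern_complex A B C D E G)"
  shows "(\<Sum>j\<in>UNIV. l (k, j)) = neg (point l) k" "(\<Sum>i\<in>UNIV. l (i, k)) = pos (point l) k"
proof -
  have "l (k, j) = 0" if "l (i, k) \<noteq> 0" for i j k
    using coordinates_clique[OF assms that, of "(k, j)"] by (auto simp: compatible_shared)
  then show "(\<Sum>j\<in>UNIV. l (k, j)) = neg (point l) k" "(\<Sum>i\<in>UNIV. l (i, k)) = pos (point l) k"
    using marginals[of l k] coordinates_nonneg[OF assms] by blast+
qed

lemma point_coordinates_pattern_complex:
  assumes "l \<in> coordinates (pattern_complex A B C D E G)"
  shows "(\<Sum>k\<in>UNIV. \<bar>point l $ k\<bar>) = 2"
proof -
  have "\<bar>point l $ k\<bar> = neg (point l) k + pos (point l) k" for k by (simp add: pos_def neg_def)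
  then have "(\<Sum>k\<in>UNIV. \<bar>point l $ k\<bar>) = (\<Sum>k\<in>UNIV. (\<Sum>j\<in>UNIV. l (k, j)) + (\<Sum>i\<in>UNIV. l (i, k)))"
    by (simp add: coordinates_marginals[OF assms])
  also have "\<dots> = 2"
    using assms by (simp add: sum.distrib sum_arrows[symmetric] sum_arrows'[symmetric] coordinates_def)
  finally show ?thesis .
qed

section \<open>Solving transportation problems on cliques: uniqueness and existence\<close>

text \<open>A smallest nonempty invariant subset is mapped onto itself. This replaces following an
  alternating walk until it closes.\<close>

lemma finite_invariant_subset:
  assumes "finite P" "P \<noteq> {}" "h ` P \<subseteq> P"
  obtains C where "C \<subseteq> P" "C \<noteq> {}" "h ` C = C" "inj_on h C"
proof -
  obtain C where C: "C \<noteq> {} \<and> C \<subseteq> P \<and> h ` C \<subseteq> C"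
    and min: "\<And>D. D \<noteq> {} \<and> D \<subseteq> P \<and> h ` D \<subseteq> D \<Longrightarrow> card C \<le> card D"
    using ex_has_least_nat[of "\<lambda>D. D \<noteq> {} \<and> D \<subseteq> P \<and> h ` D \<subseteq> D" P card] assms by blast
  have fin: "finite C" using C assms(1) finite_subset by blast
  have "card C \<le> card (h ` C)" using C by (intro min) blast
  then have "h ` C = C" using C fin by (intro card_seteq) auto
  moreover have "inj_on h C" using calculation fin by (intro eq_card_imp_inj_on) auto
  ultimately show thesis using that C by blast
qed

text \<open>
  The difference of two coordinate vectors of the same point has vanishing marginals, hence contains an
  alternating cycle. Its positive and its negative arrows form two clique matchings on the same indices.
\<close>

lemma inj_on_point_pattern_complex:
  assumes good: "good_pattern A B C D E G"
  shows "inj_on point (coordinates (pattern_complex A B C D E G))"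
proof (rule inj_onI, rule ccontr)
  fix l m :: "'n::{finite,linorder} arrow \<Rightarrow> real"
  assume l: "l \<in> coordinates (pattern_complex A B C D E G)"
    and m: "m \<in> coordinates (pattern_complex A B C D E G)"
    and eq: "point l = point m" and "l \<noteq> m"
  define d where "d a = l a - m a" for a
  have rows: "(\<Sum>j\<in>UNIV. d (i, j)) = 0" and cols: "(\<Sum>i\<in>UNIV. d (i, j)) = 0" for i j
    using coordinates_marginals[OF l] coordinates_marginals[OF m] eq by (simp_all add: d_def sum_subtractf)
  have pos_neg: "\<exists>i\<in>UNIV. f i > 0" "\<exists>i\<in>UNIV. f i < 0" if "(\<Sum>i\<in>UNIV. f i) = 0" "f k \<noteq> 0"
    for f :: "'n \<Rightarrow> real" and k
  proof -
    show "\<exists>i\<in>UNIV. f i > 0"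
    proof (rule ccontr)
      assume "\<not> ?thesis"
      then have "\<forall>i\<in>UNIV. - f i = 0"
        using that(1) by (subst sum_nonneg_eq_0_iff[symmetric]) (simp_all add: sum_negf not_less)
      then show False using that(2) by simp
    qed
    show "\<exists>i\<in>UNIV. f i < 0"
    proof (rule ccontr)
      assume "\<not> ?thesis"
      then have "\<forall>i\<in>UNIV. f i = 0"
        using that(1) by (subst sum_nonneg_eq_0_iff[symmetric]) (simp_all add: not_less)
      then show False using that(2) by simp
    qed
  qed
  have l_pos: "l a \<noteq> 0" if "d a > 0" for a
  proof -
    have "0 \<le> m a" by (rule coordinates_nonneg[OF m])
    then show ?thesis using that by (simp add: d_def)
  qed
  have m_pos: "m a \<noteq> 0" if "d a < 0" for a
  proof -
    have "0 \<le> l a" by (rule coordinates_nonneg[OF l])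
    then show ?thesis using that by (simp add: d_def)
  qed
  note clique_l = coordinates_clique[OF l] and clique_m = coordinates_clique[OF m]
  define P where "P = {i. \<exists>j. d (i, j) > 0}"
  \<comment> \<open>\<open>J\<close> leaves a tail along an arrow where \<open>l\<close> exceeds
    \<open>m\<close>, and \<open>I\<close> returns from the head along one where \<open>m\<close>
    exceeds \<open>l\<close>; vanishing row and column sums guarantee both. On a set permuted by the
    round trip, the two kinds of arrows form two matchings.\<close>
  define J where "J i = (SOME j. d (i, j) > 0)" for i
  define I where "I j = (SOME i. d (i, j) < 0)" for j
  have J: "d (i, J i) > 0" if "i \<in> P" for i
  proof -
    have "\<exists>j. d (i, j) > 0" using that by (simp add: P_def)
    then show ?thesis unfolding J_def by (rule someI_ex)
  qed
  have I: "d (I (J i), J i) < 0" if "i \<in> P" for i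
  proof -
    have "\<exists>i'. d (i', J i) < 0" using pos_neg(2)[OF cols, of i "J i"] J[OF that] by auto
    then show ?thesis unfolding I_def by (rule someI_ex)
  qed
  have in_P: "i \<in> P" if "d (i, j) \<noteq> 0" for i j
    using pos_neg(1)[of "\<lambda>j. d (i, j)" j, OF rows that] by (simp add: P_def)
  obtain a where "l a \<noteq> m a" using \<open>l \<noteq> m\<close> by (meson ext)
  then have "d (fst a, snd a) \<noteq> 0" by (simp add: d_def)
  then have "fst a \<in> P" by (rule in_P)
  have image: "(\<lambda>i. I (J i)) ` P \<subseteq> P"
  proof (rule image_subsetI)
    fix i assume "i \<in> P"
    show "I (J i) \<in> P" by (rule in_P[of _ "J i"]) (use I[OF \<open>i \<in> P\<close>] in simp)
  qed
  have "P \<noteq> {}" using \<open>fst a \<in> P\<close> by blast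
  then obtain S where S: "S \<subseteq> P" "S \<noteq> {}" "(\<lambda>i. I (J i)) ` S = S" "inj_on (\<lambda>i. I (J i)) S"
    using finite_invariant_subset[OF _ _ image] by (metis finite)
  have injJ: "inj_on J S" using S(4) by (auto simp: inj_on_def)
  define M where "M = (\<lambda>i. (i, J i)) ` S"
  define N where "N = (\<lambda>i. (I (J i), J i)) ` S"
  have fst_snd: "fst ` M = S" "fst ` N = S" "snd ` M = J ` S" "snd ` N = J ` S"
    using S(3) by (auto simp: M_def N_def image_image)
  have M: "l a \<noteq> 0" if "a \<in> M" for a using that S(1) J l_pos by (auto simp: M_def)
  have N: "m a \<noteq> 0" if "a \<in> N" for a using that S(1) I m_pos by (auto simp: N_def)
  have disjoint: "S \<inter> J ` S = {}"
  proof (rule ccontr)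
    assume "S \<inter> J ` S \<noteq> {}"
    then obtain i where "i \<in> S" "J i \<in> S" by blast
    then have "(i, J i) \<in> M" "(J i, J (J i)) \<in> M" by (auto simp: M_def)
    then have "compatible A B C D E G (i, J i) (J i, J (J i))" by (intro clique_l M)
    then show False by (simp add: compatible_shared(4))
  qed
  have "matching M"
    using injJ disjoint by (auto simp: matching_def fst_snd) (auto simp: M_def inj_on_def)
  have "matching N"
    using injJ S(4) disjoint by (auto simp: matching_def fst_snd) (auto simp: N_def inj_on_def)
  interpret clique_matchings A B C D E G M N
    by unfold_locales (use \<open>matching M\<close> \<open>matching N\<close> clique_l[OF M M] clique_m[OF N N] fst_snd in auto)
  have "M = N" by (rule clique_matching_unique[OF good])
  obtain i where "i \<in> S" using S(2) by blast
  then have "(i, J i) \<in> N" using \<open>M = N\<close> by (auto simp: M_def)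
  then obtain i' where "i' \<in> S" "i = I (J i')" "J i = J i'" by (auto simp: N_def)
  then have "I (J i) = i" by simp
  then show False using I[of i] J[of i] S(1) \<open>i \<in> S\<close> by auto
qed

text \<open>
  If every non-edge can be exchanged against a cheaper edge, a cheapest coordinate vector of a boundary
  point is supported on a clique.
\<close>

lemma surj_point_pattern_complex:
  fixes c :: "'n::{finite,linorder} arrow \<Rightarrow> real" and x :: "(real, 'n) vec"
  assumes cheaper: "\<And>i j k l. distinct [i, j, k, l] \<Longrightarrow> \<not> compatible A B C D E G (i, j) (k, l) \<Longrightarrow>
      c (i, l) + c (k, j) < c (i, j) + c (k, l)"
    and x: "(\<Sum>k\<in>UNIV. x $ k) = 0" "(\<Sum>k\<in>UNIV. \<bar>x $ k\<bar>) = 2"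
  shows "x \<in> point ` coordinates (pattern_complex A B C D E G)"
proof -
  define Q where "Q = {a. x $ fst a < 0 \<and> 0 < x $ snd a}"
  \<comment> \<open>The transportation polytope, written in a Euclidean space so that compactness
    yields a cheapest point. Restricting the support to \<open>Q\<close> fixes which indices are
    tails and which are heads, so exchanging partners never creates a loop.\<close>
  define T where "T = {v :: real ^ ('n \<times> 'n). (\<forall>a. 0 \<le> v $ a) \<and> (\<forall>a. a \<notin> Q \<longrightarrow> v $ a = 0) \<and>
    (\<Sum>a\<in>UNIV. v $ a) = 1 \<and> (\<Sum>a\<in>UNIV. v $ a *\<^sub>R arrow_vector a) = x}"
  have T_iff: "(\<chi> a. l a) \<in> T \<longleftrightarrow> (\<forall>a. 0 \<le> l a) \<and> (\<forall>a. a \<notin> Q \<longrightarrow> l a = 0) \<and>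
      (\<Sum>a\<in>UNIV. l a) = 1 \<and> point l = x" for l
    by (simp add: T_def point_def)
  have "closed T"
    unfolding T_def
    by (intro closed_Collect_conj closed_Collect_all closed_Collect_imp closed_Collect_le closed_Collect_eq
        continuous_intros open_Collect_const)
  moreover have "T \<subseteq> cbox 0 (\<chi> a. 1)"
  proof
    fix v assume v: "v \<in> T"
    have "v $ a \<le> 1" for a
      using member_le_sum[of a UNIV "($) v"] v by (auto simp: T_def)
    then show "v \<in> cbox 0 (\<chi> a. 1)" using v by (auto simp: T_def mem_box_cart)
  qed
  ultimately have "compact T"
    using compact_Int_closed[OF compact_cbox[of 0 "\<chi> a. 1"]] by (metis inf.absorb_iff2)
  have "x \<noteq> 0" using x by auto
  have "(\<chi> a. coupling x a) \<in> T"
    unfolding T_iff using coupling[OF x(1) \<open>x \<noteq> 0\<close>] x(2) by (auto simp: Q_def)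
  then have "T \<noteq> {}" by blast
  have "continuous_on T (\<lambda>v. \<Sum>a\<in>UNIV. c a * v $ a)" by (intro continuous_intros)
  then obtain v where v: "v \<in> T" "\<And>w. w \<in> T \<Longrightarrow> (\<Sum>a\<in>UNIV. c a * v $ a) \<le> (\<Sum>a\<in>UNIV. c a * w $ a)"
    using continuous_attains_inf[OF \<open>compact T\<close> \<open>T \<noteq> {}\<close>] by blast
  define l where "l a = v $ a" for a
  have l: "\<forall>a. 0 \<le> l a" "\<forall>a. a \<notin> Q \<longrightarrow> l a = 0" "(\<Sum>a\<in>UNIV. l a) = 1" "point l = x"
    using v(1) by (auto simp: T_def l_def point_def)
  have "compatible A B C D E G a b" if ab: "l a \<noteq> 0" "l b \<noteq> 0" for a b
  proof (rule ccontr)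
    assume not: "\<not> compatible A B C D E G a b"
    obtain i j k h where eq: "a = (i, j)" "b = (k, h)" by (cases a, cases b)
    have "(i, j) \<in> Q" "(k, h) \<in> Q" using ab l(2) unfolding eq by blast+
    then have Q: "(i, h) \<in> Q" "(k, j) \<in> Q" and ne: "i \<noteq> j" "k \<noteq> h" "i \<noteq> h" "k \<noteq> j"
      by (auto simp: Q_def)
    moreover have "i \<noteq> k" "j \<noteq> h" using not ne compatible_shared(1,2) unfolding eq by metis+
    ultimately have dist: "distinct [i, j, k, h]" by auto
    \<comment> \<open>The largest amount that can be shifted from the two incompatible arrows to the
      exchanged pair; \<open>D\<close> is the direction of the shift.\<close>
    define e where "e = min (l (i, j)) (l (k, h))"
    have "e > 0" using ab l(1) unfolding eq e_def by (simp add: less_le)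
    define \<delta> where "\<delta> p a = (if a = p then 1 else 0 :: real)" for p a :: "'n arrow"
    define D where "D a = \<delta> (i, h) a + \<delta> (k, j) a - \<delta> (i, j) a - \<delta> (k, h) a" for a
    have sum_\<delta>: "(\<Sum>a\<in>UNIV. \<delta> p a * f a) = f p" "(\<Sum>a\<in>UNIV. \<delta> p a *\<^sub>R g a) = g p"
      for p and f :: "'n arrow \<Rightarrow> real" and g :: "'n arrow \<Rightarrow> (real, 'n) vec"
      by (simp_all add: \<delta>_def if_distrib[of "\<lambda>c. c * _"] if_distrib[of "\<lambda>c. c *\<^sub>R _"] cong: if_cong)
    have D_sum: "(\<Sum>a\<in>UNIV. D a * f a) = f (i, h) + f (k, j) - f (i, j) - f (k, h)" for f
      by (simp add: D_def left_diff_distrib distrib_right sum.distrib sum_subtractf sum_\<delta>)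
    define l' where "l' a = l a + e * D a" for a
    have "0 \<le> l' a" for a
    proof -
      have "D a \<ge> - \<delta> (i, j) a - \<delta> (k, h) a" by (auto simp: D_def \<delta>_def)
      then have "e * D a \<ge> e * (- \<delta> (i, j) a - \<delta> (k, h) a)" using \<open>e > 0\<close> by simp
      moreover have "l a + e * (- \<delta> (i, j) a - \<delta> (k, h) a) \<ge> 0"
        using l(1)[rule_format, of a] dist by (auto simp: \<delta>_def e_def)
      ultimately show ?thesis by (simp add: l'_def)
    qed
    moreover have "l' a = 0" if "a \<notin> Q" for a
      using that Q \<open>(i, j) \<in> Q\<close> \<open>(k, h) \<in> Q\<close> l(2)[rule_format, OF that]
      by (auto simp: l'_def D_def \<delta>_def)
    moreover have "(\<Sum>a\<in>UNIV. l' a) = 1"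
      using D_sum[of "\<lambda>a. 1"] l(3) by (simp add: l'_def sum.distrib sum_distrib_left[symmetric])
    moreover have "point D = 0"
      unfolding point_def D_def
      by (simp add: scaleR_diff_left scaleR_add_left sum.distrib sum_subtractf sum_\<delta>)
        (simp add: arrow_vector_def)
    then have "point l' = x"
      unfolding l'_def by (simp add: point_add point_scale l(4))
    ultimately have "(\<chi> a. l' a) \<in> T" unfolding T_iff by blast
    then have "(\<Sum>a\<in>UNIV. c a * l a) \<le> (\<Sum>a\<in>UNIV. c a * l' a)" using v(2) by (force simp: l_def)
    also have "\<dots> = (\<Sum>a\<in>UNIV. c a * l a) + e * (\<Sum>a\<in>UNIV. D a * c a)"
      by (simp add: l'_def distrib_left sum.distrib sum_distrib_left mult_ac)
    finally have "0 \<le> c (i, h) + c (k, j) - c (i, j) - c (k, h)"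
      using \<open>e > 0\<close> by (simp add: D_sum zero_le_mult_iff)
    then show False using cheaper[OF dist] not unfolding eq by simp
  qed
  then have "l \<in> coordinates (pattern_complex A B C D E G)"
    using l by (auto simp: coordinates_def pattern_complex_def)
  then show ?thesis using l(4) by blast
qed

text \<open>
  Arrow costs whose minimizers realize a pattern: \<open>K\<close> penalizes backward arrows, \<open>\<alpha>\<close> rewards or
  penalizes length, \<open>\<gamma>\<close> rewards backward arrows far to the right, and the quadratic term decides
  between nesting and crossing of arrows of the same direction.
\<close>

definition arrow_cost ::
    "real \<Rightarrow> real \<Rightarrow> real \<Rightarrow> bool \<Rightarrow> bool \<Rightarrow> real \<Rightarrow> real \<Rightarrow> real" where
  "arrow_cost K \<alpha> \<gamma> E G x y = (if x < y then \<alpha> * (y - x) + (if E then - 1 else 1) * (y - x)\<^sup>2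
     else K + \<alpha> * (x - y) - \<gamma> * (x + y) + (if G then - 1 else 1) * (x - y)\<^sup>2)"

text \<open>The quadratic terms contribute at most \<open>3 * L^2\<close> to the comparisons for
  \<open>A\<close>, \<open>B\<close> and at most \<open>2 * L^2\<close> to those for
  \<open>C\<close>, \<open>D\<close>, less than \<open>M\<close> times a gap of at least 1. The
  value \<open>4 * M * L\<close> of \<open>K\<close> outweighs the terms of size up to
  \<open>2 * M * L\<close> caused by \<alpha> or \<gamma>, and so forces \<open>A\<close> off and
  \<open>B\<close> on. A positive \<gamma> acts on \<open>C\<close> and \<open>D\<close> with
  opposite signs, which yields \<open>D\<close> without \<open>C\<close>. In the last case only the
  quadratic terms act on \<open>C\<close> and \<open>D\<close>; with \<open>E\<close> and
  \<open>G\<close> they are concave and favour crossing.\<close>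

definition cost_parameters ::
    "bool \<Rightarrow> bool \<Rightarrow> bool \<Rightarrow> bool \<Rightarrow> bool \<Rightarrow> bool \<Rightarrow> real \<Rightarrow> real \<Rightarrow> real \<Rightarrow> real \<Rightarrow> bool" where
  "cost_parameters A B C D E G K \<alpha> \<gamma> L \<longleftrightarrow>
     (let M = 4 * L\<^sup>2 in
      \<not> A \<and> \<not> B \<and> \<not> C \<and> \<not> D \<and> K = 0 \<and> \<alpha> = M \<and> \<gamma> = 0 \<or>
      A \<and> B \<and> C \<and> D \<and> K = 0 \<and> \<alpha> = - M \<and> \<gamma> = 0 \<or>
      \<not> A \<and> B \<and> \<not> C \<and> \<not> D \<and> K = 4 * M * L \<and> \<alpha> = M \<and> \<gamma> = 0 \<or>
      \<not> A \<and> B \<and> \<not> C \<and> D \<and> K = 4 * M * L \<and> \<alpha> = 0 \<and> \<gamma> = M \<or>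
      \<not> A \<and> B \<and> C \<and> D \<and> E \<and> G \<and> K = 4 * M * L \<and> \<alpha> = 0 \<and> \<gamma> = 0)"

lemma arrow_cost_quadruple:
  fixes p q r s :: real
  assumes par: "cost_parameters A B C D E G K \<alpha> \<gamma> L"
    and bounds: "0 \<le> p" "p + 1 \<le> q" "q + 1 \<le> r" "r + 1 \<le> s" "s \<le> L"
  defines "c \<equiv> arrow_cost K \<alpha> \<gamma> E G"
  shows "if A then c p s + c r q < c p q + c r s else c p q + c r s < c p s + c r q"
    and "if B then c s p + c q r < c s r + c q p else c s r + c q p < c s p + c q r"
    and "if C then c p r + c s q < c p q + c s r else c p q + c s r < c p r + c s q"
    and "if D then c r p + c q s < c r s + c q p else c r s + c q p < c r p + c q s"
    and "if E then c p s + c q r < c p r + c q s else c p r + c q s < c p s + c q r"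
    and "if G then c s p + c r q < c s q + c r p else c s q + c r p < c s p + c r q"
proof -
  define M where "M = 4 * L\<^sup>2"
  define u where "u = M * (r - q)"
  have "L \<ge> 3" using bounds by simp
  then have L: "L \<ge> 3" "L\<^sup>2 \<ge> 9" "M \<ge> 0" using power_mono[of 3 L 2] by (simp_all add: M_def)
  have u: "u \<ge> M" "u \<le> M * L"
    using bounds L mult_left_mono[of 1 "r - q" M] mult_left_mono[of "r - q" L M] by (simp_all add: u_def)
  have large3: "M * L \<ge> 3 * M" using L mult_left_mono[of 3 L M] by simp
  have sq: "0 \<le> (y - x)\<^sup>2 \<and> (y - x)\<^sup>2 \<le> L\<^sup>2" if "0 \<le> x" "x \<le> y" "y \<le> L" for x y
    using that power_mono[of "y - x" L 2] by simp
  have sqs: "0 \<le> (q - p)\<^sup>2 \<and> (q - p)\<^sup>2 \<le> L\<^sup>2" "0 \<le> (r - p)\<^sup>2 \<and> (r - p)\<^sup>2 \<le> L\<^sup>2"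
      "0 \<le> (s - p)\<^sup>2 \<and> (s - p)\<^sup>2 \<le> L\<^sup>2" "0 \<le> (r - q)\<^sup>2 \<and> (r - q)\<^sup>2 \<le> L\<^sup>2"
      "0 \<le> (s - q)\<^sup>2 \<and> (s - q)\<^sup>2 \<le> L\<^sup>2" "0 \<le> (s - r)\<^sup>2 \<and> (s - r)\<^sup>2 \<le> L\<^sup>2"
    by (rule sq; use bounds in linarith)+
  have incr: "(q - p)\<^sup>2 < (r - p)\<^sup>2" "(s - r)\<^sup>2 < (s - q)\<^sup>2"
    using bounds by (auto intro!: power_strict_mono)
  \<comment> \<open>Strict convexity of the square. The nested and the crossing pair have the same
    total length and the same sum of endpoints, so only the sign of the quadratic term decides
    between them.\<close>
  have "0 < 2 * ((q - p) * (s - r))" using bounds by simp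
  also have "\<dots> = (s - p)\<^sup>2 + (r - q)\<^sup>2 - (r - p)\<^sup>2 - (s - q)\<^sup>2"
    by (simp add: power2_eq_square algebra_simps)
  finally have nest: "(r - p)\<^sup>2 + (s - q)\<^sup>2 < (s - p)\<^sup>2 + (r - q)\<^sup>2" by simp
  have Mq: "0 \<le> M * (q + r)" "M * (q + r) \<le> 2 * (M * L)"
    using bounds L mult_left_mono[of "q + r" "2 * L" M] by simp_all
  have fwd: "c x y = \<alpha> * (y - x) + (if E then - 1 else 1) * (y - x)\<^sup>2" if "x < y" for x y
    using that by (simp add: c_def arrow_cost_def)
  have bwd: "c y x = K + \<alpha> * (y - x) - \<gamma> * (y + x) + (if G then - 1 else 1) * (y - x)\<^sup>2" if "x < y" for x y
    using that by (simp add: c_def arrow_cost_def)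
  have lt: "p < q" "q < r" "r < s" "p < r" "q < s" "p < s" using bounds by auto
  note vals = fwd[OF lt(1)] fwd[OF lt(2)] fwd[OF lt(3)] fwd[OF lt(4)] fwd[OF lt(5)] fwd[OF lt(6)]
    bwd[OF lt(1)] bwd[OF lt(2)] bwd[OF lt(3)] bwd[OF lt(4)] bwd[OF lt(5)] bwd[OF lt(6)]
  define X where "X = (s - p)\<^sup>2 - (q - p)\<^sup>2 - (s - r)\<^sup>2"
  have X: "\<bar>X\<bar> \<le> 2 * L\<^sup>2" using sqs unfolding X_def abs_le_iff by linarith
  have large: "M * L \<ge> 12 * L\<^sup>2" using large3 by (simp add: M_def)
  have A_eq0: "c p s + c r q - (c p q + c r s) =
      K + 2 * \<alpha> * (r - q) - \<gamma> * (q + r) + (if E then - 1 else 1) * X + (if G then - 1 else 1) * (r - q)\<^sup>2"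
    unfolding vals X_def by (simp add: algebra_simps)
  have B_eq0: "c s p + c q r - (c q p + c s r) =
      - K + 2 * \<alpha> * (r - q) + \<gamma> * (q + r) + (if G then - 1 else 1) * X + (if E then - 1 else 1) * (r - q)\<^sup>2"
    unfolding vals X_def by (simp add: algebra_simps)
  have C_eq0: "c p r + c s q - (c p q + c s r) = 2 * \<alpha> * (r - q) + \<gamma> * (r - q) +
      (if E then - 1 else 1) * ((r - p)\<^sup>2 - (q - p)\<^sup>2) + (if G then - 1 else 1) * ((s - q)\<^sup>2 - (s - r)\<^sup>2)"
    unfolding vals by (simp add: algebra_simps)
  have D_eq0: "c r p + c q s - (c q p + c r s) = 2 * \<alpha> * (r - q) - \<gamma> * (r - q) +
      (if G then - 1 else 1) * ((r - p)\<^sup>2 - (q - p)\<^sup>2) + (if E then - 1 else 1) * ((s - q)\<^sup>2 - (s - r)\<^sup>2)"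
    unfolding vals by (simp add: algebra_simps)
  have signs: "\<bar>(if b then - 1 else 1) * y\<bar> = \<bar>y\<bar>" for b and y :: real by simp
  have Q: "\<bar>(r - q)\<^sup>2\<bar> \<le> L\<^sup>2" "\<bar>(r - p)\<^sup>2 - (q - p)\<^sup>2\<bar> \<le> L\<^sup>2" "\<bar>(s - q)\<^sup>2 - (s - r)\<^sup>2\<bar> \<le> L\<^sup>2"
    using sqs incr unfolding abs_le_iff by linarith+
  define eX gX eQ gQ where "eX = (if E then - 1 else 1) * X" and "gX = (if G then - 1 else 1) * X"
    and "eQ = (if E then - 1 else 1) * (r - q)\<^sup>2" and "gQ = (if G then - 1 else 1) * (r - q)\<^sup>2"
  have EG: "\<bar>eX\<bar> \<le> 2 * L\<^sup>2" "\<bar>gX\<bar> \<le> 2 * L\<^sup>2" "\<bar>eQ\<bar> \<le> L\<^sup>2" "\<bar>gQ\<bar> \<le> L\<^sup>2"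
    unfolding eX_def gX_def eQ_def gQ_def signs using X Q(1) by blast+
  define e1 g1 e2 g2 where "e1 = (if E then - 1 else 1) * ((r - p)\<^sup>2 - (q - p)\<^sup>2)"
    and "g1 = (if G then - 1 else 1) * ((r - p)\<^sup>2 - (q - p)\<^sup>2)"
    and "e2 = (if E then - 1 else 1) * ((s - q)\<^sup>2 - (s - r)\<^sup>2)"
    and "g2 = (if G then - 1 else 1) * ((s - q)\<^sup>2 - (s - r)\<^sup>2)"
  have eg: "\<bar>e1\<bar> \<le> L\<^sup>2" "\<bar>g1\<bar> \<le> L\<^sup>2" "\<bar>e2\<bar> \<le> L\<^sup>2" "\<bar>g2\<bar> \<le> L\<^sup>2"
    unfolding e1_def g1_def e2_def g2_def signs using Q by blast+
  have u2: "u \<ge> 4 * L\<^sup>2" using u by (simp add: M_def)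
  have A_eq: "c p s + c r q - (c p q + c r s) = K + 2 * (\<alpha> * (r - q)) - \<gamma> * (q + r) + eX + gQ"
    unfolding A_eq0 eX_def gQ_def by simp
  have B_eq: "c s p + c q r - (c q p + c s r) = - K + 2 * (\<alpha> * (r - q)) + \<gamma> * (q + r) + gX + eQ"
    unfolding B_eq0 gX_def eQ_def by simp
  have C_eq: "c p r + c s q - (c p q + c s r) = 2 * (\<alpha> * (r - q)) + \<gamma> * (r - q) + e1 + g2"
    unfolding C_eq0 e1_def g2_def by simp
  have D_eq: "c r p + c q s - (c q p + c r s) = 2 * (\<alpha> * (r - q)) - \<gamma> * (r - q) + g1 + e2"
    unfolding D_eq0 g1_def e2_def by simp
  have Lpos: "L\<^sup>2 > 0" using L by simp
  \<comment> \<open>Stating the five cases through products with \<open>r - q\<close> and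
    \<open>q + r\<close> leaves only linear arithmetic.\<close>
  have params: "\<not> A \<and> \<not> B \<and> \<not> C \<and> \<not> D \<and> K = 0 \<and> \<alpha> * (r - q) = u \<and> \<gamma> * (r - q) = 0 \<and> \<gamma> * (q + r) = 0 \<or>
      A \<and> B \<and> C \<and> D \<and> K = 0 \<and> \<alpha> * (r - q) = - u \<and> \<gamma> * (r - q) = 0 \<and> \<gamma> * (q + r) = 0 \<or>
      \<not> A \<and> B \<and> \<not> C \<and> \<not> D \<and> K = 4 * M * L \<and> \<alpha> * (r - q) = u \<and> \<gamma> * (r - q) = 0 \<and> \<gamma> * (q + r) = 0 \<or>
      \<not> A \<and> B \<and> \<not> C \<and> D \<and> K = 4 * M * L \<and> \<alpha> * (r - q) = 0 \<and> \<gamma> * (r - q) = u \<and> \<gamma> * (q + r) = M * (q + r) \<or>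
      \<not> A \<and> B \<and> C \<and> D \<and> K = 4 * M * L \<and> \<alpha> * (r - q) = 0 \<and> \<gamma> * (r - q) = 0 \<and> \<gamma> * (q + r) = 0 \<and>
        e1 < 0 \<and> e2 < 0 \<and> g1 < 0 \<and> g2 < 0"
    using par unfolding cost_parameters_def Let_def M_def[symmetric]
    by (elim disjE conjE) (use incr in \<open>simp_all add: u_def e1_def e2_def g1_def g2_def\<close>)
  show "if A then c p s + c r q < c p q + c r s else c p q + c r s < c p s + c r q"
    using params
    by (elim disjE conjE; simp only: if_True if_False not_False_eq_True;
      use A_eq EG u u2 Mq Lpos large in linarith)
  show "if B then c s p + c q r < c s r + c q p else c s r + c q p < c s p + c q r"
    using params
    by (elim disjE conjE; simp only: if_True if_False not_False_eq_True;
      use B_eq EG u u2 Mq Lpos large in linarith)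
  show "if C then c p r + c s q < c p q + c s r else c p q + c s r < c p r + c s q"
    using params
    by (elim disjE conjE; simp only: if_True if_False not_False_eq_True;
      use C_eq eg u u2 Mq Lpos large in linarith)
  show "if D then c r p + c q s < c r s + c q p else c r s + c q p < c r p + c q s"
    using params
    by (elim disjE conjE; simp only: if_True if_False not_False_eq_True;
      use D_eq eg u u2 Mq Lpos large in linarith)
  show "if E then c p s + c q r < c p r + c q s else c p r + c q s < c p s + c q r"
    unfolding vals using nest by (auto simp: algebra_simps)
  show "if G then c s p + c r q < c s q + c r p else c s q + c r p < c s p + c r q"
    unfolding vals using nest by (auto simp: algebra_simps)
qed

lemma exists_cost_parameters:
  assumes "good_pattern A B C D E G"
  shows "\<exists>K \<alpha> \<gamma>. cost_parameters A B C D E G K \<alpha> \<gamma> L"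
  using assms unfolding cost_parameters_def good_pattern_def Let_def
  by (cases A; cases B; cases C; cases D) simp_all

section \<open>Ranks of indices and the sufficiency of good patterns\<close>

definition position :: "'n::{finite,linorder} \<Rightarrow> nat" where "position x = card {y. y < x}"

lemma position_less: "x < y \<Longrightarrow> position x < position y"
proof -
  assume "x < y"
  then have "{z. z < x} \<subseteq> {z. z < y}" "x \<in> {z. z < y} - {z. z < x}" by auto
  then show ?thesis unfolding position_def by (intro psubset_card_mono) auto
qed

text \<open>Makes compatibility and the cost comparison one relation indexed by a bit: negating the
  bit swaps the sides, so the 24 arrangements close by rewriting.\<close>

definition chosen :: "bool \<Rightarrow> real \<Rightarrow> real \<Rightarrow> bool" where
  "chosen b x y \<longleftrightarrow> (if b then x < y else y < x)"

lemma chosen_not: "chosen (\<not> b) x y \<longleftrightarrow> chosen b y x"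
  by (simp add: chosen_def)

lemma chosen_add_commute: "chosen b (x + x') (y + y') \<Longrightarrow> chosen b (x' + x) (y' + y)"
  by (simp add: add.commute)

lemma uniform_flag_triangulation_pattern_complex:
  assumes good: "good_pattern A B C D E G" and card: "CARD('n::{finite,linorder}) \<ge> 2"
  shows "uniform_flag_triangulation (pattern_complex A B C D E G :: 'n arrow_complex)"
proof -
  define \<rho> where "\<rho> x = real (position x)" for x :: 'n
  define L where "L = real CARD('n)"
  obtain K \<alpha> \<gamma> where par: "cost_parameters A B C D E G K \<alpha> \<gamma> L"
    using exists_cost_parameters[OF good] by blast
  define c where "c a = arrow_cost K \<alpha> \<gamma> E G (\<rho> (fst a)) (\<rho> (snd a))" for a
  have \<rho>: "\<rho> x + 1 \<le> \<rho> y" if "x < y" for x y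
    using position_less[OF that] by (simp add: \<rho>_def)
  have bounds: "0 \<le> \<rho> x" "\<rho> x \<le> L" for x
    by (auto simp: \<rho>_def position_def L_def intro!: card_mono)
  have cheaper: "c (i, l) + c (k, j) < c (i, j) + c (k, l)"
    if "distinct [i, j, k, l]" "\<not> compatible A B C D E G (i, j) (k, l)" for i j k l
  proof -
    have "chosen (compatible A B C D E G (i, j) (k, l)) (c (i, j) + c (k, l)) (c (i, l) + c (k, j))"
    proof (rule sorted_quadruple_cases[OF that(1)], goal_cases)
      case (1 p q r s)
      note lt = 1(1-3)
      have ineq: "chosen A (c (p, s) + c (r, q)) (c (p, q) + c (r, s))"
        "chosen B (c (s, p) + c (q, r)) (c (s, r) + c (q, p))"
        "chosen C (c (p, r) + c (s, q)) (c (p, q) + c (s, r))"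
        "chosen D (c (r, p) + c (q, s)) (c (r, s) + c (q, p))"
        "chosen E (c (p, s) + c (q, r)) (c (p, r) + c (q, s))"
        "chosen G (c (s, p) + c (r, q)) (c (s, q) + c (r, p))"
        unfolding chosen_def c_def fst_conv snd_conv
        by (rule arrow_cost_quadruple[OF par bounds(1) \<rho>[OF lt(1)] \<rho>[OF lt(2)] \<rho>[OF lt(3)] bounds(2)])+
      show ?thesis
        using 1(5)
        by (elim insertE emptyE Pair_inject;
          simp only: compatible_quadruple[OF lt] chosen_not ineq ineq[THEN chosen_add_commute])
    qed
    then show ?thesis using that(2) by (simp add: chosen_def)
  qed
  have "point ` coordinates (pattern_complex A B C D E G :: 'n arrow_complex) = rel_frontier root_polytope"
    unfolding rel_frontier_root_polytope[OF card]
    using surj_point_pattern_complex[of A B C D E G c, OF cheaper]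
    by (auto simp: sum_point point_coordinates_pattern_complex)
  then have "bij_betw point (coordinates (pattern_complex A B C D E G :: 'n arrow_complex)) (rel_frontier root_polytope)"
    using inj_on_point_pattern_complex[OF good] by (simp add: bij_betw_def)
  then show ?thesis
    unfolding uniform_flag_triangulation_def
    using flag_pattern_complex uniform_pattern_complex
      represents_if_bij_betw[OF simplicial_pattern_complex] by blast
qed

section \<open>Necessary conditions\<close>

locale boundary_triangulation =
  fixes K :: "'n::{finite,linorder} arrow_complex"
  assumes complex: "simplicial_complex_on arrows K"
    and bij: "bij_betw point (coordinates K) {x. (\<Sum>k\<in>UNIV. x $ k) = 0 \<and> (\<Sum>k\<in>UNIV. \<bar>x $ k\<bar>) = 2}"
begin

text \<open>A cancellation between an incoming and an outgoing arrow would push the point off the boundary.\<close>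

lemma tails_heads_disjoint:
  assumes l: "l \<in> coordinates K" and "l (i, k) \<noteq> 0"
  shows "l (k, j) = 0"
proof -
  define inn out where "inn k = (\<Sum>i\<in>UNIV. l (i, k))" and "out k = (\<Sum>j\<in>UNIV. l (k, j))" for k
  have nonneg: "0 \<le> inn k" "0 \<le> out k" for k
    by (simp_all add: inn_def out_def sum_nonneg coordinates_nonneg[OF l])
  have "point l \<in> {x. (\<Sum>k\<in>UNIV. x $ k) = 0 \<and> (\<Sum>k\<in>UNIV. \<bar>x $ k\<bar>) = 2}"
    by (rule bij_betwE[OF bij, rule_format, OF l])
  then have "(\<Sum>k\<in>UNIV. \<bar>inn k - out k\<bar>) = 2" by (simp add: point_nth inn_def out_def)
  moreover have "(\<Sum>k\<in>UNIV. inn k + out k) = 2"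
    using l by (simp add: inn_def out_def sum.distrib sum_arrows[symmetric] sum_arrows'[symmetric] coordinates_def)
  ultimately have "(\<Sum>k\<in>UNIV. inn k + out k - \<bar>inn k - out k\<bar>) = 0" by (simp add: sum_subtractf)
  moreover have "\<forall>k\<in>UNIV. 0 \<le> inn k + out k - \<bar>inn k - out k\<bar>" using nonneg by (simp add: abs_if)
  ultimately have "inn k + out k - \<bar>inn k - out k\<bar> = 0"
    by (simp add: sum_nonneg_eq_0_iff)
  then have "inn k = 0 \<or> out k = 0" by (auto simp: abs_if split: if_splits)
  moreover have "inn k > 0"
    unfolding inn_def using assms(2) coordinates_nonneg[OF l]
    by (intro sum_pos2[of _ i]) (auto simp: less_le)
  ultimately have "out k = 0" by simp
  then show ?thesis
    unfolding out_def using coordinates_nonneg[OF l] by (simp add: sum_nonneg_eq_0_iff)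
qed

text \<open>Surjectivity of \<open>point\<close> in transportation form. The weights are nonnegative
  and bounded by their marginals, which confines the support to the given tails and heads.\<close>

lemma exists_coordinates:
  assumes nonneg: "\<And>k. 0 \<le> p k" "\<And>k. 0 \<le> q k" and disjoint: "\<And>k. p k = 0 \<or> q k = 0"
    and sums: "(\<Sum>k\<in>UNIV. p k) = 1" "(\<Sum>k\<in>UNIV. q k) = 1"
  obtains l where "l \<in> coordinates K" "\<And>i. (\<Sum>j\<in>UNIV. l (i, j)) = p i" "\<And>j. (\<Sum>i\<in>UNIV. l (i, j)) = q j"
    "\<And>i j. l (i, j) \<noteq> 0 \<Longrightarrow> p i \<noteq> 0 \<and> q j \<noteq> 0"
proof -
  define x :: "(real, 'n) vec" where "x = (\<chi> k. q k - p k)"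
  have abs: "\<bar>x $ k\<bar> = p k + q k" for k using nonneg[of k] disjoint[of k] by (auto simp: x_def)
  have "x \<in> {x. (\<Sum>k\<in>UNIV. x $ k) = 0 \<and> (\<Sum>k\<in>UNIV. \<bar>x $ k\<bar>) = 2}"
    by (simp add: abs sum.distrib sums) (simp add: x_def sum_subtractf sums)
  then have "x \<in> point ` coordinates K" using bij_betw_imp_surj_on[OF bij] by simp
  then obtain l where l: "l \<in> coordinates K" "point l = x" by blast
  have "neg x k = p k" "pos x k = q k" for k
    using nonneg[of k] disjoint[of k] by (auto simp: neg_def pos_def x_def)
  then have rows: "(\<Sum>j\<in>UNIV. l (i, j)) = p i" and cols: "(\<Sum>i\<in>UNIV. l (i, j)) = q j" for i j
    using marginals[of l, OF coordinates_nonneg[OF l(1)] tails_heads_disjoint[OF l(1)]] l(2) by simp_all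
  have "l (i, j) \<le> p i" "l (i, j) \<le> q j" for i j
    using member_le_sum[of j UNIV "\<lambda>j. l (i, j)"] member_le_sum[of i UNIV "\<lambda>i. l (i, j)"]
      coordinates_nonneg[OF l(1)] rows cols by auto
  then have "p i \<noteq> 0 \<and> q j \<noteq> 0" if "l (i, j) \<noteq> 0" for i j
    using that coordinates_nonneg[OF l(1), of "(i, j)"] by (metis order.antisym)
  then show thesis using that l(1) rows cols by blast
qed

lemma coordinates_edge:
  assumes "l \<in> coordinates K" "l a \<noteq> 0" "l b \<noteq> 0"
  shows "{a, b} \<in> K"
proof (rule simplicial_complex_onD(3)[OF complex])
  show "{a. l a \<noteq> 0} \<in> K" using assms(1) by (simp add: coordinates_def)
qed (use assms in simp)

text \<open>Equal weights on \<open>M\<close> and on \<open>N\<close> give the same point, so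
  injectivity identifies the two matchings.\<close>

lemma face_matching_unique:
  assumes "M \<in> K" "N \<in> K" and M: "matching M" and N: "matching N"
    and eq: "fst ` M = fst ` N" "snd ` M = snd ` N"
  shows "M = N"
proof (cases "M = {}")
  case True
  then show ?thesis using eq by auto
next
  case False
  define c where "c = real (card (fst ` M))"
  define u where "u R a = (if a \<in> R then 1 / c else 0)" for R and a :: "'n arrow"
  have "c > 0" using M False by (auto simp: c_def matching_def card_gt_0_iff)
  have card: "real (card R) = c" if "R = M \<or> R = N" for R
    using that M N eq card_image[of fst R] by (auto simp: matching_def c_def)
  have coord: "u R \<in> coordinates K" if "R = M \<or> R = N" for R
  proof -
    have "(\<Sum>a\<in>UNIV. u R a) = real (card R) * (1 / c)" by (simp add: u_def sum.If_cases)
    then have "(\<Sum>a\<in>UNIV. u R a) = 1" using card[OF that] \<open>c > 0\<close> by simp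
    moreover have "{a. u R a \<noteq> 0} = R" using \<open>c > 0\<close> by (simp add: u_def)
    moreover have "R \<in> K" using that assms(1,2) by (elim disjE) simp_all
    moreover have "\<forall>a. 0 \<le> u R a" using \<open>c > 0\<close> by (simp add: u_def)
    ultimately show ?thesis unfolding coordinates_def by simp
  qed
  have col: "(\<Sum>i\<in>UNIV. u R (i, k)) = (if k \<in> snd ` R then 1 / c else 0)" if "matching R" for R k
  proof (cases "k \<in> snd ` R")
    case True
    then obtain i where i: "(i, k) \<in> R" by auto
    then have "(i', k) \<in> R \<longleftrightarrow> i' = i" for i' using matching_snd[OF that] by metis
    then have "u R (i', k) = (if i' = i then 1 / c else 0)" for i' by (simp add: u_def)
    then show ?thesis using True by simp
  next
    case False
    then have "u R (i, k) = 0" for i by (force simp: u_def)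
    then show ?thesis using False by simp
  qed
  have row: "(\<Sum>j\<in>UNIV. u R (k, j)) = (if k \<in> fst ` R then 1 / c else 0)" if "matching R" for R k
  proof (cases "k \<in> fst ` R")
    case True
    then obtain j where j: "(k, j) \<in> R" by auto
    then have "(k, j') \<in> R \<longleftrightarrow> j' = j" for j' using matching_fst[OF that] by metis
    then have "u R (k, j') = (if j' = j then 1 / c else 0)" for j' by (simp add: u_def)
    then show ?thesis using True by simp
  next
    case False
    then have "u R (k, j) = 0" for j by (force simp: u_def)
    then show ?thesis using False by simp
  qed
  have "point (u M) = point (u N)"
    unfolding vec_eq_iff point_nth col[OF M] col[OF N] row[OF M] row[OF N] eq by simp
  then have "u M = u N" using bij coord by (auto simp: bij_betw_def dest: inj_onD)
  then have "u M a = u N a" for a by simp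
  then have "a \<in> M \<longleftrightarrow> a \<in> N" for a
    using \<open>c > 0\<close> unfolding u_def by (metis divide_eq_0_iff less_irrefl zero_neq_one)
  then show ?thesis by blast
qed

text \<open>At the midpoint the shared index would both send and receive, which
  \<open>tails_heads_disjoint\<close> excludes.\<close>

lemma edge_tails_heads:
  assumes "{(i, j), (k, l)} \<in> K"
  shows "i \<noteq> l"
proof
  assume "i = l"
  have arrows: "i \<noteq> j" "k \<noteq> l"
    using simplicial_complex_onD(1)[OF complex assms] by (auto simp: arrows_def)
  define u where "u a = (if a = (i, j) \<or> a = (k, l) then 1 / 2 else 0 :: real)" for a
  have "(i, j) \<noteq> (k, l)" using \<open>i = l\<close> arrows by auto
  then have "(\<Sum>a\<in>UNIV. u a) = 1"
  proof -
    have "(\<Sum>a\<in>UNIV. u a) = (\<Sum>a\<in>{(i, j), (k, l)}. 1 / 2)"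
      unfolding u_def by (rule sum.mono_neutral_cong_right) auto
    then show ?thesis using \<open>(i, j) \<noteq> (k, l)\<close> by simp
  qed
  moreover have "{a. u a \<noteq> 0} = {(i, j), (k, l)}" by (auto simp: u_def)
  ultimately have "u \<in> coordinates K" using assms by (simp add: coordinates_def u_def)
  then show False using tails_heads_disjoint[of u k i j] \<open>i = l\<close> by (simp add: u_def)
qed

text \<open>With a single tail the transportation problem has only one solution, and that solution
  uses both arrows.\<close>

lemma edge_same_tail:
  assumes "i \<noteq> j" "i \<noteq> k" "j \<noteq> k"
  shows "{(i, j), (i, k)} \<in> K"
proof -
  obtain l where l: "l \<in> coordinates K" "\<And>t. (\<Sum>h\<in>UNIV. l (t, h)) = (if t = i then 1 else 0)"
      "\<And>h. (\<Sum>t\<in>UNIV. l (t, h)) = (if h = j then 1 / 2 else 0) + (if h = k then 1 / 2 else 0)"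
      "\<And>t h. l (t, h) \<noteq> 0 \<Longrightarrow> (if t = i then 1 else 0 :: real) \<noteq> 0 \<and> (if h = j then 1 / 2 else 0) + (if h = k then 1 / 2 else 0 :: real) \<noteq> 0"
    by (rule exists_coordinates[of "\<lambda>t. if t = i then 1 else 0" "\<lambda>h. (if h = j then 1 / 2 else 0) + (if h = k then 1 / 2 else 0)"])
      (use assms in \<open>auto simp: sum.distrib\<close>)
  have "(\<Sum>t\<in>UNIV. l (t, h)) = l (i, h)" for h
  proof -
    have "l (t, h) = (if t = i then l (i, h) else 0)" for t
      using l(4)[of t h] by (cases "l (t, h) = 0") (auto split: if_splits)
    then have "(\<Sum>t\<in>UNIV. l (t, h)) = (\<Sum>t\<in>UNIV. if t = i then l (i, h) else 0)" by (intro sum.cong) auto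
    then show ?thesis by simp
  qed
  then have "l (i, j) \<noteq> 0" "l (i, k) \<noteq> 0" using l(3)[of j] l(3)[of k] assms by auto
  then show ?thesis by (rule coordinates_edge[OF l(1)])
qed

lemma edge_same_head:
  assumes "i \<noteq> k" "j \<noteq> k" "i \<noteq> j"
  shows "{(i, k), (j, k)} \<in> K"
proof -
  obtain l where l: "l \<in> coordinates K"
      "\<And>t. (\<Sum>h\<in>UNIV. l (t, h)) = (if t = i then 1 / 2 else 0) + (if t = j then 1 / 2 else 0)"
      "\<And>h. (\<Sum>t\<in>UNIV. l (t, h)) = (if h = k then 1 else 0)"
      "\<And>t h. l (t, h) \<noteq> 0 \<Longrightarrow> (if t = i then 1 / 2 else 0) + (if t = j then 1 / 2 else 0 :: real) \<noteq> 0 \<and> (if h = k then 1 else 0 :: real) \<noteq> 0"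
    by (rule exists_coordinates[of "\<lambda>h. (if h = i then 1 / 2 else 0) + (if h = j then 1 / 2 else 0)" "\<lambda>t. if t = k then 1 else 0"])
      (use assms in \<open>auto simp: sum.distrib\<close>)
  have "(\<Sum>h\<in>UNIV. l (t, h)) = l (t, k)" for t
  proof -
    have "l (t, h) = (if h = k then l (t, k) else 0)" for h
      using l(4)[of t h] by (cases "l (t, h) = 0") (auto split: if_splits)
    then have "(\<Sum>h\<in>UNIV. l (t, h)) = (\<Sum>h\<in>UNIV. if h = k then l (t, k) else 0)" by (intro sum.cong) auto
    then show ?thesis by simp
  qed
  then have "l (i, k) \<noteq> 0" "l (j, k) \<noteq> 0" using l(2)[of i] l(2)[of j] assms by auto
  then show ?thesis by (rule coordinates_edge[OF l(1)])
qed

lemma two_heads: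
  fixes l :: "'n arrow \<Rightarrow> real"
  assumes "\<And>t h. l (t, h) \<noteq> 0 \<Longrightarrow> h = j \<or> h = k" "j \<noteq> k"
  shows "(\<Sum>h\<in>UNIV. l (t, h)) = l (t, j) + l (t, k)"
proof -
  have "(\<Sum>h\<in>UNIV. l (t, h)) = (\<Sum>h\<in>{j, k}. l (t, h))"
    using assms(1) by (intro sum.mono_neutral_right) auto
  then show ?thesis using assms(2) by simp
qed

text \<open>The two pairs are the diagonals of a quadrilateral with a common midpoint. Uniqueness
  forbids both as edges. Conversely, if one diagonal is missing, a vanishing entry on it and the
  marginals 1/2 make both entries of the other diagonal nonzero.\<close>

lemma edge_exchange:
  assumes "distinct [i, j, k, l]"
  shows "{(i, l), (k, j)} \<in> K \<longleftrightarrow> {(i, j), (k, l)} \<notin> K"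
proof
  assume "{(i, l), (k, j)} \<in> K"
  show "{(i, j), (k, l)} \<notin> K"
  proof
    assume "{(i, j), (k, l)} \<in> K"
    moreover have "matching {(i, j), (k, l)}" "matching {(i, l), (k, j)}"
      unfolding matching_def inj_on_def using assms by auto
    ultimately have "{(i, j), (k, l)} = {(i, l), (k, j)}"
      using \<open>{(i, l), (k, j)} \<in> K\<close> by (intro face_matching_unique) (simp_all add: insert_commute)
    then show False using assms by (simp add: doubleton_eq_iff)
  qed
next
  assume not: "{(i, j), (k, l)} \<notin> K"
  obtain u where u: "u \<in> coordinates K"
      "\<And>t. (\<Sum>h\<in>UNIV. u (t, h)) = (if t = i then 1 / 2 else 0) + (if t = k then 1 / 2 else 0)"
      "\<And>h. (\<Sum>t\<in>UNIV. u (t, h)) = (if h = j then 1 / 2 else 0) + (if h = l then 1 / 2 else 0)"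
      "\<And>t h. u (t, h) \<noteq> 0 \<Longrightarrow> (if t = i then 1 / 2 else 0) + (if t = k then 1 / 2 else 0 :: real) \<noteq> 0 \<and>
         (if h = j then 1 / 2 else 0) + (if h = l then 1 / 2 else 0 :: real) \<noteq> 0"
    by (rule exists_coordinates[of "\<lambda>t. (if t = i then 1 / 2 else 0) + (if t = k then 1 / 2 else 0)"
          "\<lambda>h. (if h = j then 1 / 2 else 0) + (if h = l then 1 / 2 else 0)"])
      (use assms in \<open>auto simp: sum.distrib\<close>)
  have heads: "h = j \<or> h = l" if "u (t, h) \<noteq> 0" for t h using u(4)[OF that] by (auto split: if_splits)
  have tails: "t = i \<or> t = k" if "u (t, h) \<noteq> 0" for t h using u(4)[OF that] by (auto split: if_splits)
  have ne: "j \<noteq> l" "i \<noteq> k" using assms by auto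
  have rows: "u (i, j) + u (i, l) = 1 / 2" "u (k, j) + u (k, l) = 1 / 2"
    using u(2)[of i] u(2)[of k] two_heads[of u, OF heads ne(1)] ne by auto
  have "(\<Sum>t\<in>UNIV. u (t, j)) = (\<Sum>t\<in>{i, k}. u (t, j))"
    using tails by (intro sum.mono_neutral_right) auto
  then have col: "u (i, j) + u (k, j) = 1 / 2" using u(3)[of j] ne by simp
  note face = coordinates_edge[OF u(1)]
  have "u (i, j) = 0 \<or> u (k, l) = 0" using not face[of "(i, j)" "(k, l)"] by blast
  then have "u (i, l) \<noteq> 0" "u (k, j) \<noteq> 0" using rows col by auto
  then show "{(i, l), (k, j)} \<in> K" by (rule face)
qed

end

section \<open>Recovering the six bits of a uniform flag triangulation\<close>

lemma same_relative_order_quadruple: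
  assumes "p < q" "q < r" "r < s" "p' < q'" "q' < r'" "r' < s'"
  shows "same_relative_order [p, s, r, q] [p', s', r', q']" "same_relative_order [s, p, q, r] [s', p', q', r']"
    "same_relative_order [p, r, s, q] [p', r', s', q']" "same_relative_order [r, p, q, s] [r', p', q', s']"
    "same_relative_order [p, s, q, r] [p', s', q', r']" "same_relative_order [s, p, r, q] [s', p', r', q']"
  using assms increasing_quadruple[OF assms(1-3)] increasing_quadruple[OF assms(4-6)]
  by (simp_all add: same_relative_order_def All_less_Suc)

lemma exists_increasing:
  assumes "m \<le> CARD('n::{finite,linorder})"
  obtains xs :: "'n::{finite,linorder} list" where "length xs = m" "sorted_wrt (<) xs"
proof -
  define ys where "ys = sorted_list_of_set (UNIV :: 'n set)"
  have "sorted_wrt (<) ys" unfolding ys_def by (rule strict_sorted_list_of_set)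
  then have "sorted_wrt (<) (take m ys)" by (rule sorted_wrt_take)
  moreover have "length (take m ys) = m" using assms by (simp add: ys_def)
  ultimately show thesis using that by blast
qed

text \<open>The bits are read off at one fixed quadruple. Uniformity carries them to every other
  quadruple, and \<open>edge_exchange\<close> settles the second matching of each word.\<close>

lemma (in boundary_triangulation) edge_iff_compatible:
  assumes uniform: "uniform_complex K" and lt: "p1 < p2" "p2 < p3" "p3 < p4"
  defines "A \<equiv> {(p1, p4), (p3, p2)} \<in> K" and "B \<equiv> {(p4, p1), (p2, p3)} \<in> K"
    and "C \<equiv> {(p1, p3), (p4, p2)} \<in> K" and "D \<equiv> {(p3, p1), (p2, p4)} \<in> K"
    and "E \<equiv> {(p1, p4), (p2, p3)} \<in> K" and "G \<equiv> {(p4, p1), (p3, p2)} \<in> K"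
  shows "{a, b} \<in> K \<longleftrightarrow> compatible A B C D E G a b"
proof -
  obtain i j k l where ab: "a = (i, j)" "b = (k, l)" by (cases a, cases b)
  have arrows: "a \<in> arrows \<and> b \<in> arrows" if "{a, b} \<in> K"
    using simplicial_complex_onD(1)[OF complex that] by simp
  have sym: "{x, y} \<in> K \<longleftrightarrow> {y, x} \<in> K" for x y by (simp add: insert_commute)
  consider "a \<notin> arrows \<or> b \<notin> arrows" | "a \<in> arrows" "b \<in> arrows" "i = l \<or> k = j"
    | "a \<in> arrows" "b \<in> arrows" "i \<noteq> l" "k \<noteq> j" "i = k" | "a \<in> arrows" "b \<in> arrows" "i \<noteq> l" "k \<noteq> j" "i \<noteq> k" "j = l"
    | "distinct [i, j, k, l]"
    unfolding ab by (auto simp: arrows_def)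
  then show ?thesis
  proof cases
    case 1
    then show ?thesis using arrows compatible_arrows by blast
  next
    case 2
    then have "{a, b} \<notin> K" using edge_tails_heads[of i j k l] edge_tails_heads[of k l i j] sym unfolding ab by blast
    moreover have "\<not> compatible A B C D E G a b" using 2(3) compatible_tails_heads unfolding ab by blast
    ultimately show ?thesis by simp
  next
    case 3
    have "{a, b} \<in> K"
    proof (cases "j = l")
      case True
      then have "{a, b} = {a}" using 3(5) ab by simp
      then show ?thesis using complex 3(1) by (simp add: simplicial_complex_on_def)
    next
      case False
      then show ?thesis using edge_same_tail[of i j l] 3 unfolding ab by (auto simp: arrows_def)
    qed
    moreover have "compatible A B C D E G a b"
      using compatible_shared(1)[of i j l] 3 unfolding ab by (auto simp: arrows_def)
    ultimately show ?thesis by simp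
  next
    case 4
    have "{a, b} \<in> K" using edge_same_head[of i j k] 4 unfolding ab by (auto simp: arrows_def)
    moreover have "compatible A B C D E G a b"
      using compatible_shared(2)[of i j k] 4 unfolding ab by (auto simp: arrows_def)
    ultimately show ?thesis by simp
  next
    case 5
    then show ?thesis
    proof (rule sorted_quadruple_cases, goal_cases)
      case (1 p q r s)
      note pqrs = 1(1-4)
      have transfer: "{(i1, j1), (i2, j2)} \<in> K \<longleftrightarrow> {(i1', j1'), (i2', j2')} \<in> K"
        if "same_relative_order [i1, j1, i2, j2] [i1', j1', i2', j2']" "i1 \<noteq> j1" "i2 \<noteq> j2" "i1' \<noteq> j1'" "i2' \<noteq> j2'"
        for i1 j1 i2 j2 i1' j1' i2' j2'
        using uniform that unfolding uniform_complex_def arrows_def by blast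
      have "distinct [p1, p2, p3, p4]" using lt by auto
      then have ne: "p1 \<noteq> p2" "p1 \<noteq> p3" "p1 \<noteq> p4" "p2 \<noteq> p3" "p2 \<noteq> p4" "p3 \<noteq> p4" "p \<noteq> q" "p \<noteq> r" "p \<noteq> s" "q \<noteq> r" "q \<noteq> s" "r \<noteq> s"
        using pqrs(4) by simp_all
      note order = same_relative_order_quadruple[OF pqrs(1-3) lt]
      have long: "{(p, s), (r, q)} \<in> K \<longleftrightarrow> A" "{(s, p), (q, r)} \<in> K \<longleftrightarrow> B" "{(p, r), (s, q)} \<in> K \<longleftrightarrow> C"
        "{(r, p), (q, s)} \<in> K \<longleftrightarrow> D" "{(p, s), (q, r)} \<in> K \<longleftrightarrow> E" "{(s, p), (r, q)} \<in> K \<longleftrightarrow> G"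
        unfolding A_def B_def C_def D_def E_def G_def
        by (rule transfer; (rule order | rule ne ne[symmetric]))+
      have short: "{(p, q), (r, s)} \<in> K \<longleftrightarrow> \<not> A" "{(s, r), (q, p)} \<in> K \<longleftrightarrow> \<not> B" "{(p, q), (s, r)} \<in> K \<longleftrightarrow> \<not> C"
        "{(r, s), (q, p)} \<in> K \<longleftrightarrow> \<not> D" "{(p, r), (q, s)} \<in> K \<longleftrightarrow> \<not> E" "{(s, q), (r, p)} \<in> K \<longleftrightarrow> \<not> G"
        unfolding long[symmetric]
        using edge_exchange[of p s r q] edge_exchange[of s p q r] edge_exchange[of p r s q]
          edge_exchange[of r p q s] edge_exchange[of p s q r] edge_exchange[of s p r q] ne by auto
      have swapped: "{(r, q), (p, s)} \<in> K \<longleftrightarrow> A" "{(q, r), (s, p)} \<in> K \<longleftrightarrow> B" "{(s, q), (p, r)} \<in> K \<longleftrightarrow> C" "{(q, s), (r, p)} \<in> K \<longleftrightarrow> D" "{(q, r), (p, s)} \<in> K \<longleftrightarrow> E" "{(r, q), (s, p)} \<in> K \<longleftrightarrow> G"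
        "{(r, s), (p, q)} \<in> K \<longleftrightarrow> \<not> A" "{(q, p), (s, r)} \<in> K \<longleftrightarrow> \<not> B" "{(s, r), (p, q)} \<in> K \<longleftrightarrow> \<not> C" "{(q, p), (r, s)} \<in> K \<longleftrightarrow> \<not> D" "{(q, s), (p, r)} \<in> K \<longleftrightarrow> \<not> E" "{(r, p), (s, q)} \<in> K \<longleftrightarrow> \<not> G"
        using long short by (simp_all add: insert_commute)
      show ?thesis
        using 1(5) unfolding ab
        by (elim insertE emptyE Pair_inject;
          simp only: compatible_quadruple[OF pqrs(1-3)] long short swapped)
    qed
  qed
qed

lemma boundary_triangulation_if_uniform:
  fixes K :: "'n::{finite,linorder} arrow_complex"
  assumes K: "uniform_flag_triangulation K" and card: "CARD('n) \<ge> 2"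
  shows "boundary_triangulation K"
proof
  show complex: "simplicial_complex_on arrows K"
    using K by (simp add: uniform_flag_triangulation_def flag_complex_on_def)
  show "bij_betw point (coordinates K) {x. (\<Sum>k\<in>UNIV. x $ k) = 0 \<and> (\<Sum>k\<in>UNIV. \<bar>x $ k\<bar>) = 2}"
    using bij_betw_if_represents[OF complex] K rel_frontier_root_polytope[OF card]
    by (simp add: uniform_flag_triangulation_def)
qed

lemma uniform_flag_triangulation_is_pattern_complex:
  fixes K :: "'n::{finite,linorder} arrow_complex"
  assumes K: "uniform_flag_triangulation K" and card: "CARD('n) \<ge> 4"
  obtains A B C D E G where "K = pattern_complex A B C D E G"
proof -
  have flag: "flag_complex_on arrows K" and uniform: "uniform_complex K"
    using K by (simp_all add: uniform_flag_triangulation_def)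
  then have complex: "simplicial_complex_on arrows K" by (simp add: flag_complex_on_def)
  interpret boundary_triangulation K
    using card by (intro boundary_triangulation_if_uniform[OF K]) simp
  obtain xs :: "'n list" where "length xs = 4" "sorted_wrt (<) xs" using exists_increasing[OF card] .
  then obtain p1 p2 p3 p4 :: 'n where lt: "p1 < p2" "p2 < p3" "p3 < p4"
    by (auto simp: numeral_eq_Suc length_Suc_conv)
  obtain A B C D E G where edge: "\<And>a b. {a, b} \<in> K \<longleftrightarrow> compatible A B C D E G a b"
    by (rule that) (rule edge_iff_compatible[OF uniform lt])
  have "K = pattern_complex A B C D E G"
  proof (intro equalityI subsetI)
    fix \<sigma> assume \<sigma>: "\<sigma> \<in> K"
    have "{a, b} \<in> K" if "a \<in> \<sigma>" "b \<in> \<sigma>" for a b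
      by (rule simplicial_complex_onD(3)[OF complex \<sigma>]) (use that in simp)
    then show "\<sigma> \<in> pattern_complex A B C D E G" by (simp add: pattern_complex_def edge)
  next
    fix \<sigma> :: "'n arrow set" assume \<sigma>: "\<sigma> \<in> pattern_complex A B C D E G"
    then have "\<sigma> \<subseteq> arrows" by (rule simplicial_complex_onD(1)[OF simplicial_pattern_complex])
    moreover have "\<forall>a\<in>\<sigma>. \<forall>b\<in>\<sigma>. {a, b} \<in> K" using \<sigma> by (simp add: pattern_complex_def edge)
    ultimately show "\<sigma> \<in> K" using flag unfolding flag_complex_on_def by (meson finite)
  qed
  then show thesis by (rule that)
qed

section \<open>Obstructions from prisms and hexagons\<close>

text \<open>A nonzero \<open>y\<close> forces the next one to be 1/3, all around the cycle, so the
  three sum to 0 or to 1 but never to 1/2.\<close>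

lemma cyclic_transport_absurd:
  fixes y1 y2 y3 z1 z2 z3 :: real
  assumes "y1 + z1 = 1 / 3" "y2 + z2 = 1 / 3" "y3 + z3 = 1 / 3" "y1 + y2 + y3 = 1 / 2"
    and "y1 = 0 \<or> z2 = 0" "y2 = 0 \<or> z3 = 0" "y3 = 0 \<or> z1 = 0"
  shows False
  using assms by auto

lemma sum_if_const: "(\<Sum>k\<in>UNIV. if k \<in> S then c else 0) = real (card S) * c"
  for S :: "'a::finite set"
  by (simp add: sum.If_cases)

context boundary_triangulation
begin

text \<open>
  On the prisms spanned by \<open>THTHT\<close> and by \<open>HTHTH\<close>, cyclic diagonals leave the barycenter uncovered.
\<close>

lemma prism_THTHT:
  fixes p q r s t :: 'n
  assumes edge: "\<And>a b. {a, b} \<in> K \<Longrightarrow> compatible A B C D E G a b"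
    and lt: "p < q" "q < r" "r < s" "s < t" and "A = B"
  shows "A = C"
proof (rule ccontr)
  assume "A \<noteq> C"
  note two = less_trans[OF lt(1,2)] less_trans[OF lt(2,3)] less_trans[OF lt(3,4)]
  note three = less_trans[OF two(1) lt(3)] less_trans[OF two(2) lt(4)]
  note more = two three less_trans[OF three(1) lt(4)]
  have ne: "p \<noteq> q" "p \<noteq> r" "p \<noteq> s" "p \<noteq> t" "q \<noteq> r" "q \<noteq> s" "q \<noteq> t" "r \<noteq> s" "r \<noteq> t" "s \<noteq> t"
    using lt more by auto
  \<comment> \<open>Equal supplies at three tails and equal demands at two heads describe the
    barycenter of the prism.\<close>
  have sums: "(\<Sum>k\<in>UNIV. if k \<in> {p, r, t} then 1 / 3 else 0 :: real) = 1"
      "(\<Sum>k\<in>UNIV. if k \<in> {q, s} then 1 / 2 else 0 :: real) = 1"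
    unfolding sum_if_const using ne by simp_all
  obtain u where u: "u \<in> coordinates K" "\<And>i. (\<Sum>j\<in>UNIV. u (i, j)) = (if i \<in> {p, r, t} then 1 / 3 else 0)"
      "\<And>j. (\<Sum>i\<in>UNIV. u (i, j)) = (if j \<in> {q, s} then 1 / 2 else 0)"
      "\<And>i j. u (i, j) \<noteq> 0 \<Longrightarrow> (if i \<in> {p, r, t} then 1 / 3 else 0 :: real) \<noteq> 0 \<and> (if j \<in> {q, s} then 1 / 2 else 0 :: real) \<noteq> 0"
    by (rule exists_coordinates[OF _ _ _ sums]) (use ne in auto)
  have supp: "i \<in> {p, r, t}" "j \<in> {q, s}" if "u (i, j) \<noteq> 0" for i j
    using u(4)[OF that] by (meson, meson)
  have row: "u (i, q) + u (i, s) = 1 / 3" if "i \<in> {p, r, t}" for i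
  proof -
    have "(\<Sum>j\<in>UNIV. u (i, j)) = (\<Sum>j\<in>{q, s}. u (i, j))"
      using supp(2) by (intro sum.mono_neutral_right) auto
    then show ?thesis using u(2)[of i] that ne by simp
  qed
  have "(\<Sum>i\<in>UNIV. u (i, q)) = (\<Sum>i\<in>{p, r, t}. u (i, q))"
    using supp(1) by (intro sum.mono_neutral_right) auto
  then have col: "u (p, q) + u (r, q) + u (t, q) = 1 / 2" using u(3)[of q] ne by simp
  have clique: "u a = 0 \<or> u b = 0" if "\<not> compatible A B C D E G a b" for a b
    using edge coordinates_edge[OF u(1)] that by blast
  have bits: "compatible A B C D E G (p, q) (r, s) \<longleftrightarrow> \<not> A" "compatible A B C D E G (r, q) (p, s) \<longleftrightarrow> A"
      "compatible A B C D E G (p, q) (t, s) \<longleftrightarrow> \<not> C" "compatible A B C D E G (t, q) (p, s) \<longleftrightarrow> C"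
      "compatible A B C D E G (r, q) (t, s) \<longleftrightarrow> \<not> B" "compatible A B C D E G (t, q) (r, s) \<longleftrightarrow> B"
    using compatible_quadruple[of p q r s A B C D E G] compatible_quadruple[of p q s t A B C D E G]
      compatible_quadruple[of q r s t A B C D E G] lt more by simp_all
  have rows: "u (p, q) + u (p, s) = 1 / 3" "u (r, q) + u (r, s) = 1 / 3" "u (t, q) + u (t, s) = 1 / 3"
    by (rule row; simp)+
  have col': "u (p, q) + u (t, q) + u (r, q) = 1 / 2" using col by simp
  \<comment> \<open>The three missing diagonals run cyclically through the tails, in the order
    \<open>p\<close>, \<open>r\<close>, \<open>t\<close> if \<open>A\<close> holds and in the order
    \<open>p\<close>, \<open>t\<close>, \<open>r\<close> otherwise.\<close>
  show False
  proof (cases A)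
    case True
    show ?thesis
      by (rule cyclic_transport_absurd[OF rows(1,2,3) col]; rule clique;
          use bits \<open>A = B\<close> \<open>A \<noteq> C\<close> True in simp)
  next
    case False
    show ?thesis
      by (rule cyclic_transport_absurd[OF rows(1,3,2) col']; rule clique;
          use bits \<open>A = B\<close> \<open>A \<noteq> C\<close> False in simp)
  qed
qed

lemma prism_HTHTH:
  fixes p q r s t :: 'n
  assumes edge: "\<And>a b. {a, b} \<in> K \<Longrightarrow> compatible A B C D E G a b"
    and lt: "p < q" "q < r" "r < s" "s < t" and "A = B"
  shows "A = D"
proof (rule ccontr)
  assume "A \<noteq> D"
  note two = less_trans[OF lt(1,2)] less_trans[OF lt(2,3)] less_trans[OF lt(3,4)]
  note three = less_trans[OF two(1) lt(3)] less_trans[OF two(2) lt(4)]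
  note more = two three less_trans[OF three(1) lt(4)]
  have ne: "p \<noteq> q" "p \<noteq> r" "p \<noteq> s" "p \<noteq> t" "q \<noteq> r" "q \<noteq> s" "q \<noteq> t" "r \<noteq> s" "r \<noteq> t" "s \<noteq> t"
    using lt more by auto
  have sums: "(\<Sum>k\<in>UNIV. if k \<in> {p, r, t} then 1 / 3 else 0 :: real) = 1"
      "(\<Sum>k\<in>UNIV. if k \<in> {q, s} then 1 / 2 else 0 :: real) = 1"
    unfolding sum_if_const using ne by simp_all
  obtain u where u: "u \<in> coordinates K" "\<And>j. (\<Sum>i\<in>UNIV. u (j, i)) = (if j \<in> {q, s} then 1 / 2 else 0)"
      "\<And>i. (\<Sum>j\<in>UNIV. u (j, i)) = (if i \<in> {p, r, t} then 1 / 3 else 0)"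
      "\<And>j i. u (j, i) \<noteq> 0 \<Longrightarrow> (if j \<in> {q, s} then 1 / 2 else 0 :: real) \<noteq> 0 \<and> (if i \<in> {p, r, t} then 1 / 3 else 0 :: real) \<noteq> 0"
    by (rule exists_coordinates[OF _ _ _ sums(2,1)]) (use ne in auto)
  have supp: "i \<in> {p, r, t}" "j \<in> {q, s}" if "u (j, i) \<noteq> 0" for i j
    using u(4)[OF that] by (meson, meson)
  have row: "u (q, i) + u (s, i) = 1 / 3" if "i \<in> {p, r, t}" for i
  proof -
    have "(\<Sum>j\<in>UNIV. u (j, i)) = (\<Sum>j\<in>{q, s}. u (j, i))"
      using supp(2) by (intro sum.mono_neutral_right) auto
    then show ?thesis using u(3)[of i] that ne by simp
  qed
  have "(\<Sum>i\<in>UNIV. u (q, i)) = (\<Sum>i\<in>{p, r, t}. u (q, i))"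
    using supp(1) by (intro sum.mono_neutral_right) auto
  then have col: "u (q, p) + u (q, r) + u (q, t) = 1 / 2" using u(2)[of q] ne by simp
  have clique: "u a = 0 \<or> u b = 0" if "\<not> compatible A B C D E G a b" for a b
    using edge coordinates_edge[OF u(1)] that by blast
  have bits: "compatible A B C D E G (q, p) (s, r) \<longleftrightarrow> \<not> B" "compatible A B C D E G (q, r) (s, p) \<longleftrightarrow> B"
      "compatible A B C D E G (q, p) (s, t) \<longleftrightarrow> \<not> D" "compatible A B C D E G (q, t) (s, p) \<longleftrightarrow> D"
      "compatible A B C D E G (q, r) (s, t) \<longleftrightarrow> \<not> A" "compatible A B C D E G (q, t) (s, r) \<longleftrightarrow> A"
    using compatible_quadruple[of p q r s A B C D E G] compatible_quadruple[of p q s t A B C D E G]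
      compatible_quadruple[of q r s t A B C D E G] lt more by simp_all
  have rows: "u (q, p) + u (s, p) = 1 / 3" "u (q, r) + u (s, r) = 1 / 3" "u (q, t) + u (s, t) = 1 / 3"
    by (rule row; simp)+
  have col': "u (q, p) + u (q, t) + u (q, r) = 1 / 2" using col by simp
  show False
  proof (cases A)
    case True
    show ?thesis
      by (rule cyclic_transport_absurd[OF rows(1,2,3) col]; rule clique;
          use bits \<open>A = B\<close> \<open>A \<noteq> D\<close> True in simp)
  next
    case False
    show ?thesis
      by (rule cyclic_transport_absurd[OF rows(1,3,2) col']; rule clique;
          use bits \<open>A = B\<close> \<open>A \<noteq> D\<close> False in simp)
  qed
qed

text \<open>On the hexagons \<open>THTHTH\<close> and \<open>HTHTHT\<close>, two clique matchings would have the same barycenter.\<close>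

lemma hexagons:
  fixes p q r s t v :: 'n
  assumes K: "K = pattern_complex A B C D E G" and lt: "p < q" "q < r" "r < s" "s < t" "t < v"
    and "A \<noteq> B" C D
  shows "E \<and> G"
proof (rule ccontr)
  note two = less_trans[OF lt(1,2)] less_trans[OF lt(2,3)] less_trans[OF lt(3,4)] less_trans[OF lt(4,5)]
  note three = less_trans[OF two(1) lt(3)] less_trans[OF two(2) lt(4)] less_trans[OF two(3) lt(5)]
  note four = less_trans[OF three(1) lt(4)] less_trans[OF three(2) lt(5)]
  note lts = lt two three four less_trans[OF four(1) lt(5)]
  note [simp] = lts lts[THEN less_not_sym] lts[THEN less_imp_neq] lts[THEN less_imp_neq, symmetric]
  assume "\<not> (E \<and> G)"
  \<comment> \<open>A failure of \<open>E\<close> shows on the word \<open>THTHTH\<close>, with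
    tails \<open>p\<close>, \<open>r\<close>, \<open>t\<close>; a failure of \<open>G\<close> shows
    on \<open>HTHTHT\<close>, with tails \<open>q\<close>, \<open>s\<close>,
    \<open>v\<close>.\<close>
  then consider "\<not> A" B "\<not> E" | "\<not> A" B "\<not> G" | A "\<not> B" "\<not> E" | A "\<not> B" "\<not> G"
    using \<open>A \<noteq> B\<close> by blast
  then show False
  proof cases
    case 1
    then have "{(p, q), (r, s), (t, v)} \<in> K" "{(p, s), (r, v), (t, q)} \<in> K"
      using \<open>C\<close> \<open>D\<close> by (simp_all add: K pattern_complex_def compatible_def)
    then have "{(p, q), (r, s), (t, v)} = {(p, s), (r, v), (t, q)}"
      by (rule face_matching_unique) (auto simp: matching_def inj_on_def)
    then have "(p, q) \<in> {(p, s), (r, v), (t, q)}" by (metis insertI1)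
    then show ?thesis by simp
  next
    case 2
    then have "{(q, r), (s, t), (v, p)} \<in> K" "{(q, t), (s, p), (v, r)} \<in> K"
      using \<open>C\<close> \<open>D\<close> by (simp_all add: K pattern_complex_def compatible_def)
    then have "{(q, r), (s, t), (v, p)} = {(q, t), (s, p), (v, r)}"
      by (rule face_matching_unique) (auto simp: matching_def inj_on_def)
    then have "(q, r) \<in> {(q, t), (s, p), (v, r)}" by (metis insertI1)
    then show ?thesis by simp
  next
    case 3
    then have "{(p, s), (r, v), (t, q)} \<in> K" "{(p, v), (r, q), (t, s)} \<in> K"
      using \<open>C\<close> \<open>D\<close> by (simp_all add: K pattern_complex_def compatible_def)
    then have "{(p, s), (r, v), (t, q)} = {(p, v), (r, q), (t, s)}"
      by (rule face_matching_unique) (auto simp: matching_def inj_on_def)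
    then have "(p, s) \<in> {(p, v), (r, q), (t, s)}" by (metis insertI1)
    then show ?thesis by simp
  next
    case 4
    then have "{(q, p), (s, r), (v, t)} \<in> K" "{(q, t), (s, p), (v, r)} \<in> K"
      using \<open>C\<close> \<open>D\<close> by (simp_all add: K pattern_complex_def compatible_def)
    then have "{(q, p), (s, r), (v, t)} = {(q, t), (s, p), (v, r)}"
      by (rule face_matching_unique) (auto simp: matching_def inj_on_def)
    then have "(q, p) \<in> {(q, t), (s, p), (v, r)}" by (metis insertI1)
    then show ?thesis by simp
  qed
qed

end

lemma pattern_classification:
  assumes K: "uniform_flag_triangulation (pattern_complex A B C D E G :: 'n::{finite,linorder} arrow_complex)"
    and card: "CARD('n) \<ge> 6"
  shows "(A = B \<longrightarrow> C = A \<and> D = A) \<and> (A \<noteq> B \<and> C \<and> D \<longrightarrow> E \<and> G)"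
proof -
  interpret boundary_triangulation "pattern_complex A B C D E G :: 'n arrow_complex"
    using card by (intro boundary_triangulation_if_uniform[OF K]) simp
  obtain xs :: "'n list" where "length xs = 6" "sorted_wrt (<) xs" using exists_increasing[OF card] .
  then obtain p q r s t v :: 'n where lt: "p < q" "q < r" "r < s" "s < t" "t < v"
    by (auto simp: numeral_eq_Suc length_Suc_conv)
  show ?thesis
    using prism_THTHT[OF edge_pattern_complex[THEN iffD1] lt(1-4)]
      prism_HTHTH[OF edge_pattern_complex[THEN iffD1] lt(1-4)] hexagons[OF refl lt] by blast
qed

section \<open>Types and classes\<close>

lemma endpoints_quadruple:
  assumes "p < q" "q < r" "r < s" "{fst a, snd a, fst b, snd b} = {p, q, r, s}"
  shows "endpoints a b = [p, q, r, s]"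
proof -
  have "sorted [p, q, r, s]" "distinct [p, q, r, s]" using assms(1-3) by auto
  then have "sorted_list_of_set (set [p, q, r, s]) = [p, q, r, s]"
    by (rule sorted_list_of_set.idem_if_sorted_distinct)
  then show ?thesis by (simp add: endpoints_def assms(4))
qed

lemma pair_types:
  assumes lt: "p < q" "q < r" "r < s"
  shows "pair_type (p, s) (q, r) = [T, T, H, H]" "pair_type (q, r) (p, s) = [T, T, H, H]"
    "pair_type (p, s) (r, q) = [T, H, T, H]" "pair_type (r, q) (p, s) = [T, H, T, H]"
    "pair_type (s, p) (q, r) = [H, T, H, T]" "pair_type (q, r) (s, p) = [H, T, H, T]"
    "pair_type (s, p) (r, q) = [H, H, T, T]" "pair_type (r, q) (s, p) = [H, H, T, T]"
    "pair_type (p, r) (q, s) = [T, T, H, H]" "pair_type (q, s) (p, r) = [T, T, H, H]"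
    "pair_type (p, r) (s, q) = [T, H, H, T]" "pair_type (s, q) (p, r) = [T, H, H, T]"
    "pair_type (r, p) (q, s) = [H, T, T, H]" "pair_type (q, s) (r, p) = [H, T, T, H]"
    "pair_type (r, p) (s, q) = [H, H, T, T]" "pair_type (s, q) (r, p) = [H, H, T, T]"
  using increasing_quadruple[OF lt]
  by (simp_all add: pair_type_def endpoints_quadruple[OF lt] insert_commute)

lemma endpoints_eq_quadruple:
  assumes "endpoints a b = [p, q, r, s]"
  shows "p < q" "q < r" "r < s"
proof -
  have "sorted_wrt (<) (endpoints a b)" unfolding endpoints_def by (rule strict_sorted_list_of_set)
  then show "p < q" "q < r" "r < s" unfolding assms by simp_all
qed

lemma pair_eq_doubleton: "{fst a, snd a} = {x, y} \<Longrightarrow> a = (x, y) \<or> a = (y, x)"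
  by (cases a) (auto simp: doubleton_eq_iff)

lemma nesting_cases:
  assumes "nesting a b"
  obtains p q r s where "p < q" "q < r" "r < s"
    "(a, b) \<in> {((p, s), (q, r)), ((p, s), (r, q)), ((s, p), (q, r)), ((s, p), (r, q)),
       ((q, r), (p, s)), ((r, q), (p, s)), ((q, r), (s, p)), ((r, q), (s, p))}"
proof -
  obtain p q r s where e: "endpoints a b = [p, q, r, s]"
    and "{{fst a, snd a}, {fst b, snd b}} = {{p, s}, {q, r}}"
    using assms by (auto simp: nesting_def)
  then consider "{fst a, snd a} = {p, s}" "{fst b, snd b} = {q, r}"
    | "{fst a, snd a} = {q, r}" "{fst b, snd b} = {p, s}"
    unfolding doubleton_eq_iff by blast
  then have "(a, b) \<in> {((p, s), (q, r)), ((p, s), (r, q)), ((s, p), (q, r)), ((s, p), (r, q)),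
       ((q, r), (p, s)), ((r, q), (p, s)), ((q, r), (s, p)), ((r, q), (s, p))}"
    by cases (auto dest!: pair_eq_doubleton)
  then show thesis by (rule that[OF endpoints_eq_quadruple[OF e]])
qed

lemma crossing_cases:
  assumes "crossing a b"
  obtains p q r s where "p < q" "q < r" "r < s"
    "(a, b) \<in> {((p, r), (q, s)), ((p, r), (s, q)), ((r, p), (q, s)), ((r, p), (s, q)),
       ((q, s), (p, r)), ((s, q), (p, r)), ((q, s), (r, p)), ((s, q), (r, p))}"
proof -
  obtain p q r s where e: "endpoints a b = [p, q, r, s]"
    and "{{fst a, snd a}, {fst b, snd b}} = {{p, r}, {q, s}}"
    using assms by (auto simp: crossing_def)
  then consider "{fst a, snd a} = {p, r}" "{fst b, snd b} = {q, s}"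
    | "{fst a, snd a} = {q, s}" "{fst b, snd b} = {p, r}"
    unfolding doubleton_eq_iff by blast
  then have "(a, b) \<in> {((p, r), (q, s)), ((p, r), (s, q)), ((r, p), (q, s)), ((r, p), (s, q)),
       ((q, s), (p, r)), ((s, q), (p, r)), ((q, s), (r, p)), ((s, q), (r, p))}"
    by cases (auto dest!: pair_eq_doubleton)
  then show thesis by (rule that[OF endpoints_eq_quadruple[OF e]])
qed

lemma nesting_crossing_quadruple:
  assumes lt: "p < q" "q < r" "r < s"
  shows "nesting (p, s) (q, r)" "nesting (p, s) (r, q)" "nesting (s, p) (q, r)" "nesting (s, p) (r, q)"
    "crossing (p, r) (s, q)" "crossing (r, p) (q, s)"
  unfolding nesting_def crossing_def
  by (intro exI[of _ p] exI[of _ q] exI[of _ r] exI[of _ s] conjI endpoints_quadruple[OF lt];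
    simp add: insert_commute)+

text \<open>The class predicates are universal statements and would be vacuous without pairs of the
  given type. Four indices provide a witness for each type, which makes nesting and not nesting
  exact negations.\<close>

lemma pattern_complex_types:
  fixes A B C D E G :: bool
  assumes card: "CARD('n::{finite,linorder}) \<ge> 4"
  defines "K \<equiv> pattern_complex A B C D E G :: 'n arrow_complex"
  shows "nests K [T,H,T,H] \<longleftrightarrow> A" "nests K [H,T,H,T] \<longleftrightarrow> B" "nests K [T,T,H,H] \<longleftrightarrow> E" "nests K [H,H,T,T] \<longleftrightarrow> G"
    "crosses K [T,H,H,T] \<longleftrightarrow> C" "crosses K [H,T,T,H] \<longleftrightarrow> D"
    "does_not_nest K [T,H,T,H] \<longleftrightarrow> \<not> A" "does_not_nest K [H,T,H,T] \<longleftrightarrow> \<not> B"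
    "does_not_cross K [T,H,H,T] \<longleftrightarrow> \<not> C" "does_not_cross K [H,T,T,H] \<longleftrightarrow> \<not> D"
proof -
  obtain xs :: "'n list" where "length xs = 4" "sorted_wrt (<) xs" using exists_increasing[OF card] .
  then obtain p q r s :: 'n where lt: "p < q" "q < r" "r < s"
    by (auto simp: numeral_eq_Suc length_Suc_conv)
  note lts = lt less_trans[OF lt(1,2)] less_trans[OF lt(2,3)] less_trans[OF less_trans[OF lt(1,2)] lt(3)]
  have arrows: "(x, y) \<in> arrows \<and> (y, x) \<in> arrows" if "x < y" for x y :: 'n
    using that by (auto simp: arrows_def)
  note arrow = lts[THEN arrows, THEN conjunct1] lts[THEN arrows, THEN conjunct2]
  have nest: "{a, b} \<in> K \<longleftrightarrow> (pair_type a b = [T,H,T,H] \<and> A \<or> pair_type a b = [H,T,H,T] \<and> B \<or>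
      pair_type a b = [T,T,H,H] \<and> E \<or> pair_type a b = [H,H,T,T] \<and> G)" if "nesting a b" for a b
    using that
  proof (rule nesting_cases, goal_cases)
    case 1
    then show ?thesis
      unfolding K_def edge_pattern_complex
      by (elim insertE emptyE Pair_inject) (simp_all add: pair_types compatible_quadruple)
  qed
  have cross: "{a, b} \<in> K \<longleftrightarrow> (pair_type a b = [T,H,H,T] \<and> C \<or> pair_type a b = [H,T,T,H] \<and> D \<or>
      pair_type a b = [T,T,H,H] \<and> \<not> E \<or> pair_type a b = [H,H,T,T] \<and> \<not> G)" if "crossing a b" for a b
    using that
  proof (rule crossing_cases, goal_cases)
    case 1
    then show ?thesis
      unfolding K_def edge_pattern_complex
      by (elim insertE emptyE Pair_inject) (simp_all add: pair_types compatible_quadruple)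
  qed
  note ex = nesting_crossing_quadruple[OF lt] pair_types[OF lt]
  have nests: "nests K W \<longleftrightarrow> P"
    if "\<And>a b. nesting a b \<Longrightarrow> pair_type a b = W \<Longrightarrow> {a, b} \<in> K \<longleftrightarrow> P"
      "nesting a b" "pair_type a b = W" "a \<in> arrows" "b \<in> arrows" for W P and a b :: "'n arrow"
    unfolding nests_def
  proof (intro iffI ballI impI)
    assume "\<forall>a\<in>arrows. \<forall>b\<in>arrows. nesting a b \<and> pair_type a b = W \<longrightarrow> {a, b} \<in> K"
    then show P using that(1)[OF that(2,3)] that(2-5) by blast
  qed (use that(1) in simp)
  have does_not_nest: "does_not_nest K W \<longleftrightarrow> \<not> P"
    if "\<And>a b. nesting a b \<Longrightarrow> pair_type a b = W \<Longrightarrow> {a, b} \<in> K \<longleftrightarrow> P"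
      "nesting a b" "pair_type a b = W" "a \<in> arrows" "b \<in> arrows" for W P and a b :: "'n arrow"
    unfolding does_not_nest_def
  proof (intro iffI ballI impI)
    assume "\<forall>a\<in>arrows. \<forall>b\<in>arrows. nesting a b \<and> pair_type a b = W \<longrightarrow> {a, b} \<notin> K"
    then show "\<not> P" using that(1)[OF that(2,3)] that(2-5) by blast
  qed (use that(1) in simp)
  have crosses: "crosses K W \<longleftrightarrow> P"
    if "\<And>a b. crossing a b \<Longrightarrow> pair_type a b = W \<Longrightarrow> {a, b} \<in> K \<longleftrightarrow> P"
      "crossing a b" "pair_type a b = W" "a \<in> arrows" "b \<in> arrows" for W P and a b :: "'n arrow"
    unfolding crosses_def
  proof (intro iffI ballI impI)
    assume "\<forall>a\<in>arrows. \<forall>b\<in>arrows. crossing a b \<and> pair_type a b = W \<longrightarrow> {a, b} \<in> K"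
    then show P using that(1)[OF that(2,3)] that(2-5) by blast
  qed (use that(1) in simp)
  have does_not_cross: "does_not_cross K W \<longleftrightarrow> \<not> P"
    if "\<And>a b. crossing a b \<Longrightarrow> pair_type a b = W \<Longrightarrow> {a, b} \<in> K \<longleftrightarrow> P"
      "crossing a b" "pair_type a b = W" "a \<in> arrows" "b \<in> arrows" for W P and a b :: "'n arrow"
    unfolding does_not_cross_def
  proof (intro iffI ballI impI)
    assume "\<forall>a\<in>arrows. \<forall>b\<in>arrows. crossing a b \<and> pair_type a b = W \<longrightarrow> {a, b} \<notin> K"
    then show "\<not> P" using that(1)[OF that(2,3)] that(2-5) by blast
  qed (use that(1) in simp)
  show "nests K [T,H,T,H] \<longleftrightarrow> A" "does_not_nest K [T,H,T,H] \<longleftrightarrow> \<not> A"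
    by (rule nests[of _ _ "(p, s)" "(r, q)"] does_not_nest[of _ _ "(p, s)" "(r, q)"]; simp add: nest ex arrow)+
  show "nests K [H,T,H,T] \<longleftrightarrow> B" "does_not_nest K [H,T,H,T] \<longleftrightarrow> \<not> B"
    by (rule nests[of _ _ "(s, p)" "(q, r)"] does_not_nest[of _ _ "(s, p)" "(q, r)"]; simp add: nest ex arrow)+
  show "nests K [T,T,H,H] \<longleftrightarrow> E"
    by (rule nests[of _ _ "(p, s)" "(q, r)"]; simp add: nest ex arrow)
  show "nests K [H,H,T,T] \<longleftrightarrow> G"
    by (rule nests[of _ _ "(s, p)" "(r, q)"]; simp add: nest ex arrow)
  show "crosses K [T,H,H,T] \<longleftrightarrow> C" "does_not_cross K [T,H,H,T] \<longleftrightarrow> \<not> C"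
    by (rule crosses[of _ _ "(p, r)" "(s, q)"] does_not_cross[of _ _ "(p, r)" "(s, q)"]; simp add: cross ex arrow)+
  show "crosses K [H,T,T,H] \<longleftrightarrow> D" "does_not_cross K [H,T,T,H] \<longleftrightarrow> \<not> D"
    by (rule crosses[of _ _ "(r, p)" "(q, s)"] does_not_cross[of _ _ "(r, p)" "(q, s)"]; simp add: cross ex arrow)+
qed

section \<open>Symmetries\<close>

lemma position_less_iff: "position x < position y \<longleftrightarrow> x < y"
  using position_less[of x y] position_less[of y x] by (cases x y rule: linorder_cases) auto

lemma position_bound: "position (x :: 'n::{finite,linorder}) < CARD('n)"
  unfolding position_def by (intro psubset_card_mono) auto

lemma bij_betw_position: "bij_betw position (UNIV :: 'n::{finite,linorder} set) {..<CARD('n)}"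
proof -
  have inj: "inj (position :: 'n \<Rightarrow> nat)"
    by (rule injI) (metis less_irrefl linorder_less_linear position_less)
  have "position ` (UNIV :: 'n set) = {..<CARD('n)}"
    by (intro card_subset_eq) (auto simp: card_image[OF inj] position_bound)
  with inj show ?thesis by (simp add: bij_betw_def)
qed

lemma exists_reversal: "\<exists>\<rho> :: 'n::{finite,linorder} \<Rightarrow> 'n. bij \<rho> \<and> (\<forall>x y. \<rho> x < \<rho> y \<longleftrightarrow> y < x)"
proof -
  let ?c = "CARD('n) - 1"
  have "\<exists>y :: 'n. position y = ?c - position x" for x :: 'n
  proof -
    have "?c - position x \<in> position ` (UNIV :: 'n set)"
      using bij_betw_imp_surj_on[OF bij_betw_position[where 'n = 'n]] position_bound[of x] by simp
    then show ?thesis by (metis imageE)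
  qed
  then obtain \<rho> :: "'n \<Rightarrow> 'n" where \<rho>: "position (\<rho> x) = ?c - position x" for x by metis
  have bound: "position x \<le> ?c" for x :: 'n
    using position_bound[of x] by simp
  have less: "\<rho> x < \<rho> y \<longleftrightarrow> y < x" for x y
    unfolding position_less_iff[symmetric] \<rho> using bound[of x] bound[of y] by linarith
  then have "inj \<rho>" by (intro injI) (metis linorder_less_linear less_irrefl)
  then have "bij \<rho>" by (simp add: bij_def finite_UNIV_inj_surj)
  with less show ?thesis by blast
qed

lemma pattern_complex_isomorphic:
  fixes f :: "'n::{finite,linorder} arrow \<Rightarrow> 'n arrow"
  assumes "bij f" "\<And>a b. compatible A' B' C' D' E' G' (f a) (f b) \<longleftrightarrow> compatible A B C D E G a b"
  shows "(pattern_complex A B C D E G :: 'n arrow_complex, pattern_complex A' B' C' D' E' G') \<in> complex_isomorphism"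
proof -
  let ?K = "pattern_complex A B C D E G :: 'n arrow_complex"
    and ?L = "pattern_complex A' B' C' D' E' G' :: 'n arrow_complex"
  have mem: "f ` \<sigma> \<in> ?L \<longleftrightarrow> \<sigma> \<in> ?K" for \<sigma>
    by (simp add: pattern_complex_def assms(2))
  have "(\<lambda>\<sigma>. f ` \<sigma>) ` ?K = ?L"
  proof (intro equalityI subsetI)
    fix \<sigma> assume "\<sigma> \<in> ?L"
    moreover have "f ` (inv f ` \<sigma>) = \<sigma>" using assms(1) by (simp add: bij_is_surj image_f_inv_f)
    ultimately show "\<sigma> \<in> (\<lambda>\<sigma>. f ` \<sigma>) ` ?K" using mem by (metis imageI)
  qed (use mem in auto)
  moreover have "bij_betw f arrows arrows"
  proof -
    have iff: "f a \<in> arrows \<longleftrightarrow> a \<in> arrows" for a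
      using assms(2)[of a a] by (simp only: compatible_self)
    have "f ` arrows = arrows"
    proof (intro equalityI subsetI)
      fix a :: "'n arrow" assume "a \<in> arrows"
      moreover obtain b where "a = f b" using bij_is_surj[OF assms(1)] by (metis surjD)
      ultimately show "a \<in> f ` arrows" using iff by simp
    qed (use iff in auto)
    then show ?thesis using inj_on_subset[OF bij_is_inj[OF assms(1)] subset_UNIV]
      by (simp add: bij_betw_def)
  qed
  ultimately have "bij_betw f (\<Union>?K) (\<Union>?L) \<and> (\<lambda>\<sigma>. f ` \<sigma>) ` ?K = ?L"
    by (simp only: Union_pattern_complex)
  then have "\<exists>f. bij_betw f (\<Union>?K) (\<Union>?L) \<and> (\<lambda>\<sigma>. f ` \<sigma>) ` ?K = ?L" by (intro exI[of _ f])
  then show ?thesis by (simp only: complex_isomorphism_def mem_Collect_eq prod.case)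
qed

lemma compatible_degenerate:
  assumes "\<not> distinct [i, j, k, l]"
  shows "compatible A B C D E G (i, j) (k, l) \<longleftrightarrow> i \<noteq> j \<and> k \<noteq> l \<and> i \<noteq> l \<and> k \<noteq> j"
proof -
  consider "i = j" | "k = l" | "i = l" | "k = j" | "i = k" | "j = l" using assms by auto
  then show ?thesis unfolding compatible_def prod.case by cases simp_all
qed

text \<open>Exchanging tails and heads swaps the words \<open>THTH\<close> and \<open>HTHT\<close>,
  \<open>THHT\<close> and \<open>HTTH\<close>, \<open>TTHH\<close> and \<open>HHTT\<close>.\<close>

lemma compatible_negation:
  "compatible B A D C G E (j, i) (l, k) \<longleftrightarrow> compatible A B C D E G (i, j) (k, l)"
proof (cases "distinct [i, j, k, l]")
  case True
  then show ?thesis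
    by (rule sorted_quadruple_cases)
      (elim insertE emptyE Pair_inject; simp only: compatible_quadruple)
next
  case False
  then have "\<not> distinct [j, i, l, k]" by auto
  then show ?thesis
    unfolding compatible_degenerate[OF False] compatible_degenerate[OF \<open>\<not> distinct [j, i, l, k]\<close>] by blast
qed

lemma pattern_complex_negation:
  "(pattern_complex A B C D E G :: 'n::{finite,linorder} arrow_complex, pattern_complex B A D C G E) \<in> complex_isomorphism"
proof (rule pattern_complex_isomorphic)
  show "bij prod.swap" by simp
  fix a b :: "'n arrow"
  show "compatible B A D C G E (prod.swap a) (prod.swap b) \<longleftrightarrow> compatible A B C D E G a b"
    by (cases a; cases b) (simp add: compatible_negation)
qed

text \<open>Reading words backwards fixes the palindromes \<open>THHT\<close> and
  \<open>HTTH\<close> and swaps the other two pairs of words. Together with negation this yields a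
  symmetry that exchanges only \<open>C\<close> and \<open>D\<close>.\<close>

lemma pattern_complex_reversal:
  "(pattern_complex A B C D E G :: 'n::{finite,linorder} arrow_complex, pattern_complex B A C D G E) \<in> complex_isomorphism"
proof -
  obtain \<rho> :: "'n \<Rightarrow> 'n" where \<rho>: "bij \<rho>" "\<And>x y. \<rho> x < \<rho> y \<longleftrightarrow> y < x"
    using exists_reversal by blast
  have eq: "\<rho> x = \<rho> y \<longleftrightarrow> x = y" for x y using \<rho>(1) by (auto simp: bij_def inj_def)
  show ?thesis
  proof (rule pattern_complex_isomorphic)
    show "bij (map_prod \<rho> \<rho>)" using \<rho>(1) bij_betw_map_prod[of \<rho> UNIV UNIV \<rho> UNIV UNIV] by simp
    fix a b :: "'n arrow"
    obtain i j k l where ab: "a = (i, j)" "b = (k, l)" by (cases a, cases b)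
    have "compatible B A C D G E (\<rho> i, \<rho> j) (\<rho> k, \<rho> l) \<longleftrightarrow> compatible A B C D E G (i, j) (k, l)"
    proof (cases "distinct [i, j, k, l]")
      case True
      then show ?thesis
      proof (rule sorted_quadruple_cases, goal_cases)
        case (1 p q r s)
        note lt = 1(1-3)
        have lt': "\<rho> s < \<rho> r" "\<rho> r < \<rho> q" "\<rho> q < \<rho> p" using lt by (simp_all add: \<rho>(2))
        show ?thesis
          using 1(5)
          by (elim insertE emptyE Pair_inject;
            simp only: compatible_quadruple[OF lt] compatible_quadruple[OF lt'])
      qed
    next
      case False
      then have "\<not> distinct [\<rho> i, \<rho> j, \<rho> k, \<rho> l]" by (simp add: eq)
      then show ?thesis using False by (simp add: compatible_degenerate eq del: distinct.simps)
    qed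
    then show "compatible B A C D G E (map_prod \<rho> \<rho> a) (map_prod \<rho> \<rho> b) \<longleftrightarrow> compatible A B C D E G a b"
      by (simp add: ab)
  qed
qed

section \<open>Counting non-edges\<close>

definition defect :: "'v set set \<Rightarrow> 'v \<Rightarrow> nat" where
  "defect K v = card {w \<in> \<Union>K. {v, w} \<notin> K}"

definition defect_count :: "'v set set \<Rightarrow> nat \<Rightarrow> nat" where
  "defect_count K m = card {v \<in> \<Union>K. defect K v = m}"

lemma image_filter:
  "(\<And>v. v \<in> V \<Longrightarrow> P (f v) \<longleftrightarrow> Q v) \<Longrightarrow> {w \<in> f ` V. P w} = f ` {v \<in> V. Q v}"
  by auto

lemma defect_count_isomorphic:
  assumes "(K, L) \<in> complex_isomorphism"
  shows "defect_count K m = defect_count L m"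
proof -
  obtain f where f: "bij_betw f (\<Union>K) (\<Union>L)" and L: "(\<lambda>\<sigma>. f ` \<sigma>) ` K = L"
    using assms by (auto simp: complex_isomorphism_def)
  have inj: "inj_on f (\<Union>K)" and surj: "f ` \<Union>K = \<Union>L" using f by (auto simp: bij_betw_def)
  have edge: "{f v, f w} \<in> L \<longleftrightarrow> {v, w} \<in> K" if "v \<in> \<Union>K" "w \<in> \<Union>K" for v w
  proof
    assume "{f v, f w} \<in> L"
    then obtain \<sigma> where \<sigma>: "\<sigma> \<in> K" "f ` \<sigma> = f ` {v, w}" unfolding L[symmetric] by auto
    moreover have "\<sigma> = {v, w}"
      using inj_on_image_eq_iff[OF inj, of \<sigma> "{v, w}"] \<sigma> that by blast
    ultimately show "{v, w} \<in> K" by simp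
  next
    assume "{v, w} \<in> K"
    then have "f ` {v, w} \<in> L" unfolding L[symmetric] by (rule imageI)
    then show "{f v, f w} \<in> L" by simp
  qed
  have defect: "defect L (f v) = defect K v" if v: "v \<in> \<Union>K" for v
  proof -
    have "{w \<in> \<Union>L. {f v, w} \<notin> L} = f ` {w \<in> \<Union>K. {v, w} \<notin> K}"
      unfolding surj[symmetric] by (rule image_filter) (simp only: edge[OF v])
    moreover have "inj_on f {w \<in> \<Union>K. {v, w} \<notin> K}" using inj by (rule inj_on_subset) blast
    ultimately show ?thesis by (simp add: defect_def card_image)
  qed
  have "{v \<in> \<Union>L. defect L v = m} = f ` {v \<in> \<Union>K. defect K v = m}"
    unfolding surj[symmetric] by (rule image_filter) (simp only: defect)
  moreover have "inj_on f {v \<in> \<Union>K. defect K v = m}" using inj by (rule inj_on_subset) blast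
  ultimately show ?thesis by (simp add: defect_count_def card_image)
qed

text \<open>Half of the ordered pairs of distinct elements are increasing; the factor 2 avoids the
  division.\<close>

lemma sum_diagonal_block:
  fixes S :: "'a::linorder set"
  assumes "finite S"
  shows "2 * (\<Sum>k\<in>S. \<Sum>l\<in>S. if k < l then a else if l < k then d else 0) = (a + d) * (card S * (card S - 1) :: nat)"
  using assms
proof (induction rule: finite_linorder_max_induct)
  case (insert b S)
  have "(\<Sum>k\<in>insert b S. \<Sum>l\<in>insert b S. if k < l then a else if l < k then d else 0) =
      (\<Sum>l\<in>insert b S. if b < l then a else if l < b then d else 0) +
      (\<Sum>k\<in>S. \<Sum>l\<in>insert b S. if k < l then a else if l < k then d else 0)"
    using insert by (subst sum.insert) auto
  also have "(\<Sum>l\<in>insert b S. if b < l then a else if l < b then d else 0) = (\<Sum>l\<in>S. d)"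
  proof -
    have "(\<Sum>l\<in>S. if b < l then a else if l < b then d else 0) = (\<Sum>l\<in>S. d)"
      using insert by (intro sum.cong) (auto dest: less_not_sym)
    then show ?thesis using insert by (subst sum.insert) auto
  qed
  also have "(\<Sum>k\<in>S. \<Sum>l\<in>insert b S. if k < l then a else if l < k then d else 0) =
      (\<Sum>k\<in>S. a + (\<Sum>l\<in>S. if k < l then a else if l < k then d else 0))"
    using insert by (intro sum.cong refl, subst sum.insert) auto
  finally have "(\<Sum>k\<in>insert b S. \<Sum>l\<in>insert b S. if k < l then a else if l < k then d else 0) =
      (a + d) * card S + (\<Sum>k\<in>S. \<Sum>l\<in>S. if k < l then a else if l < k then d else 0)"
    by (simp add: sum.distrib algebra_simps)
  then have "2 * (\<Sum>k\<in>insert b S. \<Sum>l\<in>insert b S. if k < l then a else if l < k then d else 0) =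
      2 * ((a + d) * card S) + (a + d) * (card S * (card S - 1))"
    using insert.IH by simp
  also have "\<dots> = (a + d) * (card S * (card S + 1))"
    by (cases "card S") (simp_all add: algebra_simps)
  finally show ?case using insert by (auto simp: algebra_simps)
qed simp

section \<open>Non-neighbours of an arrow in terms of its position\<close>

definition twice_nonedges :: "bool \<Rightarrow> bool \<Rightarrow> bool \<Rightarrow> bool \<Rightarrow> bool \<Rightarrow> bool \<Rightarrow> nat \<Rightarrow> nat \<Rightarrow> nat \<Rightarrow> nat" where
  "twice_nonedges A B C D E G p q r =
     (of_bool A + of_bool D) * (p * (p - 1)) + (of_bool (\<not> E) + of_bool (\<not> A)) * (q * (q - 1)) +
     (of_bool A + of_bool C) * (r * (r - 1)) +
     2 * ((of_bool E + of_bool (\<not> D)) * (p * q) + (of_bool E + of_bool (\<not> C)) * (q * r) +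
       (of_bool (\<not> E) + of_bool (\<not> B)) * (p * r))"

text \<open>
  Twice the number of arrows that share no index with a forward arrow and form no edge with it, when
  \<open>p\<close>, \<open>q\<close> and \<open>r\<close> indices lie before, between and after its endpoints.
\<close>

lemma twice_nonedges_eq:
  fixes i j :: "'n::{finite,linorder}"
  assumes "i < j"
  defines "P \<equiv> {x. x < i}" and "Q \<equiv> {x. i < x \<and> x < j}" and "R \<equiv> {x. j < x}"
  shows "2 * (\<Sum>k\<in>P \<union> Q \<union> R. \<Sum>l\<in>P \<union> Q \<union> R. of_bool (k \<noteq> l \<and> \<not> compatible A B C D E G (i, j) (k, l))) =
    twice_nonedges A B C D E G (card P) (card Q) (card R)"
proof -
  define f where "f k l = (of_bool (k \<noteq> l \<and> \<not> compatible A B C D E G (i, j) (k, l)) :: nat)" for k l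
  note quad = compatible_quadruple
  have ij: "k < j" if "k \<in> P" for k using that assms(1) by (auto simp: P_def)
  \<comment> \<open>The word formed with a second arrow \<open>(k, l)\<close> depends only on the
    blocks containing \<open>k\<close> and \<open>l\<close> and, inside one block, on their
    order.\<close>
  have PP: "f k l = (if k < l then of_bool A else if l < k then of_bool D else 0)" if "k \<in> P" "l \<in> P" for k l
    using that assms(1) quad(2)[of k l i j A B C D E G] quad(14)[of l k i j A B C D E G]
    by (cases k l rule: linorder_cases) (auto simp: f_def P_def)
  have QQ: "f k l = (if k < l then of_bool (\<not> E) else if l < k then of_bool (\<not> A) else 0)" if "k \<in> Q" "l \<in> Q" for k l
    using that quad(19)[of i k l j A B C D E G] quad(3)[of i l k j A B C D E G]
    by (cases k l rule: linorder_cases) (auto simp: f_def Q_def)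
  have RR: "f k l = (if k < l then of_bool A else if l < k then of_bool C else 0)" if "k \<in> R" "l \<in> R" for k l
    using that assms(1) quad(1)[of i j k l A B C D E G] quad(9)[of i j l k A B C D E G]
    by (cases k l rule: linorder_cases) (auto simp: f_def R_def)
  have PQ: "f k l = of_bool E" "f l k = of_bool (\<not> D)" if "k \<in> P" "l \<in> Q" for k l
    using that quad(18)[of k i l j A B C D E G] quad(16)[of k i l j A B C D E G] by (auto simp: f_def P_def Q_def)
  have QR: "f k l = of_bool E" "f l k = of_bool (\<not> C)" if "k \<in> Q" "l \<in> R" for k l
    using that quad(17)[of i k j l A B C D E G] quad(11)[of i k j l A B C D E G] by (auto simp: f_def R_def Q_def)
  have PR: "f k l = of_bool (\<not> E)" "f l k = of_bool (\<not> B)" if "k \<in> P" "l \<in> R" for k l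
    using that assms(1) quad(20)[of k i j l A B C D E G] quad(8)[of k i j l A B C D E G] by (auto simp: f_def P_def R_def)
  have disj: "P \<inter> Q = {}" "(P \<union> Q) \<inter> R = {}" using assms(1) by (auto simp: P_def Q_def R_def)
  have split: "(\<Sum>l\<in>P \<union> Q \<union> R. g l) = (\<Sum>l\<in>P. g l) + (\<Sum>l\<in>Q. g l) + (\<Sum>l\<in>R. g l)" for g :: "'n \<Rightarrow> nat"
    using disj by (simp add: sum.union_disjoint)
  have off: "(\<Sum>k\<in>S. \<Sum>l\<in>S'. f k l) = c * (card S * card S')"
    if "\<And>k l. k \<in> S \<Longrightarrow> l \<in> S' \<Longrightarrow> f k l = c" for S S' c
  proof -
    have "(\<Sum>k\<in>S. \<Sum>l\<in>S'. f k l) = (\<Sum>k\<in>S. \<Sum>l\<in>S'. c)" using that by (intro sum.cong refl) auto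
    then show ?thesis by simp
  qed
  have diag: "2 * (\<Sum>k\<in>S. \<Sum>l\<in>S. f k l) = (a + d) * (card S * (card S - 1))"
    if "\<And>k l. k \<in> S \<Longrightarrow> l \<in> S \<Longrightarrow> f k l = (if k < l then a else if l < k then d else 0)" for S a d
  proof -
    have "(\<Sum>k\<in>S. \<Sum>l\<in>S. f k l) = (\<Sum>k\<in>S. \<Sum>l\<in>S. if k < l then a else if l < k then d else 0)"
      using that by (intro sum.cong refl) auto
    then show ?thesis using sum_diagonal_block[of S a d] by simp
  qed
  have diags: "2 * (\<Sum>k\<in>P. \<Sum>l\<in>P. f k l) = (of_bool A + of_bool D) * (card P * (card P - 1))"
    "2 * (\<Sum>k\<in>Q. \<Sum>l\<in>Q. f k l) = (of_bool (\<not> E) + of_bool (\<not> A)) * (card Q * (card Q - 1))"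
    "2 * (\<Sum>k\<in>R. \<Sum>l\<in>R. f k l) = (of_bool A + of_bool C) * (card R * (card R - 1))"
    by (rule diag, rule PP QQ RR, assumption+)+
  have offs: "(\<Sum>k\<in>P. \<Sum>l\<in>Q. f k l) = of_bool E * (card P * card Q)"
    "(\<Sum>k\<in>Q. \<Sum>l\<in>P. f k l) = of_bool (\<not> D) * (card Q * card P)"
    "(\<Sum>k\<in>Q. \<Sum>l\<in>R. f k l) = of_bool E * (card Q * card R)"
    "(\<Sum>k\<in>R. \<Sum>l\<in>Q. f k l) = of_bool (\<not> C) * (card R * card Q)"
    "(\<Sum>k\<in>P. \<Sum>l\<in>R. f k l) = of_bool (\<not> E) * (card P * card R)"
    "(\<Sum>k\<in>R. \<Sum>l\<in>P. f k l) = of_bool (\<not> B) * (card R * card P)"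
    by (rule off, rule PQ(1) PQ(2) QR(1) QR(2) PR(1) PR(2), assumption+)+
  have "(\<Sum>k\<in>P \<union> Q \<union> R. \<Sum>l\<in>P \<union> Q \<union> R. f k l) =
      (\<Sum>k\<in>P. \<Sum>l\<in>P. f k l) + (\<Sum>k\<in>Q. \<Sum>l\<in>Q. f k l) + (\<Sum>k\<in>R. \<Sum>l\<in>R. f k l) +
      ((\<Sum>k\<in>P. \<Sum>l\<in>Q. f k l) + (\<Sum>k\<in>Q. \<Sum>l\<in>P. f k l)) + ((\<Sum>k\<in>Q. \<Sum>l\<in>R. f k l) + (\<Sum>k\<in>R. \<Sum>l\<in>Q. f k l)) +
      ((\<Sum>k\<in>P. \<Sum>l\<in>R. f k l) + (\<Sum>k\<in>R. \<Sum>l\<in>P. f k l))"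
    by (simp add: split sum.distrib)
  then have "2 * (\<Sum>k\<in>P \<union> Q \<union> R. \<Sum>l\<in>P \<union> Q \<union> R. f k l) =
      2 * (\<Sum>k\<in>P. \<Sum>l\<in>P. f k l) + 2 * (\<Sum>k\<in>Q. \<Sum>l\<in>Q. f k l) + 2 * (\<Sum>k\<in>R. \<Sum>l\<in>R. f k l) +
      2 * (((\<Sum>k\<in>P. \<Sum>l\<in>Q. f k l) + (\<Sum>k\<in>Q. \<Sum>l\<in>P. f k l)) + ((\<Sum>k\<in>Q. \<Sum>l\<in>R. f k l) + (\<Sum>k\<in>R. \<Sum>l\<in>Q. f k l)) +
      ((\<Sum>k\<in>P. \<Sum>l\<in>R. f k l) + (\<Sum>k\<in>R. \<Sum>l\<in>P. f k l)))"
    by simp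
  also have "\<dots> = twice_nonedges A B C D E G (card P) (card Q) (card R)"
    unfolding diags offs twice_nonedges_def by (simp add: algebra_simps)
  finally show ?thesis unfolding f_def .
qed

text \<open>The constant is twice the number of non-neighbours that share an index: the
  \<open>CARD('n) - 1\<close> arrows leaving \<open>j\<close>, and the \<open>CARD('n) - 2\<close>
  arrows entering \<open>i\<close> from elsewhere.\<close>

lemma defect_forward:
  fixes i j :: "'n::{finite,linorder}"
  assumes "i < j"
  shows "2 * defect (pattern_complex A B C D E G) (i, j) = 4 * CARD('n) - 6 +
    twice_nonedges A B C D E G (card {x. x < i}) (card {x. i < x \<and> x < j}) (card {x. j < x})"
proof -
  define V where "V = {x. x < i} \<union> {x. i < x \<and> x < j} \<union> {x. j < x}"
  define f where "f k l = (of_bool (k \<noteq> l \<and> \<not> compatible A B C D E G (i, j) (k, l)) :: nat)" for k l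
  have "defect (pattern_complex A B C D E G) (i, j) = card {w. fst w \<noteq> snd w \<and> \<not> compatible A B C D E G (i, j) w}"
    unfolding defect_def Union_pattern_complex edge_pattern_complex arrows_def
    by (rule arg_cong[where f = card]) auto
  also have "\<dots> = (\<Sum>w\<in>UNIV. of_bool (fst w \<noteq> snd w \<and> \<not> compatible A B C D E G (i, j) w))"
    by (simp add: of_bool_def sum.If_cases)
  also have "\<dots> = (\<Sum>k\<in>UNIV. \<Sum>l\<in>UNIV. f k l)" unfolding sum_arrows f_def by simp
  finally have defect: "defect (pattern_complex A B C D E G) (i, j) = (\<Sum>k\<in>UNIV. \<Sum>l\<in>UNIV. f k l)" .
  have V: "V = - {i, j}" using assms by (auto simp: V_def neq_iff)
  have split: "(\<Sum>l\<in>UNIV. g l) = g i + g j + (\<Sum>l\<in>V. g l)" for g :: "'n \<Rightarrow> nat"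
  proof -
    have "(\<Sum>l\<in>UNIV. g l) = (\<Sum>l\<in>{i, j}. g l) + (\<Sum>l\<in>- {i, j}. g l)"
      by (subst sum.union_disjoint[symmetric]) (auto simp: Compl_partition)
    then show ?thesis using assms unfolding V by simp
  qed
  have card_V: "card V = CARD('n) - 2"
    unfolding V Compl_eq_Diff_UNIV using assms by (subst card_Diff_subset) auto
  have "CARD('n) \<ge> 2" using card_mono[of UNIV "{i, j}"] assms by simp
  have row_i: "f i l = 0" for l
    using compatible_shared(1)[OF less_imp_neq[OF assms], of l A B C D E G] by (auto simp: f_def)
  have row_j: "f j l = of_bool (l \<noteq> j)" for l
    using compatible_shared(4)[of A B C D E G i j l] by (auto simp: f_def)
  have col_i: "f k i = of_bool (k \<noteq> i)" for k
    using compatible_shared(3)[of A B C D E G i j k] by (auto simp: f_def)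
  have col_j: "f k j = 0" if "k \<noteq> j" for k
    using compatible_shared(2)[OF less_imp_neq[OF assms] that, of A B C D E G] by (auto simp: f_def)
  have "(\<Sum>l\<in>UNIV. f j l) = CARD('n) - 1"
  proof -
    have "(\<Sum>l\<in>UNIV. f j l) = (\<Sum>l\<in>UNIV - {j}. 1)"
      unfolding row_j by (rule sum.mono_neutral_cong_right) auto
    then show ?thesis by (simp add: card_Diff_singleton)
  qed
  moreover have "(\<Sum>k\<in>V. \<Sum>l\<in>UNIV. f k l) = (\<Sum>k\<in>V. 1 + (\<Sum>l\<in>V. f k l))"
    unfolding split by (rule sum.cong) (auto simp: col_i col_j V)
  then have "(\<Sum>k\<in>V. \<Sum>l\<in>UNIV. f k l) = CARD('n) - 2 + (\<Sum>k\<in>V. \<Sum>l\<in>V. f k l)"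
    by (simp only: sum.distrib sum_constant card_V) simp
  ultimately have "(\<Sum>k\<in>UNIV. \<Sum>l\<in>UNIV. f k l) = CARD('n) - 1 + (CARD('n) - 2) + (\<Sum>k\<in>V. \<Sum>l\<in>V. f k l)"
    unfolding split[of "\<lambda>k. \<Sum>l\<in>UNIV. f k l"] using \<open>CARD('n) \<ge> 2\<close> by (simp add: row_i)
  then have "2 * defect (pattern_complex A B C D E G) (i, j) =
      2 * (CARD('n) - 1 + (CARD('n) - 2)) + 2 * (\<Sum>k\<in>V. \<Sum>l\<in>V. f k l)"
    unfolding defect by simp
  also have "2 * (\<Sum>k\<in>V. \<Sum>l\<in>V. f k l) =
      twice_nonedges A B C D E G (card {x. x < i}) (card {x. i < x \<and> x < j}) (card {x. j < x})"
    unfolding f_def V_def by (rule twice_nonedges_eq[OF assms])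
  finally show ?thesis using \<open>CARD('n) \<ge> 2\<close> by simp
qed

lemma position_between:
  fixes i j :: "'n::{finite,linorder}"
  assumes "i < j"
  shows "position j = position i + 1 + card {x. i < x \<and> x < j}"
proof -
  have "{x. x < j} = insert i ({x. x < i} \<union> {x. i < x \<and> x < j})" using assms by auto
  then have "position j = card (insert i ({x. x < i} \<union> {x. i < x \<and> x < j}))" by (simp add: position_def)
  also have "\<dots> = Suc (card ({x. x < i} \<union> {x. i < x \<and> x < j}))" by (rule card_insert_disjoint) auto
  also have "card ({x. x < i} \<union> {x. i < x \<and> x < j}) = position i + card {x. i < x \<and> x < j}"
    unfolding position_def by (rule card_Un_disjoint) auto
  finally show ?thesis by simp
qed

lemma position_above:
  fixes j :: "'n::{finite,linorder}"
  shows "position j + 1 + card {x. j < x} = CARD('n)"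
proof -
  have "UNIV = insert j ({x. x < j} \<union> {x. j < x})" by auto
  then have "CARD('n) = card (insert j ({x. x < j} \<union> {x. j < x}))" by simp
  also have "\<dots> = Suc (card ({x. x < j} \<union> {x. j < x}))" by (rule card_insert_disjoint) auto
  also have "card ({x. x < j} \<union> {x. j < x}) = position j + card {x. j < x}"
    unfolding position_def by (rule card_Un_disjoint) auto
  finally show ?thesis by simp
qed

lemma bij_betw_gaps:
  assumes "CARD('n::{finite,linorder}) = N + 2"
  shows "bij_betw (\<lambda>(i, j). (card {x. x < i}, card {x. i < x \<and> x < j}, card {x. j < x}))
    {(i :: 'n, j). i < j} {(p, q, r). p + q + r = N}"
proof -
  define g :: "'n arrow \<Rightarrow> nat \<times> nat \<times> nat" where
    "g = (\<lambda>(i, j). (card {x. x < i}, card {x. i < x \<and> x < j}, card {x. j < x}))"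
  have g: "g (i, j) = (p, q, r) \<longleftrightarrow> position i = p \<and> position j = p + q + 1 \<and> p + q + r = N" if "i < j" for i j p q r
    using position_between[OF that] position_above[of j] assms unfolding g_def position_def by auto
  have inj: "position i = position j \<Longrightarrow> i = j" for i j :: 'n
    using position_less_iff[of i j] position_less_iff[of j i] by (cases i j rule: linorder_cases) auto
  have "bij_betw g {(i, j). i < j} {(p, q, r). p + q + r = N}"
  proof (rule bij_betw_imageI)
    show "inj_on g {(i, j). i < j}"
    proof (rule inj_onI, clarify)
      fix i j k l assume lt: "i < j" "k < l" and eq: "g (i, j) = g (k, l)"
      obtain p q r where pqr: "g (k, l) = (p, q, r)" by (cases "g (k, l)") auto
      then have "position i = position k" "position j = position l"
        using g[OF lt(2), of p q r] g[OF lt(1), of p q r] eq by auto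
      then show "i = k \<and> j = l" using inj by blast
    qed
    show "g ` {(i, j). i < j} = {(p, q, r). p + q + r = N}"
    proof (intro equalityI subsetI)
      fix t assume "t \<in> g ` {(i, j). i < j}"
      then obtain i j where ij: "i < j" "t = g (i, j)" by auto
      obtain p q r where "g (i, j) = (p, q, r)" by (cases "g (i, j)") auto
      then show "t \<in> {(p, q, r). p + q + r = N}" using g[OF ij(1), of p q r] ij(2) by simp
    next
      fix t :: "nat \<times> nat \<times> nat" assume "t \<in> {(p, q, r). p + q + r = N}"
      then obtain p q r where t: "t = (p, q, r)" "p + q + r = N" by auto
      have "p \<in> position ` (UNIV :: 'n set)" "p + q + 1 \<in> position ` (UNIV :: 'n set)"
        using bij_betw_imp_surj_on[OF bij_betw_position[where 'n = 'n]] assms t(2) by auto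
      then obtain i j :: 'n where ij: "position i = p" "position j = p + q + 1" by (metis imageE)
      then have "i < j" by (simp add: position_less_iff[symmetric])
      then have "g (i, j) = t" using g[of i j p q r] ij t by simp
      then show "t \<in> g ` {(i, j). i < j}" using \<open>i < j\<close> by force
    qed
  qed
  then show ?thesis unfolding g_def .
qed

definition nonedge_solutions ::
    "bool \<Rightarrow> bool \<Rightarrow> bool \<Rightarrow> bool \<Rightarrow> bool \<Rightarrow> bool \<Rightarrow> nat \<Rightarrow> nat \<Rightarrow> (nat \<times> nat \<times> nat) set" where
  "nonedge_solutions A B C D E G N m =
     {(p, q, r). p + q + r = N \<and> twice_nonedges A B C D E G p q r = 2 * m}"

lemma defect_backward:
  "defect (pattern_complex A B C D E G) (j, i) = defect (pattern_complex B A D C G E) (i, j)"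
proof -
  have swap: "compatible A B C D E G (j, i) (prod.swap w) \<longleftrightarrow> compatible B A D C G E (i, j) w"
      "prod.swap w \<in> arrows \<longleftrightarrow> w \<in> arrows" for w
    by (cases w, simp only: swap_simp compatible_negation) (cases w, auto simp: arrows_def)
  have image: "prod.swap ` {w \<in> arrows. \<not> compatible B A D C G E (i, j) w} = {w \<in> arrows. \<not> compatible A B C D E G (j, i) w}"
  proof (intro equalityI subsetI)
    fix w assume "w \<in> {w \<in> arrows. \<not> compatible A B C D E G (j, i) w}"
    then have "prod.swap w \<in> {w \<in> arrows. \<not> compatible B A D C G E (i, j) w}"
      using swap[of "prod.swap w"] by simp
    then have "prod.swap (prod.swap w) \<in> prod.swap ` {w \<in> arrows. \<not> compatible B A D C G E (i, j) w}"
      by (rule imageI)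
    then show "w \<in> prod.swap ` {w \<in> arrows. \<not> compatible B A D C G E (i, j) w}" by simp
  next
    fix w assume "w \<in> prod.swap ` {w \<in> arrows. \<not> compatible B A D C G E (i, j) w}"
    then obtain w' where "w = prod.swap w'" "w' \<in> arrows" "\<not> compatible B A D C G E (i, j) w'" by blast
    then show "w \<in> {w \<in> arrows. \<not> compatible A B C D E G (j, i) w}" using swap by simp
  qed
  have "inj_on prod.swap {w \<in> arrows. \<not> compatible B A D C G E (i, j) w}"
    by (rule inj_on_inverseI[of _ prod.swap]) simp
  then show ?thesis
    unfolding defect_def Union_pattern_complex edge_pattern_complex image[symmetric] by (rule card_image)
qed

text \<open>Here \<open>2 * N + 1\<close> non-neighbours share an index with the arrow, whatever the
  pattern, so \<open>m\<close> counts the index-disjoint ones. The second summand accounts for the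
  backward arrows, which negation makes forward.\<close>

lemma defect_count_pattern_complex:
  assumes card: "CARD('n::{finite,linorder}) = N + 2"
  shows "defect_count (pattern_complex A B C D E G :: 'n arrow_complex) (2 * N + 1 + m) =
    card (nonedge_solutions A B C D E G N m) + card (nonedge_solutions B A D C G E N m)"
proof -
  define g :: "'n arrow \<Rightarrow> nat \<times> nat \<times> nat" where
    "g = (\<lambda>(i, j). (card {x. x < i}, card {x. i < x \<and> x < j}, card {x. j < x}))"
  have bij: "bij_betw g {(i, j). i < j} {(p, q, r). p + q + r = N}"
    unfolding g_def by (rule bij_betw_gaps[OF card])
  define F where "F A B C D E G = {(i :: 'n, j). i < j \<and> defect (pattern_complex A B C D E G) (i, j) = 2 * N + 1 + m}"
    for A B C D E G
  have F: "card (F A B C D E G) = card (nonedge_solutions A B C D E G N m)" for A B C D E G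
  proof -
    have "g ` F A B C D E G = nonedge_solutions A B C D E G N m"
    proof -
      have iff: "defect (pattern_complex A B C D E G) (i, j) = 2 * N + 1 + m \<longleftrightarrow>
          (case g (i, j) of (p, q, r) \<Rightarrow> twice_nonedges A B C D E G p q r = 2 * m)" if "i < j" for i j :: 'n
        using defect_forward[OF that, of A B C D E G] card by (auto simp: g_def)
      have "F A B C D E G = {a \<in> {(i, j). i < j}. (case g a of (p, q, r) \<Rightarrow> twice_nonedges A B C D E G p q r = 2 * m)}"
        unfolding F_def using iff by auto
      moreover have "nonedge_solutions A B C D E G N m =
          {t \<in> g ` {(i, j). i < j}. (case t of (p, q, r) \<Rightarrow> twice_nonedges A B C D E G p q r = 2 * m)}"
        unfolding bij_betw_imp_surj_on[OF bij] nonedge_solutions_def by auto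
      ultimately show ?thesis by auto
    qed
    moreover have "inj_on g (F A B C D E G)"
      by (rule inj_on_subset[OF bij_betw_imp_inj_on[OF bij]]) (auto simp: F_def)
    ultimately show ?thesis using card_image[of g "F A B C D E G"] by simp
  qed
  have "{v \<in> (arrows :: 'n arrow set). defect (pattern_complex A B C D E G) v = 2 * N + 1 + m} =
      F A B C D E G \<union> prod.swap ` F B A D C G E"
  proof (intro equalityI subsetI)
    fix v assume v: "v \<in> {v \<in> (arrows :: 'n arrow set). defect (pattern_complex A B C D E G) v = 2 * N + 1 + m}"
    obtain i j where ij: "v = (i, j)" by (cases v)
    show "v \<in> F A B C D E G \<union> prod.swap ` F B A D C G E"
    proof (cases "i < j")
      case True
      then show ?thesis using v ij by (simp add: F_def)
    next
      case False
      then have "(j, i) \<in> F B A D C G E"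
        using v ij by (auto simp: F_def arrows_def defect_backward[symmetric])
      then have "prod.swap (j, i) \<in> prod.swap ` F B A D C G E" by (rule imageI)
      then show ?thesis using ij by simp
    qed
  qed (auto simp: F_def arrows_def defect_backward[of A B C D E G])
  moreover have "F A B C D E G \<inter> prod.swap ` F B A D C G E = {}" by (auto simp: F_def)
  ultimately show ?thesis
    unfolding defect_count_def Union_pattern_complex
    by (simp add: card_Un_disjoint card_image F)
qed

section \<open>Extreme and small numbers of non-neighbours\<close>

text \<open>The flags tell which of the terms \<open>p * (p - 1)\<close>,
  \<open>q * (q - 1)\<close>, \<open>r * (r - 1)\<close>, \<open>p * q\<close>,
  \<open>q * r\<close>, \<open>p * r\<close> have a positive coefficient and hence must
  vanish.\<close>

definition vanishing_triples :: "bool \<Rightarrow> bool \<Rightarrow> bool \<Rightarrow> bool \<Rightarrow> bool \<Rightarrow> bool \<Rightarrow> nat \<Rightarrow> (nat \<times> nat \<times> nat) set" where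
  "vanishing_triples P Q R PQ QR PR N = {(p, q, r). p + q + r = N \<and> (P \<longrightarrow> p \<le> 1) \<and> (Q \<longrightarrow> q \<le> 1) \<and>
     (R \<longrightarrow> r \<le> 1) \<and> (PQ \<longrightarrow> p = 0 \<or> q = 0) \<and> (QR \<longrightarrow> q = 0 \<or> r = 0) \<and> (PR \<longrightarrow> p = 0 \<or> r = 0)}"

lemma nonedge_solutions_0:
  "nonedge_solutions A B C D E G N 0 =
     vanishing_triples (A \<or> D) (\<not> E \<or> \<not> A) (A \<or> C) (E \<or> \<not> D) (E \<or> \<not> C) (\<not> E \<or> \<not> B) N"
proof -
  have "twice_nonedges A B C D E G p q r = 0 \<longleftrightarrow>
      (A \<or> D \<longrightarrow> p \<le> 1) \<and> (\<not> E \<or> \<not> A \<longrightarrow> q \<le> 1) \<and> (A \<or> C \<longrightarrow> r \<le> 1) \<and>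
      (E \<or> \<not> D \<longrightarrow> p = 0 \<or> q = 0) \<and> (E \<or> \<not> C \<longrightarrow> q = 0 \<or> r = 0) \<and> (\<not> E \<or> \<not> B \<longrightarrow> p = 0 \<or> r = 0)" for p q r
  proof -
    have "x * (x - 1) = 0 \<longleftrightarrow> x \<le> 1" for x :: nat by auto
    then show ?thesis
      unfolding twice_nonedges_def add_eq_0_iff_both_eq_0 mult_eq_0_iff[of "of_bool _ + of_bool _"] mult_eq_0_iff[of 2]
      by (simp only: mult_eq_0_iff[of p q] mult_eq_0_iff[of q r] mult_eq_0_iff[of p r] of_bool_eq_0_iff) (simp, blast)
  qed
  then show ?thesis by (simp add: nonedge_solutions_def vanishing_triples_def)
qed

text \<open>Complementing all bits exchanges edges and non-edges among index-disjoint pairs, and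
  \<open>N * (N - 1)\<close> arrows avoid both endpoints when \<open>N = p + q + r\<close>. The
  maximal count thus reduces to the count 0 of the complementary pattern.\<close>

lemma twice_nonedges_complement:
  "twice_nonedges A B C D E G p q r + twice_nonedges (\<not> A) (\<not> B) (\<not> C) (\<not> D) (\<not> E) (\<not> G) p q r =
    2 * ((p + q + r) * (p + q + r - 1))"
proof -
  have "(p + q + r) * (p + q + r - 1) = p * (p - 1) + q * (q - 1) + r * (r - 1) + 2 * (p * q) + 2 * (q * r) + 2 * (p * r)"
    by (cases p; cases q; cases r) (simp_all add: algebra_simps)
  moreover have "of_bool (\<not> b) = 1 - (of_bool b :: nat)" for b by simp
  ultimately show ?thesis
    unfolding twice_nonedges_def by (cases A; cases B; cases C; cases D; cases E) simp_all
qed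

lemma nonedge_solutions_max:
  "nonedge_solutions A B C D E G N (N * (N - 1)) =
    nonedge_solutions (\<not> A) (\<not> B) (\<not> C) (\<not> D) (\<not> E) (\<not> G) N 0"
proof -
  have "twice_nonedges A B C D E G p q r = 2 * (N * (N - 1)) \<longleftrightarrow>
      twice_nonedges (\<not> A) (\<not> B) (\<not> C) (\<not> D) (\<not> E) (\<not> G) p q r = 2 * 0" if "p + q + r = N" for p q r
    using twice_nonedges_complement[of A B C D E G p q r] unfolding that by linarith
  then show ?thesis unfolding nonedge_solutions_def by auto
qed

lemma card_vanishing_triples:
  assumes "N \<ge> 3"
  shows "card (vanishing_triples False True False True True False N) = N + 1"
    "card (vanishing_triples False True False True True True N) = 2"
    "card (vanishing_triples True False True True True False N) = 1"
    "card (vanishing_triples True False True True True True N) = 1"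
    "card (vanishing_triples True True False False True True N) = 1"
    "card (vanishing_triples True True False True True False N) = 2"
    "card (vanishing_triples True True True False False True N) = 0"
    "card (vanishing_triples True True True True False True N) = 0"
    "card (vanishing_triples True True True True True False N) = 0"
    "card (vanishing_triples True True True True True True N) = 0"
proof -
  have "vanishing_triples False True False True True False N = (\<lambda>p. (p, 0, N - p)) ` {..N}"
    using assms by (auto simp: vanishing_triples_def image_def)
  moreover have "inj_on (\<lambda>p. (p, 0 :: nat, N - p)) {..N}" by (rule inj_onI) simp
  ultimately show "card (vanishing_triples False True False True True False N) = N + 1"
    by (simp add: card_image)
  have "vanishing_triples False True False True True True N = {(0, 0, N), (N, 0, 0)}"
    "vanishing_triples True False True True True False N = {(0, N, 0)}"
    "vanishing_triples True False True True True True N = {(0, N, 0)}"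
    "vanishing_triples True True False False True True N = {(0, 0, N)}"
    "vanishing_triples True True False True True False N = {(0, 0, N), (1, 0, N - 1)}"
    "vanishing_triples True True True False False True N = {}"
    "vanishing_triples True True True True False True N = {}"
    "vanishing_triples True True True True True False N = {}"
    "vanishing_triples True True True True True True N = {}"
    using assms by (auto simp: vanishing_triples_def)
  then show "card (vanishing_triples False True False True True True N) = 2"
    "card (vanishing_triples True False True True True False N) = 1"
    "card (vanishing_triples True False True True True True N) = 1"
    "card (vanishing_triples True True False False True True N) = 1"
    "card (vanishing_triples True True False True True False N) = 2"
    "card (vanishing_triples True True True False False True N) = 0"
    "card (vanishing_triples True True True True False True N) = 0"
    "card (vanishing_triples True True True True True False N) = 0"
    "card (vanishing_triples True True True True True True N) = 0"
    using assms by simp_all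
qed

lemma finite_nonedge_solutions: "finite (nonedge_solutions A B C D E G N m)"
  unfolding nonedge_solutions_def
  by (rule finite_subset[of _ "{..N} \<times> {..N} \<times> {..N}"]) auto

lemma nat_small_cases:
  obtains "p = (0::nat)" | "p = 1" | "p = 2" | p' where "p = p' + 3"
  by (metis One_nat_def add.commute add_2_eq_Suc' le_Suc_ex less_2_cases less_Suc_eq linorder_not_less numeral_2_eq_2 numeral_3_eq_3)

text \<open>Prepares the ties that the extreme counts leave open. The third claim needs
  \<open>N \<ge> 4\<close>, since \<open>(2, 1, 0)\<close> is a solution for
  \<open>N = 3\<close>.\<close>

lemma nonedge_solutions_1_empty:
  assumes "N \<ge> 3"
  shows "nonedge_solutions False True False False False True N 1 = {}"
    "nonedge_solutions True False False False True False N 1 = {}"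
    "N \<ge> 4 \<Longrightarrow> nonedge_solutions False True False True False True N 1 = {}"
    "nonedge_solutions True False True False True False N 1 = {}"
proof -
  have *: "twice_nonedges False True False False False True p q r \<noteq> 2"
    "twice_nonedges True False False False True False p q r \<noteq> 2"
    "p + q + r \<ge> 4 \<Longrightarrow> twice_nonedges False True False True False True p q r \<noteq> 2"
    "twice_nonedges True False True False True False p q r \<noteq> 2"
    if "p + q + r \<ge> 3" for p q r
    by - (insert that, (cases p rule: nat_small_cases; cases q rule: nat_small_cases; cases r rule: nat_small_cases;
      simp add: twice_nonedges_def algebra_simps))+
  show "nonedge_solutions False True False False False True N 1 = {}"
    "nonedge_solutions True False False False True False N 1 = {}"
    "nonedge_solutions True False True False True False N 1 = {}"
    using * assms by (auto simp: nonedge_solutions_def)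
  show "nonedge_solutions False True False True False True N 1 = {}" if "N \<ge> 4"
    using *(3) assms that by (auto simp: nonedge_solutions_def)
qed

lemma nonedge_solutions_1_pos:
  assumes "N \<ge> 3"
  shows "card (nonedge_solutions False True False True True G N 1) > 0"
proof -
  have "(2, 0, N - 2) \<in> nonedge_solutions False True False True True G N 1"
    using assms by (simp add: nonedge_solutions_def twice_nonedges_def)
  then show ?thesis using finite_nonedge_solutions card_gt_0_iff by blast
qed

lemma nonedge_solutions_3:
  "nonedge_solutions A B C D E G 3 m =
    set (filter (\<lambda>(p, q, r). twice_nonedges A B C D E G p q r = 2 * m)
      [(0,0,3), (0,1,2), (0,2,1), (0,3,0), (1,0,2), (1,1,1), (1,2,0), (2,0,1), (2,1,0), (3,0,0)])"
proof -
  have "(p, q, r) \<in> set [(0,0,3), (0,1,2), (0,2,1), (0,3,0), (1,0,2), (1,1,1), (1,2,0), (2,0,1), (2,1,0), (3,0,0)] \<longleftrightarrow>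
      p + q + r = 3" for p q r :: nat
    by (simp, presburger)
  then show ?thesis unfolding nonedge_solutions_def set_filter by blast
qed

section \<open>Isomorphism classes\<close>

lemma equiv_complex_isomorphism: "equiv UNIV (complex_isomorphism :: ('v set set \<times> 'v set set) set)"
proof (rule equivI)
  show "(complex_isomorphism :: ('v set set \<times> 'v set set) set) \<subseteq> UNIV \<times> UNIV" by simp
  show "refl (complex_isomorphism :: ('v set set \<times> 'v set set) set)"
  proof (rule reflI)
    fix K :: "'v set set"
    have "bij_betw id (\<Union>K) (\<Union>K) \<and> (\<lambda>\<sigma>. id ` \<sigma>) ` K = K" by simp
    then show "(K, K) \<in> complex_isomorphism" unfolding complex_isomorphism_def by blast
  qed
  show "sym (complex_isomorphism :: ('v set set \<times> 'v set set) set)"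
  proof (rule symI)
    fix K L :: "'v set set" assume "(K, L) \<in> complex_isomorphism"
    then obtain f where f: "bij_betw f (\<Union>K) (\<Union>L)" "(\<lambda>\<sigma>. f ` \<sigma>) ` K = L"
      by (auto simp: complex_isomorphism_def)
    define g where "g = inv_into (\<Union>K) f"
    have inj: "inj_on f (\<Union>K)" using f(1) by (rule bij_betw_imp_inj_on)
    have "g ` f ` \<sigma> = \<sigma>" if "\<sigma> \<in> K" for \<sigma>
      unfolding g_def using inj that by (intro inv_into_image_cancel) auto
    then have "(\<lambda>\<sigma>. g ` \<sigma>) ` L = K" unfolding f(2)[symmetric] image_image by simp
    moreover have "bij_betw g (\<Union>L) (\<Union>K)" unfolding g_def by (rule bij_betw_inv_into[OF f(1)])
    ultimately show "(L, K) \<in> complex_isomorphism" unfolding complex_isomorphism_def by blast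
  qed
  show "trans (complex_isomorphism :: ('v set set \<times> 'v set set) set)"
  proof (rule transI)
    fix K L M :: "'v set set"
    assume "(K, L) \<in> complex_isomorphism" "(L, M) \<in> complex_isomorphism"
    then obtain f g where f: "bij_betw f (\<Union>K) (\<Union>L)" "(\<lambda>\<sigma>. f ` \<sigma>) ` K = L"
      and g: "bij_betw g (\<Union>L) (\<Union>M)" "(\<lambda>\<sigma>. g ` \<sigma>) ` L = M"
      by (auto simp: complex_isomorphism_def)
    have "(\<lambda>\<sigma>. (g \<circ> f) ` \<sigma>) ` K = M"
      unfolding g(2)[symmetric] f(2)[symmetric] by (simp add: image_image image_comp[symmetric])
    then show "(K, M) \<in> complex_isomorphism"
      using bij_betw_trans[OF f(1) g(1)] unfolding complex_isomorphism_def by blast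
  qed
qed

lemma card_quotient_representatives:
  assumes R: "equiv UNIV R" and "Rs \<subseteq> S"
    and cover: "\<And>x. x \<in> S \<Longrightarrow> \<exists>y\<in>Rs. (x, y) \<in> R"
    and distinct: "\<And>x y. x \<in> Rs \<Longrightarrow> y \<in> Rs \<Longrightarrow> (x, y) \<in> R \<Longrightarrow> x = y"
  shows "card (S // R) = card Rs"
proof -
  have class_eq: "R `` {x} = R `` {y} \<longleftrightarrow> (x, y) \<in> R" for x y
    using eq_equiv_class_iff[OF R] by simp
  have "S // R = (\<lambda>x. R `` {x}) ` Rs"
  proof (intro equalityI subsetI)
    fix X assume "X \<in> S // R"
    then obtain x where x: "x \<in> S" "X = R `` {x}" by (auto simp: quotient_def)
    then obtain y where y: "y \<in> Rs" "(x, y) \<in> R" using cover by blast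
    then show "X \<in> (\<lambda>x. R `` {x}) ` Rs" using x(2) class_eq[of x y] by blast
  qed (use \<open>Rs \<subseteq> S\<close> in \<open>auto simp: quotient_def\<close>)
  moreover have "inj_on (\<lambda>x. R `` {x}) Rs" using distinct class_eq by (auto intro!: inj_onI)
  ultimately show ?thesis by (simp add: card_image)
qed

section \<open>Representatives and the final count\<close>

type_synonym pattern = "bool \<times> bool \<times> bool \<times> bool \<times> bool \<times> bool"

definition complex_of :: "pattern \<Rightarrow> 'n::{finite,linorder} arrow_complex" where
  "complex_of = (\<lambda>(A, B, C, D, E, G). pattern_complex A B C D E G)"

definition lex_patterns :: "pattern list" where
  "lex_patterns = [(False, False, False, False, False, False), (False, False, False, False, False, True),
     (False, False, False, False, True, True)]"

definition revlex_patterns :: "pattern list" where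
  "revlex_patterns = [(True, True, True, True, False, False), (True, True, True, True, False, True),
     (True, True, True, True, True, True)]"

definition simion_patterns_a :: "pattern list" where
  "simion_patterns_a = [(False, True, False, False, False, False), (False, True, False, False, False, True),
     (False, True, False, False, True, False), (False, True, False, False, True, True)]"

definition simion_patterns_b :: "pattern list" where
  "simion_patterns_b = [(False, True, False, True, False, False), (False, True, False, True, False, True),
     (False, True, False, True, True, False), (False, True, False, True, True, True)]"

definition simion_patterns_c :: "pattern list" where
  "simion_patterns_c = [(False, True, True, True, True, True)]"

definition patterns :: "pattern list" where
  "patterns = lex_patterns @ revlex_patterns @ simion_patterns_a @ simion_patterns_b @ simion_patterns_c"

text \<open>The extreme counts separate most patterns. The count for 1 breaks two ties within the
  Simion patterns, and the count for 2 is what distinguishes a lex pattern from a Simion pattern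
  when \<open>N = 3\<close>.\<close>

definition defect_key :: "nat \<Rightarrow> pattern \<Rightarrow> nat \<times> nat \<times> nat \<times> nat" where
  "defect_key N = (\<lambda>(A, B, C, D, E, G).
     let c = (\<lambda>m. card (nonedge_solutions A B C D E G N m) + card (nonedge_solutions B A D C G E N m))
     in (c 0, c (N * (N - 1)), c 1, c 2))"

lemma distinct_defect_keys:
  assumes "N \<ge> 3"
  shows "distinct (map (defect_key N) patterns)"
proof -
  have lex_simion: "defect_key N (False, False, False, False, True, True) \<noteq> defect_key N (False, True, False, False, True, False)"
  proof (cases "N = 3")
    case True
    then show ?thesis
      by (simp add: defect_key_def nonedge_solutions_3 twice_nonedges_def del: One_nat_def)
  next
    case False
    then show ?thesis
      using assms by (simp add: defect_key_def nonedge_solutions_0 card_vanishing_triples)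
  qed
  have simion_1: "defect_key N (False, True, False, False, False, True) \<noteq> defect_key N (False, True, False, True, True, True)"
    using nonedge_solutions_1_empty[OF assms] nonedge_solutions_1_pos[OF assms, of True]
    by (simp add: defect_key_def)
  have simion_2: "defect_key N (False, True, False, True, False, True) \<noteq> defect_key N (False, True, False, True, True, False)"
  proof (cases "N = 3")
    case True
    then show ?thesis
      by (simp add: defect_key_def nonedge_solutions_3 twice_nonedges_def del: One_nat_def)
  next
    case False
    then show ?thesis
      using nonedge_solutions_1_empty[OF assms] nonedge_solutions_1_pos[OF assms, of False] assms
      by (simp add: defect_key_def)
  qed
  \<comment> \<open>The extreme counts alone differ on all pairs except the three treated above, one
    of which ties only for \<open>N = 3\<close>.\<close>
  define key where "key x = (fst (defect_key N x), fst (snd (defect_key N x)))" for x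
  have key: "defect_key N x \<noteq> defect_key N y" if "key x \<noteq> key y" for x y
    using that by (auto simp: key_def)
  have keys: "map key patterns = [(4, 2), (4, 1), (4, 0), (0, 4), (1, 4), (2, 4), (2, 1), (3, 1), (N + 1, 0),
      (N + 2, 0), (1, 3), (2, 2), (2, 2), (3, 1), (1, 2)]"
    by (simp add: key_def defect_key_def patterns_def lex_patterns_def revlex_patterns_def simion_patterns_a_def
        simion_patterns_b_def simion_patterns_c_def nonedge_solutions_max[unfolded One_nat_def] nonedge_solutions_0
        card_vanishing_triples[OF assms])
  note lists = patterns_def lex_patterns_def revlex_patterns_def simion_patterns_a_def
        simion_patterns_b_def simion_patterns_c_def
  note vals = keys[unfolded lists append.simps list.map list.inject]
  show ?thesis
    unfolding lists append.simps list.map distinct.simps list.set insert_iff de_Morgan_disj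
    by (intro conjI; (rule TrueI | rule lex_simion | rule simion_1 | rule simion_2 |
      simp only: empty_iff not_False_eq_True | (rule key, use vals assms in simp)))
qed

lemma complex_of_distinct:
  assumes card: "CARD('n::{finite,linorder}) = N + 2" "N \<ge> 3"
    and xy: "x \<in> set patterns" "y \<in> set patterns"
    and iso: "(complex_of x :: 'n arrow_complex, complex_of y) \<in> complex_isomorphism"
  shows "x = y"
proof -
  have inj: "inj_on (defect_key N) (set patterns)"
    using distinct_defect_keys[OF card(2)] by (simp add: distinct_map)
  have count: "defect_count (complex_of x :: 'n arrow_complex) m = defect_count (complex_of y :: 'n arrow_complex) m" for m
    by (rule defect_count_isomorphic[OF iso])
  have "defect_key N x = defect_key N y"
    using count[of "2 * N + 1 + 0"] count[of "2 * N + 1 + N * (N - 1)"] count[of "2 * N + 1 + 1"] count[of "2 * N + 1 + 2"]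
    unfolding complex_of_def defect_key_def
    by (cases x; cases y) (simp only: prod.case defect_count_pattern_complex[OF card(1)] Let_def)
  then show ?thesis using inj xy by (auto dest: inj_onD)
qed

lemma card_quotient_patterns:
  fixes S :: "'n::{finite,linorder} arrow_complex set"
  assumes card: "CARD('n) = N + 2" "N \<ge> 3" and xs: "set xs \<subseteq> set patterns" "distinct xs"
    and reps: "\<And>x. x \<in> set xs \<Longrightarrow> complex_of x \<in> S"
    and cover: "\<And>K. K \<in> S \<Longrightarrow> \<exists>x\<in>set xs. (K, complex_of x) \<in> complex_isomorphism"
  shows "card (S // complex_isomorphism) = length xs"
proof -
  have refl: "(K, K) \<in> complex_isomorphism" for K :: "'n arrow_complex"
    using equiv_complex_isomorphism by (meson equiv_def UNIV_I refl_onD)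
  have "card (S // complex_isomorphism) = card ((complex_of :: pattern \<Rightarrow> 'n arrow_complex) ` set xs)"
  proof (rule card_quotient_representatives[OF equiv_complex_isomorphism])
    show "complex_of ` set xs \<subseteq> S" using reps by auto
    show "\<exists>y\<in>complex_of ` set xs. (K, y) \<in> complex_isomorphism" if "K \<in> S" for K
      using cover[OF that] by blast
    fix K L :: "'n arrow_complex"
    assume "K \<in> complex_of ` set xs" "L \<in> complex_of ` set xs" and iso: "(K, L) \<in> complex_isomorphism"
    then obtain x y where "x \<in> set xs" "y \<in> set xs" "K = complex_of x" "L = complex_of y" by auto
    then show "K = L" using complex_of_distinct[OF card, of x y] xs(1) iso by blast
  qed
  also have "\<dots> = card (set xs)"
  proof (rule card_image, rule inj_onI)
    fix x y assume "x \<in> set xs" "y \<in> set xs" "(complex_of x :: 'n arrow_complex) = complex_of y"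
    then show "x = y" using complex_of_distinct[OF card, of x y] xs(1) refl by auto
  qed
  also have "\<dots> = length xs" by (rule distinct_card[OF xs(2)])
  finally show ?thesis .
qed

text \<open>The four alternatives are the images under the identity, reversal, negation and their
  composite.\<close>

lemma pattern_complex_orbit:
  assumes "(A, B, C, D, E, G) \<in> set xs \<or> (B, A, C, D, G, E) \<in> set xs \<or>
    (B, A, D, C, G, E) \<in> set xs \<or> (A, B, D, C, E, G) \<in> set xs"
  shows "\<exists>x\<in>set xs. (pattern_complex A B C D E G :: 'n::{finite,linorder} arrow_complex, complex_of x) \<in> complex_isomorphism"
proof -
  have of: "(complex_of (a, b, c, d, e, g) :: 'n arrow_complex) = pattern_complex a b c d e g" for a b c d e g
    by (simp add: complex_of_def)
  have refl: "(K, K) \<in> complex_isomorphism" for K :: "'n arrow_complex"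
    using equiv_complex_isomorphism by (meson equiv_def UNIV_I refl_onD)
  have trans: "(K, L) \<in> complex_isomorphism \<Longrightarrow> (L, M) \<in> complex_isomorphism \<Longrightarrow> (K, M) \<in> complex_isomorphism"
    for K L M :: "'n arrow_complex"
    using equiv_complex_isomorphism by (meson equiv_def transD)
  have both: "(pattern_complex A B C D E G :: 'n arrow_complex, pattern_complex A B D C E G) \<in> complex_isomorphism"
    by (rule trans[OF pattern_complex_reversal pattern_complex_negation])
  from assms show ?thesis
  proof (elim disjE)
    assume "(A, B, C, D, E, G) \<in> set xs"
    then show ?thesis by (rule bexI[rotated]) (simp only: of refl)
  next
    assume "(B, A, C, D, G, E) \<in> set xs"
    then show ?thesis by (rule bexI[rotated]) (simp only: of pattern_complex_reversal)
  next
    assume "(B, A, D, C, G, E) \<in> set xs"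
    then show ?thesis by (rule bexI[rotated]) (simp only: of pattern_complex_negation)
  next
    assume "(A, B, D, C, E, G) \<in> set xs"
    then show ?thesis by (rule bexI[rotated]) (simp only: of both)
  qed
qed

lemma pattern_complex_classes:
  assumes "CARD('n::{finite,linorder}) \<ge> 4"
  shows "lex_class (pattern_complex A B C D E G :: 'n arrow_complex) \<longleftrightarrow> \<not> A \<and> \<not> B \<and> \<not> C \<and> \<not> D"
    and "revlex_class (pattern_complex A B C D E G :: 'n arrow_complex) \<longleftrightarrow> A \<and> B \<and> C \<and> D"
    and "simion_class (pattern_complex A B C D E G :: 'n arrow_complex) \<longleftrightarrow> A \<noteq> B \<and> (C \<and> D \<longrightarrow> E \<and> G)"
    and "simion_class_a (pattern_complex A B C D E G :: 'n arrow_complex) \<longleftrightarrow> A \<noteq> B \<and> \<not> C \<and> \<not> D"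
    and "simion_class_b (pattern_complex A B C D E G :: 'n arrow_complex) \<longleftrightarrow> A \<noteq> B \<and> C \<noteq> D"
    and "simion_class_c (pattern_complex A B C D E G :: 'n arrow_complex) \<longleftrightarrow> A \<noteq> B \<and> C \<and> D \<and> E \<and> G"
  unfolding lex_class_def revlex_class_def simion_class_a_def simion_class_b_def simion_class_c_def simion_class_def
    pattern_complex_types[OF assms] by auto

theorem theorem5p1:
  fixes n :: nat
    and U :: "'n::{finite,linorder} arrow_complex set"
  assumes "n \<ge> 4"
    and "CARD('n) = n + 1"
    and "U = {K. uniform_flag_triangulation K}"
  shows "card ({K \<in> U. lex_class K \<or> revlex_class K \<or> simion_class K} // complex_isomorphism) = 15 \<and>
    card ({K \<in> U. lex_class K} // complex_isomorphism) = 3 \<and>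
    card ({K \<in> U. revlex_class K} // complex_isomorphism) = 3 \<and>
    card ({K \<in> U. simion_class_a K} // complex_isomorphism) = 4 \<and>
    card ({K \<in> U. simion_class_b K} // complex_isomorphism) = 4 \<and>
    card ({K \<in> U. simion_class_c K} // complex_isomorphism) = 1 \<and>
    (n \<ge> 5 \<longrightarrow> card (U // complex_isomorphism) = 15)"
proof -
  \<comment> \<open>The number of indices other than the two endpoints of an arrow.\<close>
  define N where "N = n - 1"
  have N: "CARD('n) = N + 2" "N \<ge> 3" using assms(1,2) by (simp_all add: N_def)
  have card: "CARD('n) \<ge> 4" "CARD('n) \<ge> 2" using assms(1,2) by simp_all
  note classes = pattern_complex_classes[OF card(1)]
  note lists = lex_patterns_def revlex_patterns_def simion_patterns_a_def simion_patterns_b_def simion_patterns_c_def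
  have subset: "set lex_patterns \<subseteq> set patterns" "set revlex_patterns \<subseteq> set patterns"
    "set simion_patterns_a \<subseteq> set patterns" "set simion_patterns_b \<subseteq> set patterns"
    "set simion_patterns_c \<subseteq> set patterns"
    by (auto simp: patterns_def)
  have distinct: "distinct patterns"
    using distinct_defect_keys[OF N(2)] by (simp add: distinct_map)
  then have distincts: "distinct lex_patterns" "distinct revlex_patterns" "distinct simion_patterns_a"
    "distinct simion_patterns_b" "distinct simion_patterns_c"
    by (simp_all add: patterns_def)
  have pattern: "\<exists>A B C D E G. K = pattern_complex A B C D E G" if "K \<in> U" for K
  proof -
    have "uniform_flag_triangulation K" using that assms(3) by simp
    then obtain A B C D E G where "K = pattern_complex A B C D E G"
      using uniform_flag_triangulation_is_pattern_complex[OF _ card(1)] by metis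
    then show ?thesis by (intro exI)
  qed
  \<comment> \<open>Inside a class, the class conditions already confine a pattern to the orbits of
    the listed ones, so the counts hold from five indices on.\<close>
  have count: "card ({K \<in> U. P K} // complex_isomorphism) = length xs"
    if xs: "set xs \<subseteq> set patterns" "distinct xs"
      and good: "\<And>A B C D E G. (A, B, C, D, E, G) \<in> set xs \<Longrightarrow> good_pattern A B C D E G \<and> P (pattern_complex A B C D E G)"
      and cover: "\<And>A B C D E G. uniform_flag_triangulation (pattern_complex A B C D E G :: 'n arrow_complex) \<Longrightarrow>
        P (pattern_complex A B C D E G) \<Longrightarrow>
        (A, B, C, D, E, G) \<in> set xs \<or> (B, A, C, D, G, E) \<in> set xs \<or> (B, A, D, C, G, E) \<in> set xs \<or> (A, B, D, C, E, G) \<in> set xs"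
    for P :: "'n arrow_complex \<Rightarrow> bool" and xs
  proof (rule card_quotient_patterns[OF N xs])
    fix x assume "x \<in> set xs"
    moreover obtain A B C D E G where "x = (A, B, C, D, E, G)" by (cases x)
    ultimately show "complex_of x \<in> {K \<in> U. P K}"
      using good[of A B C D E G] uniform_flag_triangulation_pattern_complex[OF _ card(2), of A B C D E G] assms(3)
      by (simp add: complex_of_def)
  next
    fix K assume K: "K \<in> {K \<in> U. P K}"
    then obtain A B C D E G where eq: "K = pattern_complex A B C D E G" using pattern by blast
    show "\<exists>x\<in>set xs. (K, complex_of x) \<in> complex_isomorphism"
      unfolding eq by (rule pattern_complex_orbit, rule cover) (use K eq assms(3) in auto)
  qed
  have lex: "card ({K \<in> U. lex_class K} // complex_isomorphism) = length lex_patterns"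
  proof (rule count[OF subset(1) distincts(1)], goal_cases)
    case (1 A B C D E G)
    then show ?case unfolding classes by (auto simp: lists good_pattern_def)
  next
    case (2 A B C D E G)
    from 2(2) show ?case
      unfolding classes by (cases A; cases B; cases C; cases D; cases E; cases G; simp add: lists)
  qed
  have revlex: "card ({K \<in> U. revlex_class K} // complex_isomorphism) = length revlex_patterns"
  proof (rule count[OF subset(2) distincts(2)], goal_cases)
    case (1 A B C D E G)
    then show ?case unfolding classes by (auto simp: lists good_pattern_def)
  next
    case (2 A B C D E G)
    from 2(2) show ?case
      unfolding classes by (cases A; cases B; cases C; cases D; cases E; cases G; simp add: lists)
  qed
  have a: "card ({K \<in> U. simion_class_a K} // complex_isomorphism) = length simion_patterns_a"
  proof (rule count[OF subset(3) distincts(3)], goal_cases)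
    case (1 A B C D E G)
    then show ?case unfolding classes by (auto simp: lists good_pattern_def)
  next
    case (2 A B C D E G)
    from 2(2) show ?case
      unfolding classes by (cases A; cases B; cases C; cases D; cases E; cases G; simp add: lists)
  qed
  have b: "card ({K \<in> U. simion_class_b K} // complex_isomorphism) = length simion_patterns_b"
  proof (rule count[OF subset(4) distincts(4)], goal_cases)
    case (1 A B C D E G)
    then show ?case unfolding classes by (auto simp: lists good_pattern_def)
  next
    case (2 A B C D E G)
    from 2(2) show ?case
      unfolding classes by (cases A; cases B; cases C; cases D; cases E; cases G; simp add: lists)
  qed
  have c: "card ({K \<in> U. simion_class_c K} // complex_isomorphism) = length simion_patterns_c"
  proof (rule count[OF subset(5) distincts(5)], goal_cases)
    case (1 A B C D E G)
    then show ?case unfolding classes by (auto simp: lists good_pattern_def)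
  next
    case (2 A B C D E G)
    from 2(2) show ?case
      unfolding classes by (cases A; cases B; cases C; cases D; cases E; cases G; simp add: lists)
  qed
  have all: "card ({K \<in> U. lex_class K \<or> revlex_class K \<or> simion_class K} // complex_isomorphism) = length patterns"
  proof (rule count[OF order.refl distinct], goal_cases)
    case (1 A B C D E G)
    then show ?case unfolding classes by (auto simp: patterns_def lists good_pattern_def)
  next
    case (2 A B C D E G)
    from 2(2) show ?case
      unfolding classes by (cases A; cases B; cases C; cases D; cases E; cases G; simp add: patterns_def lists)
  qed
  \<comment> \<open>With six indices the hexagons are available, and every uniform flag
    triangulation falls into one of the classes.\<close>
  have large: "card (U // complex_isomorphism) = length patterns" if "n \<ge> 5"
  proof -
    have "CARD('n) \<ge> 6" using that assms(2) by simp
    have "lex_class K \<or> revlex_class K \<or> simion_class K" if "K \<in> U" for K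
    proof -
      obtain A B C D E G where eq: "K = pattern_complex A B C D E G" using pattern[OF \<open>K \<in> U\<close>] by blast
      have "uniform_flag_triangulation (pattern_complex A B C D E G :: 'n arrow_complex)"
        using that assms(3) eq by simp
      from pattern_classification[OF this \<open>CARD('n) \<ge> 6\<close>] show ?thesis
        unfolding eq classes by blast
    qed
    then have "{K \<in> U. lex_class K \<or> revlex_class K \<or> simion_class K} = U" by blast
    then show ?thesis using all by simp
  qed
  show ?thesis
    using lex revlex a b c all large by (simp add: patterns_def lists)
qed

end
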